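(* The monodromy group of a polynomial of degree at most $5$ is completely determined by its critical portrait. That is: if $f,g\in\mathbb{C}[x]$ are non-constant polynomials of the same degree $d\le 5$ having identical critical portraits, then $MG(f)$ and $MG(g)$ are conjugate as subgroups of the symmetric group $S_d$.
   Context: Let $f\in\mathbb{C}[x]$ have degree $d\geq 1$ and let $\mathcal V$ be its set of critical values. For $p\in\mathbb{C}\setminus \mathcal V$, lifting closed loops at $p$ in $\mathbb{C}\setminus \mathcal V$ through the covering $f:\mathbb{C}\setminus f^{-1}(\mathcal V)\to\mathbb{C}\setminus \mathcal V$ gives an action of $\pi_1(\mathbb{C}\setminus \mathcal V,p)$ on the $d$ points of $f^{-1}(p)$; the resulting group of permutations, viewed as a subgroup of $S_d$ (well defined up to conjugacy, independently of $p$), is the monodromy group $MG(f)$. The critical portrait of $f$ is the number and multiplicity of its critical values: for each critical value $v\in \mathcal V$ one records the multiset of local degrees (orders) of $f$ at the critical points lying over $v$, and the critical portrait is the collection (multiset, indexed by the critical values) of these multisets. Two polynomials have identical critical portraits if there is a bijection between their sets of critical values under which corresponding critical values have the same multiset of local degrees at the critical points above them. *)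

theory Defs
  imports
    "HOL-Analysis.Analysis"
    "HOL-Computational_Algebra.Polynomial"
    "HOL-Library.Multiset"
    "HOL-Algebra.Sym_Groups"
begin

definition critical_points :: "complex poly \<Rightarrow> complex set" where
  "critical_points f = {z. poly (pderiv f) z = 0}"

definition critical_values :: "complex poly \<Rightarrow> complex set" where
  "critical_values f = poly f ` critical_points f"

definition fibre :: "complex poly \<Rightarrow> complex \<Rightarrow> complex set" where
  "fibre f p = {z. poly f z = p}"

(* HOL-Algebra reuses the name "order", hence the qualified name for root multiplicity. *)
definition local_degree :: "complex poly \<Rightarrow> complex \<Rightarrow> nat" where
  "local_degree f z = Polynomial.order z (f - [:poly f z:])"

definition critical_local_degrees :: "complex poly \<Rightarrow> complex \<Rightarrow> nat multiset" where
  "critical_local_degrees f v =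
     image_mset (local_degree f) (mset_set (critical_points f \<inter> fibre f v))"

definition identical_critical_portraits :: "complex poly \<Rightarrow> complex poly \<Rightarrow> bool" where
  "identical_critical_portraits f g \<longleftrightarrow>
     (\<exists>\<phi>. bij_betw \<phi> (critical_values f) (critical_values g) \<and>
          (\<forall>v\<in>critical_values f.
             critical_local_degrees g (\<phi> v) = critical_local_degrees f v))"

(* A lift of a path avoiding the critical values automatically avoids their preimage,
   so it need not be required explicitly. *)
definition is_lift ::
    "complex poly \<Rightarrow> (real \<Rightarrow> complex) \<Rightarrow> (real \<Rightarrow> complex) \<Rightarrow> bool" where
  "is_lift f \<gamma> c \<longleftrightarrow> path c \<and> (\<forall>t\<in>{0..1}. poly f (c t) = \<gamma> t)"

definition loop_avoiding_critical_values ::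
    "complex poly \<Rightarrow> complex \<Rightarrow> (real \<Rightarrow> complex) \<Rightarrow> bool" where
  "loop_avoiding_critical_values f p \<gamma> \<longleftrightarrow>
     path \<gamma> \<and> pathstart \<gamma> = p \<and> pathfinish \<gamma> = p \<and> path_image \<gamma> \<subseteq> - critical_values f"

(* The image of the fundamental group based at p in the symmetric group of the fibre over p.
   Homotopic loops act identically, so it suffices to range over the loops themselves; lifts
   with a given starting point exist and are unique, so each loop induces exactly one
   permutation. *)
definition fibre_monodromy :: "complex poly \<Rightarrow> complex \<Rightarrow> (complex \<Rightarrow> complex) set" where
  "fibre_monodromy f p =
     {\<sigma>. \<sigma> permutes fibre f p \<and>
          (\<exists>\<gamma>. loop_avoiding_critical_values f p \<gamma> \<and>
            (\<forall>x\<in>fibre f p. \<exists>c. is_lift f \<gamma> c \<and> pathstart c = x \<and> pathfinish c = \<sigma> x))}"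

(* The same group inside the symmetric group on {1..d}, where d is the degree, for a
   numbering b of the fibre.  The group is only well defined up to the choice of p and b,
   that is, up to conjugacy. *)
definition monodromy_group ::
    "complex poly \<Rightarrow> complex \<Rightarrow> (nat \<Rightarrow> complex) \<Rightarrow> (nat \<Rightarrow> nat) set" where
  "monodromy_group f p b =
     {\<tau> \<in> carrier (sym_group (degree f)).
        \<exists>\<sigma>\<in>fibre_monodromy f p. \<forall>i\<in>{1..degree f}. b (\<tau> i) = \<sigma> (b i)}"

definition conjugate_subgroups :: "('a, 'm) monoid_scheme \<Rightarrow> 'a set \<Rightarrow> 'a set \<Rightarrow> bool" where
  "conjugate_subgroups G H K \<longleftrightarrow>
     subgroup H G \<and> subgroup K G \<and>
     (\<exists>s\<in>carrier G. K = s <#\<^bsub>G\<^esub> (H #>\<^bsub>G\<^esub> inv\<^bsub>G\<^esub> s))"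

end

(* An element of the monodromy group is obtained from lifts of a loop, and a small loop around a critical
   value v permutes the fibre with the cycle type given by the local degrees over v.  So the group, which is
   transitive because the complement of a finite set is path-connected, contains a transposition, a 3-cycle
   or a non-trivial permutation with a fixed point, depending on the portrait.  Conversely, continuity along lifts shows that the group preserves every
   algebraic relation between points of a fibre that cannot degenerate away from the critical values: the
   deck transformations of a (x - c)^d + v, the involution s - x if f is a quadratic polynomial in
   (x - s/2)^2, the two quadratic factors of (f(x) - f(y)) / (x - y) for a Chebyshev quintic, and a
   square root of the discriminant if every critical value counts twice.  In degree at most 5 these lower
   and upper bounds meet, except for quartics without a critical value of type (2,2) or (4), where the
   curve of unordered pairs in a fibre is rational and hence connected.  The resulting group depends only
   on the portrait. *)
theory Submission
  imports
    Defs
    "HOL-Complex_Analysis.Conformal_Mappings"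
    "HOL-Computational_Algebra.Fundamental_Theorem_Algebra"
    "HOL-Computational_Algebra.Primes"
begin

section \<open>Fibres and local normal forms\<close>

text \<open>Generators of the fundamental group of the punctured plane are never determined: each
  small loop supplies one element of the group, with no claim that these elements generate. Upper
  bounds therefore come from invariants carried along arbitrary loops, and equality is mostly
  reached through point stabilizers: a transitive subgroup that contains the stabilizer of one point
  in a larger group is all of it. In prime degree an invariant equivalence relation is trivial, so
  one transposition or one 3-cycle spreads to all of them. In degree 4 this fails, because the
  dihedral group of order 8 is transitive and contains transpositions; hence the separate argument
  on unordered pairs. Conjugacy is obtained without relating base points: for every non-critical
  \<open>p\<close> some numbering of the fibre turns the group into one fixed set
  \<open>monodromy_model\<close>, which depends on the degree and the profiles only, and two
  numberings of one fibre differ by a permutation.\<close>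

lemma fibre_altdef: "fibre f w = {z. poly (f - [:w:]) z = 0}"
  by (simp add: fibre_def)

lemma mem_fibre: "z \<in> fibre f w \<longleftrightarrow> poly f z = w"
  by (simp add: fibre_def)

lemma degree_minus_const:
  assumes "0 < degree f"
  shows "degree (f - [:w::complex:]) = degree f"
proof -
  have "degree (f + - [:w:]) = degree f"
    using assms by (intro degree_add_eq_left) simp
  then show ?thesis by (simp only: add_uminus_conv_diff)
qed

lemma minus_const_nonzero:
  assumes "0 < degree f"
  shows "f - [:w::complex:] \<noteq> 0"
  using degree_minus_const[OF assms, of w] assms by fastforce

lemma finite_fibre: "0 < degree f \<Longrightarrow> finite (fibre f w)"
  unfolding fibre_altdef by (intro poly_roots_finite minus_const_nonzero)

lemma pderiv_nonzero: "0 < degree f \<Longrightarrow> pderiv f \<noteq> 0" for f :: "complex poly"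
  by (simp add: pderiv_eq_0_iff)

lemma finite_critical_points: "0 < degree f \<Longrightarrow> finite (critical_points f)"
  unfolding critical_points_def by (intro poly_roots_finite pderiv_nonzero)

lemma finite_critical_values: "0 < degree f \<Longrightarrow> finite (critical_values f)"
  unfolding critical_values_def by (intro finite_imageI finite_critical_points)

text \<open>Subtracting a constant does not change the derivative, and in characteristic 0
  differentiation lowers the order of a zero by exactly one. This ties local degrees to the roots of
  \<open>pderiv f\<close>.\<close>

lemma local_degree_eq_Suc:
  assumes "0 < degree f"
  shows "local_degree f z = Suc (Polynomial.order z (pderiv f))"
proof -
  have "pderiv (f - [:poly f z:]) = pderiv f"
    by (simp add: pderiv_diff pderiv_pCons)
  then show ?thesis
    unfolding local_degree_def
    using order_pderiv[OF minus_const_nonzero[OF assms], of "poly f z" z] by simp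
qed

lemma local_degree_pos: "0 < degree f \<Longrightarrow> 0 < local_degree f z"
  by (simp add: local_degree_eq_Suc)

lemma local_degree_eq_1_iff:
  assumes "0 < degree f"
  shows "local_degree f z = 1 \<longleftrightarrow> z \<notin> critical_points f"
  unfolding local_degree_eq_Suc[OF assms] critical_points_def
  using pderiv_nonzero[OF assms] by (auto simp: order_root)

lemma sum_order_roots:
  fixes q :: "complex poly"
  assumes "q \<noteq> 0"
  shows "(\<Sum>z | poly q z = 0. Polynomial.order z q) = degree q"
proof -
  have "(\<Sum>z | poly q z = 0. Polynomial.order z q) = size (proots q)"
    using assms by (simp add: size_multiset_overloaded_eq)
  then show ?thesis by (simp add: size_proots_complex)
qed

text \<open>The fundamental theorem of algebra for \<open>f - w\<close>; the later counts of sheets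
  and of fibre points rest on it.\<close>

lemma sum_local_degree:
  assumes "0 < degree f"
  shows "(\<Sum>z\<in>fibre f w. local_degree f z) = degree f"
proof -
  have "(\<Sum>z\<in>fibre f w. local_degree f z) = (\<Sum>z\<in>fibre f w. Polynomial.order z (f - [:w:]))"
    by (intro sum.cong) (auto simp: local_degree_def mem_fibre)
  then show ?thesis
    unfolding fibre_altdef
    using sum_order_roots[OF minus_const_nonzero[OF assms]] degree_minus_const[OF assms] by simp
qed

lemma local_degree_noncritical_value:
  assumes "0 < degree f" "w \<notin> critical_values f" "z \<in> fibre f w"
  shows "local_degree f z = 1"
  using assms local_degree_eq_1_iff[OF assms(1)] by (auto simp: critical_values_def mem_fibre)

lemma card_fibre:
  assumes "0 < degree f" "w \<notin> critical_values f"
  shows "card (fibre f w) = degree f"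
  using sum_local_degree[OF assms(1), of w] local_degree_noncritical_value[OF assms] by simp

lemma card_fibre_le:
  assumes "0 < degree f"
  shows "card (fibre f w) \<le> degree f"
proof -
  have "(\<Sum>z\<in>fibre f w. 1) \<le> (\<Sum>z\<in>fibre f w. local_degree f z)"
    by (intro sum_mono) (use local_degree_pos[OF assms] in \<open>auto simp: Suc_le_eq\<close>)
  then show ?thesis by (simp add: sum_local_degree[OF assms])
qed

text \<open>Write \<open>f - f(z)\<close> as \<open>(x - z)^m q\<close> with \<open>q\<close>
  nonzero at \<open>z\<close>. Near \<open>z\<close> the factor \<open>q\<close> has a holomorphic
  logarithm, hence an m-th root, and \<open>h\<close> is \<open>x - z\<close> times that root: a
  simple zero, so \<open>h\<close> is locally invertible. The radius \<open>root m R\<close> makes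
  \<open>u ^ m\<close> cover the disc of radius \<open>R\<close> exactly, so that one
  \<open>R\<close> can serve all points of a fibre.\<close>

lemma local_normal_form:
  fixes z :: complex
  assumes deg: "0 < degree f" and "0 < e"
  defines "m \<equiv> local_degree f z"
  shows "\<exists>\<rho>>0. \<forall>R. 0 < R \<and> R \<le> \<rho> \<longrightarrow> (\<exists>U h k. open U \<and> z \<in> U \<and> U \<subseteq> ball z e \<and>
           homeomorphism U (ball 0 (root m R)) h k \<and> (\<forall>x\<in>U. poly f x = poly f z + h x ^ m))"
proof -
  have m: "0 < m" using local_degree_pos[OF deg] by (simp add: m_def)
  let ?p = "f - [:poly f z:]"
  obtain q where q: "?p = [:-z, 1:] ^ m * q" and qz: "\<not> [:-z, 1:] dvd q"
    using order_decomp[OF minus_const_nonzero[OF deg], of "poly f z" z]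
    unfolding m_def local_degree_def by blast
  have qz0: "poly q z \<noteq> 0" using qz by (simp add: poly_eq_0_iff_dvd)
  have fx: "poly f x = poly f z + (x - z) ^ m * poly q x" for x
  proof -
    have "poly ?p x = (x - z) ^ m * poly q x" unfolding q by (simp add: poly_power)
    then show ?thesis by (simp add: algebra_simps)
  qed
  have "\<exists>d>0. \<forall>x. dist x z < d \<longrightarrow> dist (poly q x) (poly q z) < norm (poly q z)"
  proof -
    have "isCont (\<lambda>x. poly q x) z" by (intro continuous_intros)
    then show ?thesis using qz0 unfolding continuous_at_eps_delta by auto
  qed
  then obtain d where d: "d > 0" "\<And>x. dist x z < d \<Longrightarrow> dist (poly q x) (poly q z) < norm (poly q z)"
    by blast
  let ?B = "ball z d"
  have nz: "poly q x \<noteq> 0" if "x \<in> ?B" for x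
    using d(2)[of x] that by (auto simp: dist_commute)
  have "(\<lambda>x. poly q x) holomorphic_on ?B"
    using poly_holomorphic_on[OF holomorphic_on_ident] by blast
  then obtain g0 where g0: "g0 holomorphic_on ?B" "\<And>x. x \<in> ?B \<Longrightarrow> poly q x = exp (g0 x)"
    by (rule contractible_imp_holomorphic_log[OF _ convex_imp_contractible[OF convex_ball] nz])
      (assumption | rule that)+
  define h where "h = (\<lambda>x. (x - z) * exp (g0 x / of_nat m))"
  have hol: "h holomorphic_on ?B"
    unfolding h_def by (intro holomorphic_intros g0(1)) (use m in auto)
  have hm: "poly f x = poly f z + h x ^ m" if "x \<in> ?B" for x
  proof -
    have "exp (g0 x / of_nat m) ^ m = exp (g0 x)"
      using m by (simp flip: exp_of_nat_mult)
    then show ?thesis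
      unfolding h_def power_mult_distrib using g0(2)[OF that] fx[of x] by simp
  qed
  have hz: "h z = 0" by (simp add: h_def)
  have "(h has_field_derivative exp (g0 z / of_nat m)) (at z)"
  proof -
    define E where "E = (\<lambda>x. exp (g0 x / of_nat m))"
    have "E holomorphic_on ?B"
      unfolding E_def by (intro holomorphic_intros g0(1)) (use m in auto)
    then have "(E has_field_derivative deriv E z) (at z)"
      using d(1) by (intro holomorphic_derivI[of _ ?B]) auto
    \<comment> \<open>In the product rule the term with the derivative of \<open>E\<close> carries
      the factor \<open>x - z\<close> and vanishes at \<open>z\<close>.\<close>
    then have "((\<lambda>x. (x - z) * E x) has_field_derivative E z) (at z)"
      by (auto intro!: derivative_eq_intros)
    then show ?thesis unfolding h_def E_def .
  qed
  then have dh: "deriv h z \<noteq> 0" using DERIV_imp_deriv by fastforce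
  have "h holomorphic_on ball z (min d e)"
    using hol by (rule holomorphic_on_subset) auto
  then obtain r where r: "r > 0" "ball z r \<subseteq> ball z (min d e)" "open (h ` ball z r)" "inj_on h (ball z r)"
    using has_complex_derivative_locally_invertible[of h "ball z (min d e)" z] dh d(1) \<open>0 < e\<close> by auto
  have hol': "h holomorphic_on ball z r"
    using r(2) by (intro holomorphic_on_subset[OF hol]) auto
  obtain k where k: "homeomorphism (ball z r) (h ` ball z r) h k"
    using invariance_of_domain_homeomorphism[of "ball z r" h] r(4) holomorphic_on_imp_continuous_on[OF hol'] by auto
  have "0 \<in> h ` ball z r" using hz r(1) by force
  then obtain \<rho> where \<rho>: "\<rho> > 0" "ball 0 \<rho> \<subseteq> h ` ball z r"
    using r(3) openE by blast
  have main: "\<exists>U h k. open U \<and> z \<in> U \<and> U \<subseteq> ball z e \<and>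
           homeomorphism U (ball 0 (root m R)) h k \<and> (\<forall>x\<in>U. poly f x = poly f z + h x ^ m)"
    if R: "0 < R" "R \<le> \<rho> ^ m" for R
  proof -
    define s where "s = root m R"
    have s0: "0 < s" using R m by (simp add: s_def)
    have "s \<le> root m (\<rho> ^ m)" unfolding s_def using R m by simp
    then have "s \<le> \<rho>" using \<rho>(1) m by (simp add: real_root_power_cancel)
    then have sub: "ball 0 s \<subseteq> h ` ball z r" using \<rho>(2) by auto
    let ?U = "ball z r \<inter> h -` ball 0 s"
    have "open ?U"
      using holomorphic_on_imp_continuous_on[OF hol'] continuous_open_preimage by blast
    moreover have "z \<in> ?U" using hz r(1) s0 by simp
    moreover have "?U \<subseteq> ball z e" using r(2) by auto
    moreover have "homeomorphism ?U (ball 0 s) h k"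
    proof (rule homeomorphism_of_subsets[OF k])
      show "h ` ?U = ball 0 s" using sub by blast
    qed auto
    moreover have "\<forall>x\<in>?U. poly f x = poly f z + h x ^ m" using hm r(2) by auto
    ultimately show ?thesis unfolding s_def by metis
  qed
  have "0 < \<rho> ^ m" using \<rho>(1) by simp
  with main show ?thesis by blast
qed

text \<open>Over the disc of radius \<open>R\<close> about \<open>w\<close> the polynomial is a
  disjoint union of discs on which it reads \<open>u \<mapsto> w + u ^ m\<close>. The final equation
  says that no sheet over the disc lies outside the charts.\<close>

definition fibre_chart ::
    "complex poly \<Rightarrow> complex \<Rightarrow> real \<Rightarrow> (complex \<Rightarrow> complex set) \<Rightarrow>
     (complex \<Rightarrow> complex \<Rightarrow> complex) \<Rightarrow> (complex \<Rightarrow> complex \<Rightarrow> complex) \<Rightarrow> bool" where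
  "fibre_chart f w R U h k \<longleftrightarrow>
     (\<forall>z\<in>fibre f w. open (U z) \<and> homeomorphism (U z) (ball 0 (root (local_degree f z) R)) (h z) (k z) \<and>
        (\<forall>x\<in>U z. poly f x = w + h z x ^ local_degree f z)) \<and>
     disjoint_family_on U (fibre f w) \<and> poly f -` ball w R = (\<Union>z\<in>fibre f w. U z)"

text \<open>Completeness of the charts is obtained by counting instead of compactness: over a value
  \<open>v \<noteq> w\<close> of the disc, the chart at \<open>z\<close> contributes as many points
  as the local degree at \<open>z\<close>, together already \<open>degree f\<close>, and a fibre has
  no more.\<close>

lemma fibre_charts:
  assumes deg: "0 < degree f"
  shows "\<exists>\<rho>>0. \<forall>R. 0 < R \<and> R \<le> \<rho> \<longrightarrow> (\<exists>U h k. fibre_chart f w R U h k)"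
proof -
  define m where "m = local_degree f"
  let ?X = "fibre f w"
  have fin: "finite ?X" by (rule finite_fibre[OF deg])
  then obtain e where e: "e > 0" "\<And>x y. x \<in> ?X \<Longrightarrow> y \<in> ?X \<Longrightarrow> dist x y < e \<Longrightarrow> x = y"
    using uniform_discrete_finite_iff[of ?X] unfolding uniform_discrete_def by blast
  \<comment> \<open>Half the separation of the fibre keeps charts at different points
    disjoint.\<close>
  have "\<forall>z\<in>?X. \<exists>\<rho>>0. \<forall>R. 0 < R \<and> R \<le> \<rho> \<longrightarrow> (\<exists>U h k. open U \<and> z \<in> U \<and> U \<subseteq> ball z (e/2) \<and>
           homeomorphism U (ball 0 (root (m z) R)) h k \<and> (\<forall>x\<in>U. poly f x = w + h x ^ m z))"
  proof
    fix z assume "z \<in> ?X"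
    then have "poly f z = w" by (simp add: mem_fibre)
    then show "\<exists>\<rho>>0. \<forall>R. 0 < R \<and> R \<le> \<rho> \<longrightarrow> (\<exists>U h k. open U \<and> z \<in> U \<and> U \<subseteq> ball z (e/2) \<and>
           homeomorphism U (ball 0 (root (m z) R)) h k \<and> (\<forall>x\<in>U. poly f x = w + h x ^ m z))"
      using local_normal_form[OF deg, of "e/2" z] e(1) unfolding m_def by simp
  qed
  then obtain \<rho> where \<rho>: "\<And>z. z \<in> ?X \<Longrightarrow> \<rho> z > 0"
    "\<And>z R. z \<in> ?X \<Longrightarrow> 0 < R \<and> R \<le> \<rho> z \<Longrightarrow> (\<exists>U h k. open U \<and> z \<in> U \<and> U \<subseteq> ball z (e/2) \<and>
           homeomorphism U (ball 0 (root (m z) R)) h k \<and> (\<forall>x\<in>U. poly f x = w + h x ^ m z))"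
    by metis
  define r where "r = Min (insert 1 (\<rho> ` ?X))"
  have r0: "0 < r" unfolding r_def using fin \<rho>(1) by (subst Min_gr_iff) auto
  have r: "r \<le> \<rho> z" if "z \<in> ?X" for z
    unfolding r_def using fin that by (intro Min_le) auto
  show ?thesis
  proof (intro exI[of _ r] conjI r0 allI impI)
    fix R assume R: "0 < R \<and> R \<le> r"
    then have "\<forall>z\<in>?X. \<exists>U h k. open U \<and> z \<in> U \<and> U \<subseteq> ball z (e/2) \<and>
           homeomorphism U (ball 0 (root (m z) R)) h k \<and> (\<forall>x\<in>U. poly f x = w + h x ^ m z)"
      using \<rho>(2) r by (meson order_trans)
    then obtain U h k where U: "\<And>z. z \<in> ?X \<Longrightarrow> open (U z) \<and> z \<in> U z \<and> U z \<subseteq> ball z (e/2) \<and>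
           homeomorphism (U z) (ball 0 (root (m z) R)) (h z) (k z) \<and> (\<forall>x\<in>U z. poly f x = w + h z x ^ m z)"
      by metis
    have disj: "disjoint_family_on U ?X"
      unfolding disjoint_family_on_def
    proof (intro ballI impI)
      fix x y assume xy: "x \<in> ?X" "y \<in> ?X" "x \<noteq> y"
      then have "ball x (e/2) \<inter> ball y (e/2) = {}"
        using e(2)[OF xy(1,2)] by (intro disjoint_ballI) force
      then show "U x \<inter> U y = {}" using U[OF xy(1)] U[OF xy(2)] by blast
    qed
    have mpos: "0 < m z" for z using local_degree_pos[OF deg] by (simp add: m_def)
    have norm_root: "norm u < root (m z) R \<longleftrightarrow> norm (u ^ m z) < R" for u :: complex and z
    proof -
      have "norm u < root (m z) R \<longleftrightarrow> root (m z) (norm u ^ m z) < root (m z) R"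
        using mpos[of z] by (simp add: real_root_power_cancel)
      then show ?thesis using mpos[of z] by (simp add: norm_power)
    qed
    have sub: "poly f x \<in> ball w R" if "z \<in> ?X" "x \<in> U z" for x z
    proof -
      have "h z x \<in> ball 0 (root (m z) R)"
        using U[OF that(1)] that(2) by (auto simp: homeomorphism_def)
      then have "norm (h z x ^ m z) < R" using norm_root[of "h z x" z] by simp
      then show ?thesis using U[OF that(1)] that(2) by (simp add: dist_norm)
    qed
    have sup: "x \<in> (\<Union>z\<in>?X. U z)" if x: "poly f x \<in> ball w R" for x
    proof (cases "poly f x = w")
      case True
      then have "x \<in> ?X" by (simp add: mem_fibre)
      then show ?thesis using U by blast
    next
      case False
      define v where "v = poly f x"
      \<comment> \<open>The points over \<open>v\<close> seen in the chart at \<open>z\<close>, one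
        for each root of order \<open>m z\<close> of \<open>v - w\<close>.\<close>
      let ?A = "\<lambda>z. k z ` {u. u ^ m z = v - w}"
      have ball: "u \<in> ball 0 (root (m z) R)" if "u ^ m z = v - w" for u z
        using x norm_root[of u z] that by (simp add: v_def dist_norm norm_minus_commute)
      have A: "?A z \<subseteq> U z \<inter> fibre f v" "card (?A z) = m z" if z: "z \<in> ?X" for z
      proof -
        have hom: "homeomorphism (U z) (ball 0 (root (m z) R)) (h z) (k z)" using U[OF z] by blast
        show "?A z \<subseteq> U z \<inter> fibre f v"
        proof
          fix y assume "y \<in> ?A z"
          then obtain u where u: "u ^ m z = v - w" "y = k z u" by blast
          then have "y \<in> U z" "h z y = u" using ball[OF u(1)] hom by (auto simp: homeomorphism_def)
          then show "y \<in> U z \<inter> fibre f v" using U[OF z] u by (auto simp: mem_fibre)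
        qed
        have "inj_on (k z) {u. u ^ m z = v - w}"
          by (rule inj_on_inverseI[of _ "h z"]) (use hom ball in \<open>auto simp: homeomorphism_def\<close>)
        then show "card (?A z) = m z"
          using card_nth_roots[of "v - w" "m z"] False mpos by (simp add: card_image v_def)
      qed
      have "card (\<Union>z\<in>?X. ?A z) = (\<Sum>z\<in>?X. card (?A z))"
      proof (rule card_UN_disjoint[OF fin])
        show "\<forall>z\<in>?X. finite (?A z)"
          using A(2) mpos by (metis card_eq_0_iff less_irrefl)
        show "\<forall>i\<in>?X. \<forall>j\<in>?X. i \<noteq> j \<longrightarrow> ?A i \<inter> ?A j = {}"
          using disj A(1) unfolding disjoint_family_on_def by blast
      qed
      also have "\<dots> = (\<Sum>z\<in>?X. m z)" using A(2) by simp
      also have "\<dots> = degree f" unfolding m_def by (rule sum_local_degree[OF deg])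
      finally have "card (\<Union>z\<in>?X. ?A z) = degree f" .
      moreover have "(\<Union>z\<in>?X. ?A z) \<subseteq> fibre f v" using A(1) by blast
      ultimately have "(\<Union>z\<in>?X. ?A z) = fibre f v"
        using card_fibre_le[OF deg, of v] by (intro card_seteq finite_fibre[OF deg]) simp_all
      moreover have "x \<in> fibre f v" by (simp add: v_def mem_fibre)
      ultimately show ?thesis using A(1) by blast
    qed
    have "poly f -` ball w R = (\<Union>z\<in>?X. U z)" using sub sup by auto
    then show "\<exists>U h k. fibre_chart f w R U h k"
      unfolding fibre_chart_def m_def[symmetric] using U disj by blast
  qed
qed

section \<open>Lifting paths and the monodromy action\<close>

text \<open>Over a non-critical value every local degree is 1, so each coordinate \<open>h z\<close>
  equals \<open>poly f - w\<close> and the charts themselves are the sheets.\<close>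

lemma covering_space_poly:
  assumes deg: "0 < degree f"
  shows "covering_space (poly f -` (- critical_values f)) (poly f) (- critical_values f)"
proof (rule covering_spaceI)
  let ?V = "critical_values f"
  have oV: "open (- ?V)"
    using finite_critical_values[OF deg] by (simp add: finite_imp_closed open_Compl)
  have oC: "open (poly f -` (- ?V))"
    using oV by (intro open_vimage) (auto intro: continuous_intros)
  show "continuous_on (poly f -` (- ?V)) (poly f)" by (intro continuous_intros)
  have "w \<in> poly f ` (poly f -` (- ?V))" if "w \<in> - ?V" for w
  proof -
    have "fibre f w \<noteq> {}" using card_fibre[OF deg, of w] deg that by fastforce
    then obtain z where "poly f z = w" by (auto simp: fibre_def)
    then show ?thesis using that by blast
  qed
  then show "poly f ` (poly f -` (- ?V)) = - ?V" by auto
  fix w assume w: "w \<in> - ?V"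
  obtain \<delta> where \<delta>: "\<delta> > 0" "ball w \<delta> \<subseteq> - ?V" using oV w openE by blast
  let ?X = "fibre f w"
  have m1: "local_degree f z = 1" if "z \<in> ?X" for z
    using local_degree_noncritical_value[OF deg _ that] w by blast
  obtain \<rho> where \<rho>: "\<rho> > 0" "\<And>R. 0 < R \<and> R \<le> \<rho> \<Longrightarrow> \<exists>U h k. fibre_chart f w R U h k"
    using fibre_charts[OF deg, of w] by auto
  define R where "R = min \<rho> \<delta>"
  have R: "0 < R \<and> R \<le> \<rho>" using \<rho>(1) \<delta>(1) by (simp add: R_def)
  obtain U h k where U: "\<And>z. z \<in> ?X \<Longrightarrow> open (U z)"
      "\<And>z. z \<in> ?X \<Longrightarrow> homeomorphism (U z) (ball 0 R) (h z) (k z)"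
      "\<And>z x. z \<in> ?X \<Longrightarrow> x \<in> U z \<Longrightarrow> poly f x = w + h z x"
      and disj: "disjoint_family_on U ?X" and UN: "poly f -` ball w R = (\<Union>z\<in>?X. U z)"
  proof -
    from \<rho>(2)[OF R] obtain U h k where "fibre_chart f w R U h k" by blast
    note * = this[unfolded fibre_chart_def]
    show ?thesis by (rule that[of U h k]) (use * m1 in simp_all)
  qed
  have sub: "ball w R \<subseteq> - ?V" using \<delta>(2) by (auto simp: R_def)
  show "\<exists>T. w \<in> T \<and> openin (top_of_set (- ?V)) T \<and>
         (\<exists>v. \<Union>v = poly f -` (- ?V) \<inter> poly f -` T \<and>
            (\<forall>u\<in>v. openin (top_of_set (poly f -` (- ?V))) u) \<and>
            pairwise disjnt v \<and> (\<forall>u\<in>v. \<exists>q. homeomorphism u T (poly f) q))"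
  proof (intro exI conjI)
    show "w \<in> ball w R" using R by simp
    show "openin (top_of_set (- ?V)) (ball w R)" using sub by (simp add: open_subset)
    show "\<Union> (U ` ?X) = poly f -` (- ?V) \<inter> poly f -` ball w R" using UN sub by blast
    have "U z \<subseteq> poly f -` (- ?V)" if "z \<in> ?X" for z using UN sub that by blast
    then show "\<forall>u\<in>U ` ?X. openin (top_of_set (poly f -` (- ?V))) u"
      using U(1) by (auto intro: open_subset)
    show "pairwise disjnt (U ` ?X)"
      using disj unfolding pairwise_def disjnt_def disjoint_family_on_def by fastforce
    show "\<forall>u\<in>U ` ?X. \<exists>q. homeomorphism u (ball w R) (poly f) q"
    proof
      fix u assume "u \<in> U ` ?X"
      then obtain z where z: "z \<in> ?X" "u = U z" by blast
      have "homeomorphism (ball 0 R) (ball w R) (\<lambda>u. w + u) (\<lambda>u. u - w)"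
        by (rule homeomorphismI)
          (auto intro!: continuous_intros simp: dist_norm norm_minus_commute)
      then have "homeomorphism (U z) (ball w R) ((\<lambda>u. w + u) \<circ> h z) (k z \<circ> (\<lambda>u. u - w))"
        using U(2)[OF z(1)] by (rule homeomorphism_compose[rotated])
      then have "homeomorphism (U z) (ball w R) (poly f) (k z \<circ> (\<lambda>u. u - w))"
        by (rule homeomorphism_cong) (use U(3)[OF z(1)] in auto)
      then show "\<exists>q. homeomorphism u (ball w R) (poly f) q" using z(2) by blast
    qed
  qed
qed

section \<open>Transport of fibre points along paths\<close>

definition avoiding_path :: "complex poly \<Rightarrow> (real \<Rightarrow> complex) \<Rightarrow> bool" where
  "avoiding_path f \<gamma> \<longleftrightarrow> path \<gamma> \<and> path_image \<gamma> \<subseteq> - critical_values f"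

text \<open>The choice is harmless: along an avoiding path a lift from a given fibre point exists
  and is unique. A function in place of quantified lifts makes the group laws equational.\<close>

definition transport :: "complex poly \<Rightarrow> (real \<Rightarrow> complex) \<Rightarrow> complex \<Rightarrow> complex" where
  "transport f \<gamma> x = pathfinish (SOME c. is_lift f \<gamma> c \<and> pathstart c = x)"

lemma avoiding_path_join:
  assumes "avoiding_path f \<gamma>" "avoiding_path f \<delta>" "pathfinish \<gamma> = pathstart \<delta>"
  shows "avoiding_path f (\<gamma> +++ \<delta>)"
  using assms path_image_join_subset[of \<gamma> \<delta>] by (auto simp: avoiding_path_def)

lemma avoiding_path_reverse: "avoiding_path f \<gamma> \<Longrightarrow> avoiding_path f (reversepath \<gamma>)"
  by (simp add: avoiding_path_def)

lemma loop_iff_avoiding_path: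
  "loop_avoiding_critical_values f p \<gamma> \<longleftrightarrow>
     avoiding_path f \<gamma> \<and> pathstart \<gamma> = p \<and> pathfinish \<gamma> = p"
  by (auto simp: loop_avoiding_critical_values_def avoiding_path_def)

lemma is_lift_join:
  assumes "is_lift f \<gamma> c" "is_lift f \<delta> d" "pathfinish c = pathstart d"
  shows "is_lift f (\<gamma> +++ \<delta>) (c +++ d)"
proof -
  have "path (c +++ d)" using assms by (simp add: is_lift_def)
  then show ?thesis using assms by (auto simp: is_lift_def joinpaths_def)
qed

lemma is_lift_reverse: "is_lift f \<gamma> c \<Longrightarrow> is_lift f (reversepath \<gamma>) (reversepath c)"
  by (auto simp: is_lift_def reversepath_def[abs_def] path_reversepath[unfolded reversepath_def[abs_def]])

lemma is_lift_endpoints: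
  assumes "is_lift f \<gamma> c"
  shows "pathstart c \<in> fibre f (pathstart \<gamma>)" "pathfinish c \<in> fibre f (pathfinish \<gamma>)"
  using assms by (auto simp: is_lift_def mem_fibre pathstart_def pathfinish_def)

context
  fixes f :: "complex poly"
  assumes deg: "0 < degree f"
begin

text \<open>The common point may occur at any time \<open>s\<close>; running back to time 0 then
  shows that distinct lifts never meet.\<close>

lemma lift_unique:
  assumes \<gamma>: "avoiding_path f \<gamma>" and c: "is_lift f \<gamma> c" and d: "is_lift f \<gamma> d"
    and s: "s \<in> {0..1}" "c s = d s" and t: "t \<in> {0..1}"
  shows "c t = d t"
proof (rule covering_space_lift_unique[where a = s and x = t, OF covering_space_poly[OF deg] _])
  have im: "\<gamma> t \<notin> critical_values f" if "t \<in> {0..1}" for t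
    using \<gamma> that unfolding avoiding_path_def path_image_def by blast
  show "continuous_on {0..1} \<gamma>" using \<gamma> by (simp add: avoiding_path_def path_def)
  show "\<gamma> \<in> {0..1} \<rightarrow> - critical_values f" using im by auto
  show "continuous_on {0..1} c" "continuous_on {0..1} d"
    using c d by (auto simp: is_lift_def path_def)
  show "c \<in> {0..1} \<rightarrow> poly f -` (- critical_values f)"
       "d \<in> {0..1} \<rightarrow> poly f -` (- critical_values f)"
    using c d im by (auto simp: is_lift_def)
  show "\<gamma> x = poly f (c x)" "\<gamma> x = poly f (d x)" if "x \<in> {0..1}" for x
    using c d that by (auto simp: is_lift_def)
qed (use s t in auto)

lemma lift_exists:
  assumes \<gamma>: "avoiding_path f \<gamma>" and x: "x \<in> fibre f (pathstart \<gamma>)"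
  shows "\<exists>c. is_lift f \<gamma> c \<and> pathstart c = x"
proof -
  have "pathstart \<gamma> \<notin> critical_values f"
    using \<gamma> pathstart_in_path_image by (auto simp: avoiding_path_def)
  then have "x \<in> poly f -` (- critical_values f)" using x by (simp add: mem_fibre)
  then obtain c where "path c" "pathstart c = x" "\<And>t. t \<in> {0..1} \<Longrightarrow> poly f (c t) = \<gamma> t"
    using covering_space_lift_path_strong[OF covering_space_poly[OF deg], of x \<gamma>] \<gamma> x
    by (auto simp: avoiding_path_def mem_fibre)
  then show ?thesis by (auto simp: is_lift_def)
qed

lemma transport_lift:
  assumes "avoiding_path f \<gamma>" "is_lift f \<gamma> c"
  shows "transport f \<gamma> (pathstart c) = pathfinish c"
proof -
  let ?c = "SOME c'. is_lift f \<gamma> c' \<and> pathstart c' = pathstart c"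
  have "is_lift f \<gamma> ?c \<and> pathstart ?c = pathstart c"
    by (rule someI[where x = c]) (use assms(2) in simp)
  then have "?c 1 = c 1"
    using lift_unique[OF assms(1) _ assms(2), of ?c 0 1] by (simp add: pathstart_def)
  then show ?thesis by (simp add: transport_def pathfinish_def)
qed

lemma transport_join:
  assumes \<gamma>: "avoiding_path f \<gamma>" and \<delta>: "avoiding_path f \<delta>" and e: "pathfinish \<gamma> = pathstart \<delta>"
    and x: "x \<in> fibre f (pathstart \<gamma>)"
  shows "transport f (\<gamma> +++ \<delta>) x = transport f \<delta> (transport f \<gamma> x)"
proof -
  obtain c where c: "is_lift f \<gamma> c" "pathstart c = x" using lift_exists[OF \<gamma> x] by blast
  obtain d where d: "is_lift f \<delta> d" "pathstart d = pathfinish c"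
    using lift_exists[OF \<delta>] is_lift_endpoints(2)[OF c(1)] e by metis
  show ?thesis
    using transport_lift[OF avoiding_path_join[OF \<gamma> \<delta> e] is_lift_join[OF c(1) d(1)]]
      transport_lift[OF \<gamma> c(1)] transport_lift[OF \<delta> d(1)] c d by simp
qed

lemma transport_in_fibre:
  assumes "avoiding_path f \<gamma>" "x \<in> fibre f (pathstart \<gamma>)"
  shows "transport f \<gamma> x \<in> fibre f (pathfinish \<gamma>)"
  using lift_exists[OF assms] transport_lift[OF assms(1)] is_lift_endpoints(2) by metis

lemma transport_reverse:
  assumes \<gamma>: "avoiding_path f \<gamma>" and x: "x \<in> fibre f (pathstart \<gamma>)"
  shows "transport f (reversepath \<gamma>) (transport f \<gamma> x) = x"
proof -
  obtain c where c: "is_lift f \<gamma> c" "pathstart c = x" using lift_exists[OF \<gamma> x] by blast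
  show ?thesis
    using transport_lift[OF \<gamma> c(1)] c(2)
      transport_lift[OF avoiding_path_reverse[OF \<gamma>] is_lift_reverse[OF c(1)]] by simp
qed

lemma bij_betw_transport:
  assumes \<gamma>: "avoiding_path f \<gamma>"
  shows "bij_betw (transport f \<gamma>) (fibre f (pathstart \<gamma>)) (fibre f (pathfinish \<gamma>))"
proof (rule bij_betwI[where g = "transport f (reversepath \<gamma>)"])
  show "transport f \<gamma> \<in> fibre f (pathstart \<gamma>) \<rightarrow> fibre f (pathfinish \<gamma>)"
    using transport_in_fibre[OF \<gamma>] by blast
  show "transport f (reversepath \<gamma>) \<in> fibre f (pathfinish \<gamma>) \<rightarrow> fibre f (pathstart \<gamma>)"
    using transport_in_fibre[OF avoiding_path_reverse[OF \<gamma>]] by simp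
  show "transport f (reversepath \<gamma>) (transport f \<gamma> x) = x" if "x \<in> fibre f (pathstart \<gamma>)" for x
    using transport_reverse[OF \<gamma> that] .
  show "transport f \<gamma> (transport f (reversepath \<gamma>) y) = y" if "y \<in> fibre f (pathfinish \<gamma>)" for y
    using transport_reverse[OF avoiding_path_reverse[OF \<gamma>], of y] that by simp
qed

lemma fibre_monodromy_iff:
  "\<sigma> \<in> fibre_monodromy f p \<longleftrightarrow> \<sigma> permutes fibre f p \<and>
     (\<exists>\<gamma>. loop_avoiding_critical_values f p \<gamma> \<and> (\<forall>x\<in>fibre f p. \<sigma> x = transport f \<gamma> x))"
proof -
  have "(\<exists>c. is_lift f \<gamma> c \<and> pathstart c = x \<and> pathfinish c = \<sigma> x) \<longleftrightarrow> \<sigma> x = transport f \<gamma> x"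
    if "loop_avoiding_critical_values f p \<gamma>" "x \<in> fibre f p" for \<gamma> x
  proof -
    have a: "avoiding_path f \<gamma>" "pathstart \<gamma> = p" using that(1) by (auto simp: loop_iff_avoiding_path)
    show ?thesis
      using lift_exists[OF a(1), of x] transport_lift[OF a(1)] a(2) that(2) by metis
  qed
  then show ?thesis unfolding fibre_monodromy_def by blast
qed

lemma fibre_monodromy_of_loop:
  assumes "loop_avoiding_critical_values f p \<gamma>"
  shows "\<exists>\<sigma>\<in>fibre_monodromy f p. \<forall>x\<in>fibre f p. \<sigma> x = transport f \<gamma> x"
proof -
  \<comment> \<open>Extended by the identity, since \<open>permutes\<close> also constrains the
    values outside the fibre.\<close>
  let ?\<sigma> = "\<lambda>x. if x \<in> fibre f p then transport f \<gamma> x else x"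
  have "bij_betw (transport f \<gamma>) (fibre f p) (fibre f p)"
    using bij_betw_transport[of \<gamma>] assms by (simp add: loop_iff_avoiding_path)
  then have "bij_betw ?\<sigma> (fibre f p) (fibre f p)"
    by (rule bij_betw_cong[THEN iffD1, rotated]) simp
  then have "?\<sigma> permutes fibre f p" by (rule bij_imp_permutes) simp
  then have "?\<sigma> \<in> fibre_monodromy f p"
    unfolding fibre_monodromy_iff using assms by auto
  then show ?thesis by (rule bexI[rotated]) simp
qed

section \<open>Group laws and transitivity\<close>

lemma fibre_monodromy_permutes: "\<sigma> \<in> fibre_monodromy f p \<Longrightarrow> \<sigma> permutes fibre f p"
  by (simp add: fibre_monodromy_iff)

lemma fibre_monodromy_id:
  assumes "p \<notin> critical_values f"
  shows "id \<in> fibre_monodromy f p"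
proof -
  have \<gamma>: "avoiding_path f (\<lambda>_. p)"
    using assms by (auto simp: avoiding_path_def path_def path_image_def)
  have "transport f (\<lambda>_. p) x = x" if "x \<in> fibre f p" for x
    using transport_lift[OF \<gamma>, of "\<lambda>_. x"] that
    by (simp add: is_lift_def path_def mem_fibre pathstart_def pathfinish_def)
  moreover have "loop_avoiding_critical_values f p (\<lambda>_. p)"
    using \<gamma> by (simp add: loop_iff_avoiding_path pathstart_def pathfinish_def)
  ultimately show ?thesis
    unfolding fibre_monodromy_iff by (auto simp: permutes_id)
qed

lemma fibre_monodromy_comp:
  assumes "\<sigma> \<in> fibre_monodromy f p" "\<tau> \<in> fibre_monodromy f p"
  shows "\<sigma> \<circ> \<tau> \<in> fibre_monodromy f p"
proof -
  obtain \<gamma> where \<gamma>: "loop_avoiding_critical_values f p \<gamma>" "\<And>x. x \<in> fibre f p \<Longrightarrow> \<sigma> x = transport f \<gamma> x"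
    using assms(1) unfolding fibre_monodromy_iff by blast
  obtain \<delta> where \<delta>: "loop_avoiding_critical_values f p \<delta>" "\<And>x. x \<in> fibre f p \<Longrightarrow> \<tau> x = transport f \<delta> x"
    using assms(2) unfolding fibre_monodromy_iff by blast
  have p: "\<sigma> permutes fibre f p" "\<tau> permutes fibre f p"
    using assms by (auto simp: fibre_monodromy_permutes)
  \<comment> \<open>Concatenation runs opposite to composition: \<open>\<tau>\<close> acts first, so
    its loop \<open>\<delta>\<close> is traversed first.\<close>
  have "loop_avoiding_critical_values f p (\<delta> +++ \<gamma>)"
    using \<gamma>(1) \<delta>(1) by (auto simp: loop_iff_avoiding_path intro: avoiding_path_join)
  moreover have "(\<sigma> \<circ> \<tau>) x = transport f (\<delta> +++ \<gamma>) x" if x: "x \<in> fibre f p" for x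
  proof -
    have "\<tau> x \<in> fibre f p" using permutes_in_image[OF p(2)] x by simp
    then have "(\<sigma> \<circ> \<tau>) x = transport f \<gamma> (transport f \<delta> x)"
      using \<gamma>(2)[of "\<tau> x"] \<delta>(2)[OF x] by simp
    then show ?thesis
      using transport_join[of \<delta> \<gamma> x] \<gamma>(1) \<delta>(1) x by (simp add: loop_iff_avoiding_path)
  qed
  ultimately show ?thesis
    unfolding fibre_monodromy_iff using permutes_compose[OF p(2,1)] by blast
qed

lemma fibre_monodromy_inv:
  assumes "\<sigma> \<in> fibre_monodromy f p"
  shows "Hilbert_Choice.inv \<sigma> \<in> fibre_monodromy f p"
proof -
  obtain \<gamma> where \<gamma>: "loop_avoiding_critical_values f p \<gamma>" "\<And>x. x \<in> fibre f p \<Longrightarrow> \<sigma> x = transport f \<gamma> x"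
    using assms unfolding fibre_monodromy_iff by blast
  have p: "\<sigma> permutes fibre f p" using assms by (rule fibre_monodromy_permutes)
  have "loop_avoiding_critical_values f p (reversepath \<gamma>)"
    using \<gamma>(1) by (auto simp: loop_iff_avoiding_path intro: avoiding_path_reverse)
  moreover have "Hilbert_Choice.inv \<sigma> x = transport f (reversepath \<gamma>) x" if "x \<in> fibre f p" for x
  proof -
    define y where "y = Hilbert_Choice.inv \<sigma> x"
    have y: "y \<in> fibre f p" "\<sigma> y = x"
      using permutes_in_image[OF permutes_inv[OF p]] that permutes_inverses(1)[OF p] by (auto simp: y_def)
    have "transport f (reversepath \<gamma>) (transport f \<gamma> y) = y"
      using transport_reverse[of \<gamma> y] \<gamma>(1) y(1) by (simp add: loop_iff_avoiding_path)
    then show ?thesis using y \<gamma>(2)[OF y(1)] by (simp add: y_def)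
  qed
  ultimately show ?thesis
    unfolding fibre_monodromy_iff using permutes_inv[OF p] by blast
qed

text \<open>The connecting path is taken upstairs, off the preimage of the critical values. Its
  image under \<open>f\<close> is a loop at \<open>p\<close>, and the path itself is a lift of that
  loop.\<close>

lemma fibre_monodromy_transitive:
  assumes p: "p \<notin> critical_values f" and x: "x \<in> fibre f p" and y: "y \<in> fibre f p"
  shows "\<exists>\<sigma>\<in>fibre_monodromy f p. \<sigma> x = y"
proof -
  have "poly f -` critical_values f = (\<Union>w\<in>critical_values f. fibre f w)"
    by (auto simp: fibre_def)
  then have "finite (poly f -` critical_values f)"
    using finite_critical_values[OF deg] finite_fibre[OF deg] by simp
  then have "path_connected (- (poly f -` critical_values f))"
    by (intro path_connected_complement_countable countable_finite) simp_all
  then obtain c where c: "path c" "path_image c \<subseteq> - (poly f -` critical_values f)"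
      "pathstart c = x" "pathfinish c = y"
    using p x y unfolding path_connected_def by (metis ComplI mem_fibre vimageD)
  define \<gamma> where "\<gamma> = poly f \<circ> c"
  have loop: "loop_avoiding_critical_values f p \<gamma>"
    unfolding loop_avoiding_critical_values_def
  proof (intro conjI)
    show "path \<gamma>" unfolding \<gamma>_def using c(1) by (intro path_continuous_image continuous_intros)
    show "path_image \<gamma> \<subseteq> - critical_values f"
      using c(2) by (auto simp: \<gamma>_def path_image_compose)
    show "pathstart \<gamma> = p" "pathfinish \<gamma> = p"
      using c x y by (simp_all add: \<gamma>_def pathstart_compose pathfinish_compose mem_fibre)
  qed
  have "is_lift f \<gamma> c" using c(1) by (simp add: is_lift_def \<gamma>_def)
  then have "transport f \<gamma> x = y"
    using transport_lift[of \<gamma> c] loop c by (simp add: loop_iff_avoiding_path)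
  then show ?thesis using fibre_monodromy_of_loop[OF loop] x by auto
qed

text \<open>All lifts of one loop are followed simultaneously. They never collide and the fibres
  keep the same size, so at each time they exhaust the current fibre; this is what lets expressions
  in fibre points be tracked continuously.\<close>

lemma fibre_monodromy_lifts:
  assumes \<sigma>: "\<sigma> \<in> fibre_monodromy f p"
  obtains \<gamma> C where "loop_avoiding_critical_values f p \<gamma>"
    "\<And>x. x \<in> fibre f p \<Longrightarrow> continuous_on {0..1} (C x) \<and> C x 0 = x \<and> C x 1 = \<sigma> x"
    "\<And>t. t \<in> {0..1} \<Longrightarrow> bij_betw (\<lambda>x. C x t) (fibre f p) (fibre f (\<gamma> t))"
proof -
  obtain \<gamma> where \<gamma>: "loop_avoiding_critical_values f p \<gamma>"
    "\<forall>x\<in>fibre f p. \<exists>c. is_lift f \<gamma> c \<and> pathstart c = x \<and> pathfinish c = \<sigma> x"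
    using \<sigma> unfolding fibre_monodromy_def by blast
  then obtain C where C: "\<And>x. x \<in> fibre f p \<Longrightarrow> is_lift f \<gamma> (C x) \<and> pathstart (C x) = x \<and> pathfinish (C x) = \<sigma> x"
    by metis
  have a: "avoiding_path f \<gamma>" using \<gamma>(1) by (simp add: loop_iff_avoiding_path)
  have p: "p \<notin> critical_values f"
    using \<gamma>(1) pathstart_in_path_image[of \<gamma>] by (auto simp: loop_avoiding_critical_values_def)
  show ?thesis
  proof (rule that[OF \<gamma>(1), of C])
    show "continuous_on {0..1} (C x) \<and> C x 0 = x \<and> C x 1 = \<sigma> x" if "x \<in> fibre f p" for x
      using C[OF that] by (simp add: is_lift_def path_def pathstart_def pathfinish_def)
    fix t :: real assume t: "t \<in> {0..1}"
    have inj: "inj_on (\<lambda>x. C x t) (fibre f p)"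
    proof (rule inj_onI)
      fix x y assume xy: "x \<in> fibre f p" "y \<in> fibre f p" "C x t = C y t"
      then have "C x 0 = C y 0"
        using lift_unique[OF a, of "C x" "C y" t 0] C t by simp
      then show "x = y" using C[OF xy(1)] C[OF xy(2)] by (simp add: pathstart_def)
    qed
    have "\<gamma> t \<notin> critical_values f"
      using a t unfolding avoiding_path_def path_image_def by blast
    then have "card (fibre f (\<gamma> t)) = card ((\<lambda>x. C x t) ` fibre f p)"
      using card_fibre[OF deg] p inj by (simp add: card_image)
    moreover have "(\<lambda>x. C x t) ` fibre f p \<subseteq> fibre f (\<gamma> t)"
      using C t by (auto simp: is_lift_def mem_fibre)
    ultimately show "bij_betw (\<lambda>x. C x t) (fibre f p) (fibre f (\<gamma> t))"
      using inj finite_fibre[OF deg, of "\<gamma> t"] by (simp add: bij_betw_def card_subset_eq)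
  qed
qed

text \<open>Over a small disc around \<open>v\<close> the polynomial looks like \<open>u \<mapsto> v + u ^ m\<close> near each
  point of the fibre, so a small circle around \<open>v\<close> permutes the \<open>m\<close>-th roots cyclically.\<close>

lemma local_monodromy_near:
  "\<exists>p. p \<notin> critical_values f \<and> (\<exists>\<gamma> B. loop_avoiding_critical_values f p \<gamma> \<and>
     bij_betw B (SIGMA z:fibre f v. {..<local_degree f z}) (fibre f p) \<and>
     (\<forall>z\<in>fibre f v. \<forall>j<local_degree f z.
        transport f \<gamma> (B (z, j)) = B (z, Suc j mod local_degree f z)))"
proof -
  define m where "m = local_degree f"
  have m: "0 < m z" for z using local_degree_pos[OF deg] by (simp add: m_def)
  let ?V = "critical_values f" and ?X = "fibre f v"
  obtain \<delta> where \<delta>: "\<delta> > 0" "\<And>w. w \<in> ?V \<Longrightarrow> w \<noteq> v \<Longrightarrow> \<delta> \<le> dist v w"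
    using finite_set_avoid[OF finite_critical_values[OF deg], of v] by metis
  obtain \<rho> where \<rho>: "\<rho> > 0" "\<And>R. 0 < R \<and> R \<le> \<rho> \<Longrightarrow> \<exists>U h k. fibre_chart f v R U h k"
    using fibre_charts[OF deg, of v] by auto
  define R where "R = min \<rho> \<delta>"
  have R: "0 < R" "R \<le> \<rho>" "R \<le> \<delta>" using \<rho>(1) \<delta>(1) by (simp_all add: R_def)
  obtain U h k where *: "\<forall>z\<in>?X. open (U z) \<and>
        homeomorphism (U z) (ball 0 (root (m z) R)) (h z) (k z) \<and>
        (\<forall>x\<in>U z. poly f x = v + h z x ^ m z)"
      and disj: "disjoint_family_on U ?X" and UN: "poly f -` ball v R = (\<Union>z\<in>?X. U z)"
    using \<rho>(2)[OF conjI[OF R(1,2)]] unfolding fibre_chart_def m_def by blast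
  \<comment> \<open>\<open>s z\<close> is the modulus of the chart coordinates that lie over the
    circle of radius \<open>R/2\<close> about \<open>v\<close>.\<close>
  define s where "s = (\<lambda>z. root (m z) (R/2))"
  have s: "0 < s z" "s z < root (m z) R" "s z ^ m z = R/2" for z
    using R(1) m[of z] by (simp_all add: s_def real_root_pow_pos2)
  define p where "p = v + of_real (R/2)"
  define \<gamma> where "\<gamma> = (\<lambda>t. v + of_real (R/2) * cis (2 * pi * t))"
  define pt where "pt = (\<lambda>z \<theta>. k z (of_real (s z) * cis \<theta>))"
  \<comment> \<open>\<open>B (z, j)\<close> is the point over \<open>p\<close> whose coordinate in
    the chart at \<open>z\<close> has argument \<open>2 * pi * j / m z\<close>.\<close>
  define B where "B = (\<lambda>(z, j). pt z (2 * pi * real j / real (m z)))"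
  have inball: "of_real (s z) * cis \<theta> \<in> ball 0 (root (m z) R)" for z \<theta>
    using s[of z] by (simp add: norm_mult)
  have hpt: "pt z \<theta> \<in> U z" "h z (pt z \<theta>) = of_real (s z) * cis \<theta>" if "z \<in> ?X" for z \<theta>
  proof -
    have hom: "homeomorphism (U z) (ball 0 (root (m z) R)) (h z) (k z)" using * that by blast
    show "pt z \<theta> \<in> U z" "h z (pt z \<theta>) = of_real (s z) * cis \<theta>"
      using homeomorphism_image2[OF hom] homeomorphism_apply2[OF hom] inball[of z \<theta>]
      unfolding pt_def by blast+
  qed
  have fpt: "poly f (pt z \<theta>) = v + of_real (R/2) * cis (real (m z) * \<theta>)" if "z \<in> ?X" for z \<theta>
  proof -
    have "poly f (pt z \<theta>) = v + (of_real (s z) * cis \<theta>) ^ m z"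
      using * hpt[OF that] that by auto
    also have "\<dots> = v + of_real (s z ^ m z) * cis (real (m z) * \<theta>)"
      unfolding power_mult_distrib Complex.DeMoivre by simp
    finally show ?thesis unfolding s(3) .
  qed
  have avoid: "\<gamma> t \<notin> ?V" for t
  proof
    assume "\<gamma> t \<in> ?V"
    moreover have d: "dist v (\<gamma> t) = R/2"
      using R(1) by (simp add: \<gamma>_def dist_norm norm_mult)
    ultimately have "\<gamma> t = v" using \<delta>(2)[of "\<gamma> t"] R by fastforce
    then show False using d R(1) by simp
  qed
  have p: "p \<notin> ?V" using avoid[of 0] by (simp add: p_def \<gamma>_def)
  have loop: "loop_avoiding_critical_values f p \<gamma>"
    unfolding loop_avoiding_critical_values_def
  proof (intro conjI)
    show "path \<gamma>" unfolding path_def \<gamma>_def by (intro continuous_intros)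
    show "pathstart \<gamma> = p" "pathfinish \<gamma> = p"
      by (simp_all add: pathstart_def pathfinish_def \<gamma>_def p_def)
    show "path_image \<gamma> \<subseteq> - ?V" using avoid by (auto simp: path_image_def)
  qed
  have cis_nat: "cis (2 * pi * real j) = 1" for j by (simp add: cis_multiple_2pi)
  have cis_nat': "cis (2 * pi * (real j + t)) = cis (2 * pi * t)" for j t
    using cis_nat[of j] by (simp add: distrib_left flip: cis_mult)
  have tr: "transport f \<gamma> (B (z, j)) = B (z, Suc j mod m z)" if z: "z \<in> ?X" and j: "j < m z" for z j
  proof -
    \<comment> \<open>The coordinate makes the fraction \<open>1 / m z\<close> of a full turn while
      its power goes once round the circle.\<close>
    define c where "c = (\<lambda>t. pt z (2 * pi * (real j + t) / real (m z)))"
    have "continuous_on (ball 0 (root (m z) R)) (k z)" using * z by (auto simp: homeomorphism_def)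
    then have "continuous_on {0..1} c"
      unfolding c_def pt_def
      by (rule continuous_on_compose2) (use inball m[of z] in \<open>auto intro!: continuous_intros\<close>)
    moreover have "poly f (c t) = \<gamma> t" for t
      using fpt[OF z] m[of z] cis_nat' by (simp add: c_def \<gamma>_def)
    ultimately have lift: "is_lift f \<gamma> c" by (simp add: is_lift_def path_def)
    have "pathstart c = B (z, j)" by (simp add: pathstart_def c_def B_def)
    moreover have "pathfinish c = B (z, Suc j mod m z)"
    proof (cases "Suc j = m z")
      \<comment> \<open>After the last root the argument is a full turn, which is the root with
        index 0.\<close>
      case True
      then have "2 * pi * (real j + 1) / real (m z) = 2 * pi"
        using m[of z] by (simp add: field_simps flip: True)
      then show ?thesis
        using True by (simp add: pathfinish_def c_def B_def pt_def)
    next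
      case False
      then show ?thesis using j by (simp add: pathfinish_def c_def B_def add.commute)
    qed
    ultimately show ?thesis
      using transport_lift[OF _ lift] loop by (simp add: loop_iff_avoiding_path)
  qed
  have inj: "inj_on B (SIGMA z:?X. {..<m z})"
  proof (rule inj_onI, clarify)
    fix z j z' j' assume z: "z \<in> ?X" "z' \<in> ?X" and j: "j < m z" "j' < m z'" and e: "B (z, j) = B (z', j')"
    have "B (z, j) \<in> U z" "B (z', j') \<in> U z'" using hpt(1) z by (auto simp: B_def)
    then have zz: "z = z'" using disjoint_family_onD[OF disj z] e by auto
    let ?\<omega> = "\<lambda>j. cis (2 * pi * real j / real (m z))"
    have "of_real (s z) * ?\<omega> j = of_real (s z) * ?\<omega> j'"
      using arg_cong[OF e, of "h z"] hpt(2)[OF z(1)] by (simp add: B_def zz)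
    then have "?\<omega> j = ?\<omega> j'" using s(1)[of z] by simp
    moreover have "inj_on ?\<omega> {..<m z}"
      using Complex.bij_betw_roots_unity[OF m[of z]] by (simp add: bij_betw_def)
    ultimately have "j = j'" using j zz by (auto dest: inj_onD)
    with zz show "z = z' \<and> j = j'" by simp
  qed
  have "B ` (SIGMA z:?X. {..<m z}) \<subseteq> fibre f p"
    using fpt m by (auto simp: B_def mem_fibre p_def cis_nat)
  \<comment> \<open>The local degrees over \<open>v\<close> add up to \<open>degree f\<close>, the
    size of the fibre over \<open>p\<close>, so the injection is onto.\<close>
  moreover have "card (B ` (SIGMA z:?X. {..<m z})) = card (fibre f p)"
    using card_image[OF inj] finite_fibre[OF deg, of v] sum_local_degree[OF deg, of v] card_fibre[OF deg p]
    by (simp add: m_def)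
  ultimately have "bij_betw B (SIGMA z:?X. {..<m z}) (fibre f p)"
    using inj finite_fibre[OF deg, of p] by (simp add: bij_betw_def card_subset_eq)
  then show ?thesis using p loop tr unfolding m_def by blast
qed

text \<open>The base point \<open>q\<close> near \<open>v\<close> is joined to \<open>p\<close> by a
  path \<open>\<delta>\<close>. Going back along it, round the small loop and forth again conjugates
  by the transport along \<open>\<delta>\<close>, which preserves the cycle structure.\<close>

lemma local_monodromy:
  assumes p: "p \<notin> critical_values f"
  shows "\<exists>\<sigma>\<in>fibre_monodromy f p. \<exists>B.
     bij_betw B (SIGMA z:fibre f v. {..<local_degree f z}) (fibre f p) \<and>
     (\<forall>z\<in>fibre f v. \<forall>j<local_degree f z. \<sigma> (B (z, j)) = B (z, Suc j mod local_degree f z))"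
proof -
  let ?S = "SIGMA z:fibre f v. {..<local_degree f z}"
  obtain q \<gamma> B where q: "q \<notin> critical_values f" and \<gamma>: "loop_avoiding_critical_values f q \<gamma>"
    and B: "bij_betw B ?S (fibre f q)"
     "\<And>z j. z \<in> fibre f v \<Longrightarrow> j < local_degree f z \<Longrightarrow>
        transport f \<gamma> (B (z, j)) = B (z, Suc j mod local_degree f z)"
    using local_monodromy_near[of v] by blast
  have "path_connected (- critical_values f)"
    using finite_critical_values[OF deg]
    by (intro path_connected_complement_countable countable_finite) simp_all
  then obtain \<delta> where "path \<delta>" "path_image \<delta> \<subseteq> - critical_values f" "pathstart \<delta> = q" "pathfinish \<delta> = p"
    using p q unfolding path_connected_def by (metis ComplI)
  then have \<delta>: "avoiding_path f \<delta>" "pathstart \<delta> = q" "pathfinish \<delta> = p"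
    by (simp_all add: avoiding_path_def)
  have \<gamma>': "avoiding_path f \<gamma>" "pathstart \<gamma> = q" "pathfinish \<gamma> = q"
    using \<gamma> by (simp_all add: loop_iff_avoiding_path)
  let ?r = "reversepath \<delta>" and ?\<epsilon> = "reversepath \<delta> +++ (\<gamma> +++ \<delta>)"
  have r: "avoiding_path f ?r" and \<gamma>\<delta>: "avoiding_path f (\<gamma> +++ \<delta>)"
    using \<delta> \<gamma>' by (auto intro: avoiding_path_join avoiding_path_reverse)
  have loop: "loop_avoiding_critical_values f p ?\<epsilon>"
    using \<delta> \<gamma>' r \<gamma>\<delta> by (auto simp: loop_iff_avoiding_path intro: avoiding_path_join)
  have tr: "transport f ?\<epsilon> (transport f \<delta> y) = transport f \<delta> (transport f \<gamma> y)" if y: "y \<in> fibre f q" for y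
  proof -
    have y': "transport f \<delta> y \<in> fibre f p" using transport_in_fibre[OF \<delta>(1)] \<delta> y by simp
    have "transport f ?\<epsilon> (transport f \<delta> y) = transport f (\<gamma> +++ \<delta>) (transport f ?r (transport f \<delta> y))"
      using transport_join[OF r \<gamma>\<delta>] \<delta> \<gamma>' y' by simp
    also have "transport f ?r (transport f \<delta> y) = y" using transport_reverse[OF \<delta>(1)] \<delta> y by simp
    also have "transport f (\<gamma> +++ \<delta>) y = transport f \<delta> (transport f \<gamma> y)"
      using transport_join[OF \<gamma>'(1) \<delta>(1)] \<delta> \<gamma>' y by simp
    finally show ?thesis .
  qed
  obtain \<sigma> where \<sigma>: "\<sigma> \<in> fibre_monodromy f p" "\<And>x. x \<in> fibre f p \<Longrightarrow> \<sigma> x = transport f ?\<epsilon> x"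
    using fibre_monodromy_of_loop[OF loop] by blast
  show ?thesis
  proof (intro bexI[OF _ \<sigma>(1)] exI[of _ "transport f \<delta> \<circ> B"] conjI ballI allI impI)
    have b: "bij_betw (transport f \<delta>) (fibre f q) (fibre f p)"
      using bij_betw_transport[OF \<delta>(1)] \<delta> by simp
    show "bij_betw (transport f \<delta> \<circ> B) ?S (fibre f p)"
      using bij_betw_trans[OF B(1) b] .
    fix z j assume zj: "z \<in> fibre f v" "j < local_degree f z"
    then have y: "B (z, j) \<in> fibre f q" using B(1) by (auto simp: bij_betw_def)
    then have "transport f \<delta> (B (z, j)) \<in> fibre f p" using b by (auto simp: bij_betw_def)
    then show "\<sigma> ((transport f \<delta> \<circ> B) (z, j)) = (transport f \<delta> \<circ> B) (z, Suc j mod local_degree f z)"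
      using \<sigma>(2) tr[OF y] B(2)[OF zj] by simp
  qed
qed

end

section \<open>Permutation groups\<close>

abbreviation transposition :: "'a \<Rightarrow> 'a \<Rightarrow> 'a \<Rightarrow> 'a" where
  "transposition \<equiv> Transposition.transpose"

definition three_cycle :: "'a \<Rightarrow> 'a \<Rightarrow> 'a \<Rightarrow> 'a \<Rightarrow> 'a" where
  "three_cycle a b c = transposition a b \<circ> transposition b c"

lemma transposition_conj:
  assumes "bij \<sigma>"
  shows "\<sigma> \<circ> transposition a b \<circ> Hilbert_Choice.inv \<sigma> = transposition (\<sigma> a) (\<sigma> b)"
proof
  fix x
  obtain y where y: "x = \<sigma> y" using assms by (metis bij_pointE)
  have i: "inj \<sigma>" using assms by (rule bij_is_inj)
  show "(\<sigma> \<circ> transposition a b \<circ> Hilbert_Choice.inv \<sigma>) x = transposition (\<sigma> a) (\<sigma> b) x"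
    using inj_eq[OF i] by (simp add: y inv_f_f[OF i] Transposition.transpose_def)
qed

lemma three_cycle_conj:
  assumes "bij \<sigma>"
  shows "\<sigma> \<circ> three_cycle a b c \<circ> Hilbert_Choice.inv \<sigma> = three_cycle (\<sigma> a) (\<sigma> b) (\<sigma> c)"
proof -
  have "Hilbert_Choice.inv \<sigma> \<circ> \<sigma> = id" using bij_is_inj[OF assms] by simp
  then have "\<sigma> \<circ> three_cycle a b c \<circ> Hilbert_Choice.inv \<sigma> =
      (\<sigma> \<circ> transposition a b \<circ> Hilbert_Choice.inv \<sigma>) \<circ> (\<sigma> \<circ> transposition b c \<circ> Hilbert_Choice.inv \<sigma>)"
    by (simp add: three_cycle_def fun_eq_iff)
  then show ?thesis by (simp add: transposition_conj[OF assms] three_cycle_def)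
qed

lemma three_cycle_apply:
  assumes "distinct [a, b, c]"
  shows "three_cycle a b c x = (if x = a then b else if x = b then c else if x = c then a else x)"
  using assms by (auto simp: three_cycle_def Transposition.transpose_def)

lemma three_cycle_rotate: "distinct [a, b, c] \<Longrightarrow> three_cycle b c a = three_cycle a b c"
  by (rule ext) (auto simp: three_cycle_apply[of b c a] three_cycle_apply[of a b c])

lemma inv_three_cycle: "Hilbert_Choice.inv (three_cycle a b c) = three_cycle c b a"
  unfolding three_cycle_def
  by (simp add: o_inv_distrib Transposition.transpose_commute)

text \<open>Permutation groups as plain sets of functions, so that the same notions apply to a
  complex fibre and to the numbers \<open>1..d\<close>.\<close>

locale perm_group =
  fixes G :: "('a \<Rightarrow> 'a) set" and X :: "'a set"
  assumes finite_X: "finite X"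
    and permutes: "\<sigma> \<in> G \<Longrightarrow> \<sigma> permutes X"
    and id_mem: "id \<in> G"
    and comp_mem: "\<sigma> \<in> G \<Longrightarrow> \<tau> \<in> G \<Longrightarrow> \<sigma> \<circ> \<tau> \<in> G"
    and inv_mem: "\<sigma> \<in> G \<Longrightarrow> Hilbert_Choice.inv \<sigma> \<in> G"
begin

lemma bij_mem: "\<sigma> \<in> G \<Longrightarrow> bij \<sigma>"
  using permutes permutes_bij by blast

lemma in_X: "\<sigma> \<in> G \<Longrightarrow> \<sigma> x \<in> X \<longleftrightarrow> x \<in> X"
  using permutes_in_image[OF permutes] .

lemma conj_mem: "\<sigma> \<in> G \<Longrightarrow> \<tau> \<in> G \<Longrightarrow> \<sigma> \<circ> \<tau> \<circ> Hilbert_Choice.inv \<sigma> \<in> G"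
  by (intro comp_mem inv_mem)

lemma funpow_mem: "\<sigma> \<in> G \<Longrightarrow> \<sigma> ^^ k \<in> G"
  by (induction k) (auto intro: id_mem comp_mem)

lemma transposition_conj_mem:
  "\<sigma> \<in> G \<Longrightarrow> transposition a b \<in> G \<Longrightarrow> transposition (\<sigma> a) (\<sigma> b) \<in> G"
  using conj_mem transposition_conj[OF bij_mem] by metis

lemma three_cycle_conj_mem:
  "\<sigma> \<in> G \<Longrightarrow> three_cycle a b c \<in> G \<Longrightarrow> three_cycle (\<sigma> a) (\<sigma> b) (\<sigma> c) \<in> G"
  using conj_mem three_cycle_conj[OF bij_mem] by metis

lemma three_cycle_reverse_mem: "three_cycle a b c \<in> G \<Longrightarrow> three_cycle c b a \<in> G"
  using inv_mem inv_three_cycle by metis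

lemma all_permutations:
  assumes "\<And>a b. a \<in> X \<Longrightarrow> b \<in> X \<Longrightarrow> a \<noteq> b \<Longrightarrow> transposition a b \<in> G"
    and "\<sigma> permutes X"
  shows "\<sigma> \<in> G"
  using assms(2) finite_X
proof (induction rule: permutes_induct)
  case id
  then show ?case by (rule id_mem)
next
  case (swap a b p)
  then show ?case using assms(1) comp_mem by blast
qed

text \<open>Two transpositions sharing a point compose to a 3-cycle or to the identity; for disjoint
  ones a third transposition joining them is inserted twice.\<close>

lemma transposition_product_mem:
  assumes three: "\<And>a b c. a \<in> X \<Longrightarrow> b \<in> X \<Longrightarrow> c \<in> X \<Longrightarrow> distinct [a, b, c] \<Longrightarrow> three_cycle a b c \<in> G"
    and X: "a \<in> X" "b \<in> X" "c \<in> X" "d \<in> X" and "a \<noteq> b" "c \<noteq> d"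
  shows "transposition c d \<circ> transposition a b \<in> G"
proof -
  have one: "transposition x y \<circ> transposition y z \<in> G"
    if "x \<in> X" "y \<in> X" "z \<in> X" "x \<noteq> y" "y \<noteq> z" for x y z
  proof (cases "x = z")
    case True
    then show ?thesis using id_mem by (simp add: Transposition.transpose_commute[of y])
  next
    case False
    then show ?thesis using three[of x y z] that by (simp add: three_cycle_def)
  qed
  show ?thesis
  proof (cases "c = a \<or> c = b \<or> d = a \<or> d = b")
    case True
    then show ?thesis
      using one[of d a b] one[of d b a] one[of c a b] one[of c b a] X assms(6,7)
      by (auto simp: Transposition.transpose_commute)
  next
    case False
    have "(transposition c d \<circ> transposition d a) \<circ> (transposition d a \<circ> transposition a b)
        = transposition c d \<circ> transposition a b"
      by (simp add: fun_eq_iff)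
    then show ?thesis
      using comp_mem[OF one[of c d a] one[of d a b]] X False assms(6,7) by auto
  qed
qed

text \<open>The induction also covers odd permutations: they enter \<open>G\<close> after
  composition with any transposition. An odd member of \<open>G\<close> would therefore force the
  excluded transposition into \<open>G\<close>.\<close>

lemma eq_even_permutations:
  assumes three: "\<And>a b c. a \<in> X \<Longrightarrow> b \<in> X \<Longrightarrow> c \<in> X \<Longrightarrow> distinct [a, b, c] \<Longrightarrow> three_cycle a b c \<in> G"
    and uv: "u \<in> X" "v \<in> X" "u \<noteq> v" "transposition u v \<notin> G"
  shows "\<sigma> \<in> G \<longleftrightarrow> \<sigma> permutes X \<and> evenperm \<sigma>"
proof -
  have *: "if evenperm \<sigma> then \<sigma> \<in> G
      else \<forall>a\<in>X. \<forall>b\<in>X. a \<noteq> b \<longrightarrow> transposition a b \<circ> \<sigma> \<in> G" if "\<sigma> permutes X" for \<sigma>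
    using that finite_X
  proof (induction rule: permutes_induct)
    case id
    then show ?case using id_mem by (simp add: evenperm_id)
  next
    case (swap a b p)
    have "permutation p" using swap.hyps finite_X permutation_permutes by blast
    then have e: "evenperm (transposition a b \<circ> p) \<longleftrightarrow> \<not> evenperm p"
      using swap.hyps by (simp add: evenperm_comp permutation_swap_id evenperm_swap)
    show ?case
    proof (cases "evenperm p")
      case True
      then have p: "p \<in> G" using swap.IH by simp
      have "transposition c d \<circ> (transposition a b \<circ> p) \<in> G" if "c \<in> X" "d \<in> X" "c \<noteq> d" for c d
        using comp_mem[OF transposition_product_mem[OF three] p] that swap.hyps
        by (simp add: comp_assoc)
      then show ?thesis using True e by (simp del: o_apply)
    next
      case False
      then show ?thesis using swap e by (simp del: o_apply)
    qed
  qed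
  show ?thesis
  proof
    assume \<sigma>: "\<sigma> \<in> G"
    have "evenperm \<sigma>"
    proof (rule ccontr)
      assume "\<not> evenperm \<sigma>"
      then have "transposition u v \<circ> \<sigma> \<in> G" using *[OF permutes[OF \<sigma>]] uv by auto
      then have "(transposition u v \<circ> \<sigma>) \<circ> Hilbert_Choice.inv \<sigma> \<in> G"
        by (rule comp_mem[OF _ inv_mem[OF \<sigma>]])
      moreover have "(transposition u v \<circ> \<sigma>) \<circ> Hilbert_Choice.inv \<sigma> = transposition u v"
        unfolding comp_assoc permutes_inv_o(1)[OF permutes[OF \<sigma>]] by simp
      ultimately show False using uv(4) by metis
    qed
    then show "\<sigma> permutes X \<and> evenperm \<sigma>" using permutes[OF \<sigma>] by simp
  qed (use * in auto)
qed

end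

section \<open>Transitive groups and invariant equivalence relations\<close>

locale transitive_perm_group = perm_group +
  assumes trans_X: "x \<in> X \<Longrightarrow> y \<in> X \<Longrightarrow> \<exists>\<sigma>\<in>G. \<sigma> x = y"
begin

text \<open>An element carrying one point to another maps class into class, and this works in both
  directions, so all classes have the same size.\<close>

lemma card_invariant_class_dvd:
  assumes R: "equiv X R" and inv: "\<And>\<sigma> x y. \<sigma> \<in> G \<Longrightarrow> (x, y) \<in> R \<Longrightarrow> (\<sigma> x, \<sigma> y) \<in> R" and x: "x \<in> X"
  shows "card (R `` {x}) dvd card X"
proof -
  have le: "card (R `` {x}) \<le> card (R `` {y})" if xy: "x \<in> X" "y \<in> X" for x y
  proof -
    obtain \<sigma> where \<sigma>: "\<sigma> \<in> G" "\<sigma> x = y" using trans_X xy by blast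
    have "\<sigma> ` (R `` {x}) \<subseteq> R `` {y}" using inv[OF \<sigma>(1)] \<sigma>(2) by blast
    moreover have "finite (R `` {y})"
      using finite_equiv_class[OF finite_X equiv_type[OF R]] xy(2) by (auto simp: quotient_def)
    ultimately show ?thesis
      using card_mono card_image[OF inj_on_subset[OF bij_is_inj[OF bij_mem[OF \<sigma>(1)]]]] by (metis subset_UNIV)
  qed
  have "card (R `` {x}) * card (X // R) = card (\<Union> (X // R))"
  proof (rule card_partition)
    show "finite (X // R)" using R finite_X by (simp add: equiv_type finite_quotient)
    show "finite (\<Union> (X // R))" using R finite_X by (simp add: Union_quotient)
    show "card c = card (R `` {x})" if "c \<in> X // R" for c
      using that le x by (auto simp: quotient_def intro: le_antisym)
    show "c \<inter> d = {}" if "c \<in> X // R" "d \<in> X // R" "c \<noteq> d" for c d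
      using quotient_disj[OF R that(1,2)] that(3) by blast
  qed
  then show ?thesis using Union_quotient[OF R] by (metis dvd_triv_left)
qed

text \<open>Primitivity in prime degree: the size of a class with at least two points divides a
  prime, so the class is everything.\<close>

lemma invariant_equiv_prime:
  assumes R: "equiv X R" and inv: "\<And>\<sigma> x y. \<sigma> \<in> G \<Longrightarrow> (x, y) \<in> R \<Longrightarrow> (\<sigma> x, \<sigma> y) \<in> R"
    and "prime (card X)" and ab: "(a, b) \<in> R" "a \<noteq> b" and xy: "x \<in> X" "y \<in> X"
  shows "(x, y) \<in> R"
proof -
  have sub: "R `` {a} \<subseteq> X" using R by (auto simp: equiv_def refl_on_def)
  have a: "a \<in> X" using ab R by (auto simp: equiv_def refl_on_def)
  have fin: "finite (R `` {a})" using sub finite_X by (rule finite_subset)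
  have "{a, b} \<subseteq> R `` {a}" using ab(1) equiv_class_self[OF R a] by auto
  then have "card {a, b} \<le> card (R `` {a})" using fin by (intro card_mono)
  then have "card (R `` {a}) \<noteq> 1" using ab(2) by simp
  then have "card (R `` {a}) = card X"
  proof -
    have "card (R `` {a}) dvd card X" by (rule card_invariant_class_dvd[OF R _ a]) (rule inv)
    then show ?thesis using \<open>prime (card X)\<close> \<open>card (R `` {a}) \<noteq> 1\<close> by (auto simp: prime_nat_iff)
  qed
  then have "R `` {a} = X" using sub finite_X by (simp add: card_subset_eq)
  then have "(a, x) \<in> R" "(a, y) \<in> R" using xy by auto
  then show ?thesis using R by (meson equivE symE transE)
qed

text \<open>Being swapped by a transposition of \<open>G\<close> is an invariant equivalence
  relation: conjugating \<open>(x y)\<close> by \<open>(y z)\<close> gives \<open>(x z)\<close>, and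
  reflexivity holds because \<open>transposition x x\<close> is the identity.\<close>

lemma all_permutations_of_transposition:
  assumes "prime (card X)" "transposition a b \<in> G" "a \<noteq> b" "a \<in> X" "b \<in> X" "\<sigma> permutes X"
  shows "\<sigma> \<in> G"
proof (rule all_permutations[OF _ assms(6)])
  let ?R = "{(x, y) \<in> X \<times> X. transposition x y \<in> G}"
  have "equiv X ?R"
  proof (rule equivI)
    show "?R \<subseteq> X \<times> X" by blast
    show "refl_on X ?R" using id_mem by (auto simp: refl_on_def)
    show "sym ?R" by (auto simp: sym_def Transposition.transpose_commute)
    show "trans ?R"
    proof (rule transI)
      fix x y z assume "(x, y) \<in> ?R" "(y, z) \<in> ?R"
      then have *: "x \<in> X" "y \<in> X" "z \<in> X" "transposition x y \<in> G" "transposition y z \<in> G"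
        by auto
      have "transposition x z \<in> G"
      proof (cases "x = z \<or> y = z")
        case True
        then show ?thesis using * id_mem by auto
      next
        case False
        then show ?thesis using transposition_conj_mem[OF *(5,4)] * by (cases "x = y") auto
      qed
      then show "(x, z) \<in> ?R" using * by simp
    qed
  qed
  moreover have "(\<sigma> x, \<sigma> y) \<in> ?R" if "\<sigma> \<in> G" "(x, y) \<in> ?R" for \<sigma> x y
    using that in_X transposition_conj_mem by auto
  ultimately show "transposition x y \<in> G" if "x \<in> X" "y \<in> X" "x \<noteq> y" for x y
    using invariant_equiv_prime[of ?R a b x y] assms that by blast
qed

text \<open>Conjugates of the one transposition reach every pair. This replaces primality of the
  degree for quartics.\<close>

lemma all_permutations_of_pair_transitive:
  assumes "transposition a b \<in> G" "a \<in> X" "b \<in> X" "a \<noteq> b"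
    and "\<And>c d. c \<in> X \<Longrightarrow> d \<in> X \<Longrightarrow> c \<noteq> d \<Longrightarrow> \<exists>\<sigma>\<in>G. {\<sigma> a, \<sigma> b} = {c, d}"
    and "\<sigma> permutes X"
  shows "\<sigma> \<in> G"
proof (rule all_permutations[OF _ assms(6)])
  fix c d assume cd: "c \<in> X" "d \<in> X" "c \<noteq> d"
  obtain \<tau> where \<tau>: "\<tau> \<in> G" "{\<tau> a, \<tau> b} = {c, d}" using assms(5)[OF cd] by blast
  then have "transposition (\<tau> a) (\<tau> b) = transposition c d"
    by (metis Transposition.transpose_commute doubleton_eq_iff)
  then show "transposition c d \<in> G" using transposition_conj_mem[OF \<tau>(1) assms(1)] by simp
qed

text \<open>Lying in a common 3-cycle of \<open>G\<close> is an invariant equivalence relation,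
  hence total in prime degree. A 3-cycle \<open>(i j k)\<close> is then turned into
  \<open>(i j l)\<close> by conjugation with a 3-cycle through \<open>k\<close> and
  \<open>l\<close>.\<close>

lemma all_three_cycles:
  assumes prime: "prime (card X)"
    and abc: "three_cycle a b c \<in> G" "distinct [a, b, c]" "a \<in> X" "b \<in> X" "c \<in> X"
    and ijl: "i \<in> X" "j \<in> X" "l \<in> X" "distinct [i, j, l]"
  shows "three_cycle i j l \<in> G"
proof -
  define P where "P = (\<lambda>x y z. x \<in> X \<and> y \<in> X \<and> z \<in> X \<and> distinct [x, y, z] \<and> three_cycle x y z \<in> G)"
  have rot: "P y z x" if "P x y z" for x y z
    using that three_cycle_rotate[of x y z] by (auto simp: P_def)
  have rev: "P z y x" if "P x y z" for x y z
    using that three_cycle_reverse_mem[of x y z] by (auto simp: P_def)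
  have conj: "P (\<sigma> x) (\<sigma> y) (\<sigma> z)" if "P x y z" "\<sigma> \<in> G" for x y z \<sigma>
    using that three_cycle_conj_mem[of \<sigma> x y z] in_X[of \<sigma>] inj_eq[OF bij_is_inj[OF bij_mem[of \<sigma>]]]
    by (auto simp: P_def)
  have conj': "P (three_cycle u v w x) (three_cycle u v w y) (three_cycle u v w z)"
    if "P x y z" "P u v w" for x y z u v w
    using that conj by (auto simp: P_def)
  let ?R = "{(x, y) \<in> X \<times> X. x = y \<or> (\<exists>z. P x y z)}"
  have "equiv X ?R"
  proof (rule equivI)
    show "?R \<subseteq> X \<times> X" by blast
    show "refl_on X ?R" by (auto simp: refl_on_def)
    show "sym ?R" using rot[OF rev] by (fastforce simp: sym_def)
    show "trans ?R"
    proof (rule transI)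
      fix x y z assume xyz: "(x, y) \<in> ?R" "(y, z) \<in> ?R"
      show "(x, z) \<in> ?R"
      proof (rule ccontr)
        assume "(x, z) \<notin> ?R"
        then have *: "x = y \<or> (\<exists>u. P x y u)" "y = z \<or> (\<exists>u. P y z u)" "\<nexists>u. P x z u" "x \<noteq> z"
          using xyz by auto
        then have xz: "x \<noteq> z" by simp
        obtain u where u: "P x y u" using * xz by blast
        obtain w where w: "P y z w" using * xz u by blast
        show False
        proof (cases "z = u")
          case True
          then have "P x z y" using rev[OF rot[OF u]] by simp
          then show False using * by blast
        next
          case False
          have d: "distinct [x, y, u]" "distinct [u, y, x]" using u by (auto simp: P_def)
          \<comment> \<open>This 3-cycle sends \<open>y\<close> to \<open>x\<close> and fixes
            \<open>z\<close>, so it turns a 3-cycle through \<open>y, z\<close> into one through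
            \<open>x, z\<close>.\<close>
          have "P (three_cycle u y x y) (three_cycle u y x z) (three_cycle u y x w)"
            by (rule conj'[OF w rev[OF u]])
          moreover have "three_cycle u y x y = x" "three_cycle u y x z = z"
            using False xz d w by (auto simp: three_cycle_apply[OF d(2)] P_def)
          ultimately show False using * by metis
        qed
      qed
    qed
  qed
  moreover have "(\<sigma> x, \<sigma> y) \<in> ?R" if "\<sigma> \<in> G" "(x, y) \<in> ?R" for \<sigma> x y
    using that in_X[OF that(1)] conj[OF _ that(1)] by (auto, blast)
  moreover have "(a, b) \<in> ?R" "a \<noteq> b" using abc by (auto simp: P_def)
  ultimately have R: "(x, y) \<in> ?R" if "x \<in> X" "y \<in> X" for x y
    using invariant_equiv_prime[of ?R a b x y] prime that by blast
  obtain k where k: "P i j k" using R[OF ijl(1,2)] ijl by auto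
  have "P i j l"
  proof (cases "k = l")
    case False
    obtain m where m: "P k l m" using R[of k l] False k ijl by (auto simp: P_def)
    have d: "distinct [k, l, m]" "distinct [m, l, k]" using m by (auto simp: P_def)
    have dk: "distinct [i, j, k]" using k by (auto simp: P_def)
    \<comment> \<open>When \<open>m\<close> is \<open>i\<close> or \<open>j\<close>, conjugation
      with the inverse 3-cycle still yields a 3-cycle on \<open>i, j, l\<close>; reversal and
      rotation restore the order.\<close>
    consider "m = i" | "m = j" | "m \<noteq> i" "m \<noteq> j" by blast
    then show ?thesis
    proof cases
      case 1
      have "P (three_cycle m l k i) (three_cycle m l k j) (three_cycle m l k k)"
        by (rule conj'[OF k rev[OF m]])
      then have "P l j i" unfolding three_cycle_apply[OF d(2)] using 1 d dk ijl by auto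
      then show ?thesis by (rule rev)
    next
      case 2
      have "P (three_cycle m l k i) (three_cycle m l k j) (three_cycle m l k k)"
        by (rule conj'[OF k rev[OF m]])
      then have "P i l j" unfolding three_cycle_apply[OF d(2)] using 2 d dk ijl by auto
      then show ?thesis by (rule rev[OF rot])
    next
      case 3
      have "P (three_cycle k l m i) (three_cycle k l m j) (three_cycle k l m k)"
        by (rule conj'[OF k m])
      then show ?thesis unfolding three_cycle_apply[OF d(1)] using 3 d dk ijl by auto
    qed
  qed (use k in simp)
  then show ?thesis by (simp add: P_def)
qed

text \<open>An element of \<open>G\<close> brings \<open>\<alpha> x\<close> back to
  \<open>x\<close>, so membership of \<open>\<alpha>\<close> reduces to that of a permutation fixing
  \<open>x\<close>.\<close>

lemma supergroup_mem_of_stabilizer: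
  assumes "x \<in> X" "\<alpha> permutes X"
    and "\<And>\<sigma>. \<sigma> \<in> G \<Longrightarrow> \<sigma> (\<alpha> x) = x \<Longrightarrow> \<sigma> \<circ> \<alpha> \<in> G"
  shows "\<alpha> \<in> G"
proof -
  have "\<alpha> x \<in> X" using assms(1) permutes_in_image[OF assms(2)] by simp
  then obtain \<sigma> where \<sigma>: "\<sigma> \<in> G" "\<sigma> (\<alpha> x) = x" using trans_X assms(1) by blast
  then have "Hilbert_Choice.inv \<sigma> \<circ> (\<sigma> \<circ> \<alpha>) \<in> G" using assms(3) comp_mem inv_mem by blast
  moreover have "Hilbert_Choice.inv \<sigma> \<circ> (\<sigma> \<circ> \<alpha>) = \<alpha>"
    using permutes_inv_o(2)[OF permutes[OF \<sigma>(1)]] by (simp flip: comp_assoc)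
  ultimately show ?thesis by simp
qed

end

text \<open>The combinatorial content of a small loop: \<open>B (z, j)\<close> is position
  \<open>j\<close> in the cycle of length \<open>m z\<close> belonging to \<open>z\<close>, and
  \<open>F\<close> is to be the fibre over the critical value.\<close>

locale cycle_structure =
  fixes B :: "'b \<times> nat \<Rightarrow> 'a" and F :: "'b set" and m :: "'b \<Rightarrow> nat" and X \<sigma>
  assumes bij_B: "bij_betw B (SIGMA z:F. {..<m z}) X" and permutes_X: "\<sigma> permutes X"
    and cyc: "\<And>z j. z \<in> F \<Longrightarrow> j < m z \<Longrightarrow> \<sigma> (B (z, j)) = B (z, Suc j mod m z)"
begin

lemma funpow_apply:
  assumes "z \<in> F" "j < m z"
  shows "(\<sigma> ^^ k) (B (z, j)) = B (z, (j + k) mod m z)"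
proof (induction k)
  case (Suc k)
  have "(j + k) mod m z < m z" using assms(2) by simp
  then show ?case using Suc cyc[OF assms(1)] by (simp add: mod_Suc_eq)
qed (use assms in simp)

lemma B_eq_iff:
  assumes "z \<in> F" "j < m z" "z' \<in> F" "j' < m z'"
  shows "B (z, j) = B (z', j') \<longleftrightarrow> z = z' \<and> j = j'"
  using bij_B assms by (auto simp: bij_betw_def dest: inj_onD)

lemma mem_X_cases:
  assumes "x \<in> X"
  obtains z j where "z \<in> F" "j < m z" "x = B (z, j)"
  using bij_B assms by (auto simp: bij_betw_def)

lemma B_mem: "z \<in> F \<Longrightarrow> j < m z \<Longrightarrow> B (z, j) \<in> X"
  using bij_B by (auto simp: bij_betw_def)

text \<open>Cubing kills 1-cycles and 3-cycles and leaves a 2-cycle unchanged, so the profiles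
  \<open>{#2#}\<close> and \<open>{#2, 3#}\<close> are handled together.\<close>

lemma cube_eq_transposition:
  assumes z0: "z0 \<in> F" "m z0 = 2" and other: "\<And>z. z \<in> F \<Longrightarrow> z \<noteq> z0 \<Longrightarrow> m z = 1 \<or> m z = 3"
  shows "\<sigma> ^^ 3 = transposition (B (z0, 0)) (B (z0, 1))"
proof
  fix x
  show "(\<sigma> ^^ 3) x = transposition (B (z0, 0)) (B (z0, 1)) x"
  proof (cases "x \<in> X")
    case False
    then have "\<sigma> x = x" using permutes_X by (simp add: permutes_not_in)
    moreover have "x \<noteq> B (z0, 0)" "x \<noteq> B (z0, 1)" using False z0 B_mem by auto
    ultimately show ?thesis by (simp add: numeral_3_eq_3)
  next
    case True
    then obtain z j where zj: "z \<in> F" "j < m z" "x = B (z, j)" by (rule mem_X_cases)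
    have p: "(\<sigma> ^^ 3) x = B (z, (j + 3) mod m z)"
      unfolding zj(3) by (rule funpow_apply[OF zj(1,2)])
    show ?thesis
    proof (cases "z = z0")
      case True
      then have "j = 0 \<or> j = 1" using zj z0 by auto
      then show ?thesis using p zj True z0 by (auto simp: numeral_3_eq_3)
    next
      case False
      then have "(j + 3) mod m z = j" using other[OF zj(1)] zj(2) by auto
      moreover have "x \<noteq> B (z0, 0)" "x \<noteq> B (z0, 1)"
        using B_eq_iff[OF zj(1,2) z0(1)] z0(2) zj(3) False by auto
      ultimately show ?thesis using p zj(3) by simp
    qed
  qed
qed

lemma eq_three_cycle:
  assumes z0: "z0 \<in> F" "m z0 = 3" and other: "\<And>z. z \<in> F \<Longrightarrow> z \<noteq> z0 \<Longrightarrow> m z = 1"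
  shows "\<sigma> = three_cycle (B (z0, 0)) (B (z0, 1)) (B (z0, 2))"
    "distinct [B (z0, 0), B (z0, 1), B (z0, 2)]"
proof -
  show d: "distinct [B (z0, 0), B (z0, 1), B (z0, 2)]"
    using B_eq_iff[OF z0(1) _ z0(1)] z0(2) by auto
  show "\<sigma> = three_cycle (B (z0, 0)) (B (z0, 1)) (B (z0, 2))"
  proof
    fix x
    show "\<sigma> x = three_cycle (B (z0, 0)) (B (z0, 1)) (B (z0, 2)) x"
    proof (cases "x \<in> X")
      case False
      then have "\<sigma> x = x" using permutes_X by (simp add: permutes_not_in)
      moreover have "x \<noteq> B (z0, 0)" "x \<noteq> B (z0, 1)" "x \<noteq> B (z0, 2)"
        using False z0 B_mem by auto
      ultimately show ?thesis unfolding three_cycle_apply[OF d] by simp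
    next
      case True
      then obtain z j where zj: "z \<in> F" "j < m z" "x = B (z, j)" by (rule mem_X_cases)
      have p: "\<sigma> x = B (z, Suc j mod m z)" unfolding zj(3) using cyc zj by blast
      show ?thesis
      proof (cases "z = z0")
        case True
        then have "j = 0 \<or> j = 1 \<or> j = 2" using zj z0 by auto
        then show ?thesis unfolding three_cycle_apply[OF d] using p zj True z0 d by (auto simp: numeral_2_eq_2)
      next
        case False
        then have "Suc j mod m z = j" using other[OF zj(1)] zj(2) by auto
        moreover have "x \<noteq> B (z0, 0)" "x \<noteq> B (z0, 1)" "x \<noteq> B (z0, 2)"
          using B_eq_iff[OF zj(1,2) z0(1)] z0(2) zj(3) False by auto
        ultimately show ?thesis unfolding three_cycle_apply[OF d] using p zj(3) by simp
      qed
    qed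
  qed
qed

lemma fixed_point:
  assumes "z1 \<in> F" "m z1 = 1" "z2 \<in> F" "m z2 \<ge> 2"
  shows "B (z1, 0) \<in> X" "\<sigma> (B (z1, 0)) = B (z1, 0)" "\<sigma> \<noteq> id"
proof -
  show "B (z1, 0) \<in> X" using B_mem assms by simp
  show "\<sigma> (B (z1, 0)) = B (z1, 0)" using cyc[OF assms(1)] assms(2) by simp
  have "\<sigma> (B (z2, 0)) = B (z2, 1)" using cyc[OF assms(3), of 0] assms(4) by simp
  also have "\<dots> \<noteq> B (z2, 0)" using B_eq_iff[OF assms(3) _ assms(3)] assms(4) by simp
  finally show "\<sigma> \<noteq> id" by auto
qed

end

section \<open>Invariant relations and numberings of the fibre\<close>

declare One_nat_def [simp del]

lemma transitive_perm_group_fibre_monodromy: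
  assumes "0 < degree f" "p \<notin> critical_values f"
  shows "transitive_perm_group (fibre_monodromy f p) (fibre f p)"
  using assms
  by unfold_locales
    (auto simp: finite_fibre fibre_monodromy_permutes fibre_monodromy_id fibre_monodromy_comp
        fibre_monodromy_inv fibre_monodromy_transitive)

text \<open>Applying \<open>T\<close> to the lift from \<open>x\<close> gives a lift of the same
  loop from \<open>T x\<close>; by uniqueness it is the lift, and the end points are
  compared.\<close>

lemma fibre_monodromy_commute:
  assumes deg: "0 < degree f" and T: "continuous_on UNIV T" "\<And>x. poly f (T x) = poly f x"
    and \<sigma>: "\<sigma> \<in> fibre_monodromy f p" and x: "x \<in> fibre f p"
  shows "\<sigma> (T x) = T (\<sigma> x)"
proof -
  obtain \<gamma> C where \<gamma>: "loop_avoiding_critical_values f p \<gamma>"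
    and C: "\<And>x. x \<in> fibre f p \<Longrightarrow> continuous_on {0..1} (C x) \<and> C x 0 = x \<and> C x 1 = \<sigma> x"
      "\<And>t. t \<in> {0..1} \<Longrightarrow> bij_betw (\<lambda>x. C x t) (fibre f p) (fibre f (\<gamma> t))"
    using fibre_monodromy_lifts[OF deg \<sigma>] by metis
  have Tx: "T x \<in> fibre f p" using T(2) x by (simp add: mem_fibre)
  have C': "C y t \<in> fibre f (\<gamma> t)" if "y \<in> fibre f p" "t \<in> {0..1}" for y t
    using bij_betwE[OF C(2)[OF that(2)]] that(1) by blast
  have "is_lift f \<gamma> (C (T x))"
    using C(1)[OF Tx] C'[OF Tx] by (auto simp: is_lift_def path_def mem_fibre)
  moreover have "is_lift f \<gamma> (T \<circ> C x)"
    using C(1)[OF x] C'[OF x] T(2) continuous_on_compose[of "{0..1}" "C x" T] continuous_on_subset[OF T(1)]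
    by (auto simp: is_lift_def path_def mem_fibre)
  moreover have "C (T x) 0 = (T \<circ> C x) 0" using C(1)[OF Tx] C(1)[OF x] by simp
  ultimately have "C (T x) 1 = (T \<circ> C x) 1"
    using lift_unique[OF deg _ _ _ _ _, of \<gamma> "C (T x)" "T \<circ> C x" 0 1] \<gamma>
    by (simp add: loop_iff_avoiding_path)
  then show ?thesis using C(1)[OF Tx] C(1)[OF x] by simp
qed

text \<open>The two zero sets are closed, disjoint and cover a connected interval, so one of them is
  empty. Every invariance proof except that for deck transformations ends here.\<close>

lemma product_zero_on_interval:
  fixes \<phi> \<psi> :: "real \<Rightarrow> complex"
  assumes c: "continuous_on {0..1} \<phi>" "continuous_on {0..1} \<psi>"
    and prod: "\<And>t. t \<in> {0..1} \<Longrightarrow> \<phi> t * \<psi> t = 0"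
    and ne: "\<And>t. t \<in> {0..1} \<Longrightarrow> \<phi> t \<noteq> 0 \<or> \<psi> t \<noteq> 0"
  shows "\<phi> 1 = 0 \<longleftrightarrow> \<phi> 0 = 0"
proof -
  let ?A = "{t\<in>{0..1}. \<phi> t = 0}" and ?B = "{t\<in>{0..1}. \<psi> t = 0}"
  have cl: "closed ?A" "closed ?B"
    by (rule continuous_closed_preimage_constant[OF _ closed_real_atLeastAtMost], rule c)+
  have "{0..1} \<subseteq> ?A \<union> ?B" 
  proof
    fix t :: real assume "t \<in> {0..1}"
    then show "t \<in> ?A \<union> ?B" using prod[of t] by simp
  qed
  moreover have "?A \<inter> ?B \<inter> {0..1} = {}" using ne by auto
  moreover have "connected {0..1::real}" by simp
  ultimately have "?A \<inter> {0..1} = {} \<or> ?B \<inter> {0..1} = {}"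
    using cl unfolding connected_closed by blast
  then show ?thesis
  proof
    assume "?A \<inter> {0..1} = {}"
    then have "t \<notin> ?A" if "t \<in> {0..1}" for t using that by blast
    from this[of 0] this[of 1] show ?thesis by simp
  next
    assume "?B \<inter> {0..1} = {}"
    then have "t \<notin> ?B" if "t \<in> {0..1}" for t using that by blast
    from this[of 0] this[of 1] show ?thesis using prod[of 0] prod[of 1] by simp
  qed
qed

text \<open>\<open>\<psi>\<close> describes the complementary relation: away from critical values
  exactly one of \<open>\<phi>\<close>, \<open>\<psi>\<close> vanishes on two distinct fibre points,
  and which one cannot change along the lifts.\<close>

lemma fibre_monodromy_preserves:
  fixes \<phi> \<psi> :: "complex \<Rightarrow> complex \<Rightarrow> complex"
  assumes deg: "0 < degree f"
    and c: "continuous_on UNIV (\<lambda>z. \<phi> (fst z) (snd z))" "continuous_on UNIV (\<lambda>z. \<psi> (fst z) (snd z))"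
    and zero: "\<And>w x y. w \<notin> critical_values f \<Longrightarrow> x \<in> fibre f w \<Longrightarrow> y \<in> fibre f w \<Longrightarrow> x \<noteq> y \<Longrightarrow>
       \<phi> x y * \<psi> x y = 0 \<and> (\<phi> x y \<noteq> 0 \<or> \<psi> x y \<noteq> 0)"
    and \<sigma>: "\<sigma> \<in> fibre_monodromy f p" and xy: "x \<in> fibre f p" "y \<in> fibre f p" "x \<noteq> y"
  shows "\<phi> (\<sigma> x) (\<sigma> y) = 0 \<longleftrightarrow> \<phi> x y = 0"
proof -
  obtain \<gamma> C where \<gamma>: "loop_avoiding_critical_values f p \<gamma>"
    and C: "\<And>x. x \<in> fibre f p \<Longrightarrow> continuous_on {0..1} (C x) \<and> C x 0 = x \<and> C x 1 = \<sigma> x"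
      "\<And>t. t \<in> {0..1} \<Longrightarrow> bij_betw (\<lambda>x. C x t) (fibre f p) (fibre f (\<gamma> t))"
    using fibre_monodromy_lifts[OF deg \<sigma>] by metis
  have cont: "continuous_on {0..1} (\<lambda>t. g (C x t) (C y t))"
    if "continuous_on UNIV (\<lambda>z. g (fst z) (snd z))" for g :: "complex \<Rightarrow> complex \<Rightarrow> complex"
  proof -
    have "continuous_on {0..1} (\<lambda>t. (C x t, C y t))"
      using C(1)[OF xy(1)] C(1)[OF xy(2)] by (intro continuous_intros) auto
    from continuous_on_compose2[OF that this] show ?thesis by simp
  qed
  have zero': "\<phi> (C x t) (C y t) * \<psi> (C x t) (C y t) = 0 \<and> (\<phi> (C x t) (C y t) \<noteq> 0 \<or> \<psi> (C x t) (C y t) \<noteq> 0)"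
    if t: "t \<in> {0..1}" for t
  proof (rule zero)
    show "\<gamma> t \<notin> critical_values f"
      using \<gamma> t unfolding loop_avoiding_critical_values_def path_image_def by blast
    show "C x t \<in> fibre f (\<gamma> t)" "C y t \<in> fibre f (\<gamma> t)"
      using bij_betwE[OF C(2)[OF t]] xy by blast+
    show "C x t \<noteq> C y t"
      using C(2)[OF t] xy unfolding bij_betw_def inj_on_def by blast
  qed
  show ?thesis
    using product_zero_on_interval[OF cont[OF c(1)] cont[OF c(2)]] zero' C(1)[OF xy(1)] C(1)[OF xy(2)]
    by auto
qed

section \<open>The group on the numbers 1..d and the effect of renumbering\<close>

lemma mem_monodromy_group:
  assumes b: "bij_betw b {1..degree f} (fibre f p)" and deg: "0 < degree f"
  shows "\<tau> \<in> monodromy_group f p b \<longleftrightarrow>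
     \<tau> permutes {1..degree f} \<and> map_permutation {1..degree f} b \<tau> \<in> fibre_monodromy f p"
    (is "_ \<longleftrightarrow> _ \<and> ?m \<tau> \<in> ?G")
proof -
  have inj: "inj_on b {1..degree f}" and im: "b ` {1..degree f} = fibre f p"
    using b by (auto simp: bij_betw_def)
  have "(\<exists>\<sigma>\<in>?G. \<forall>i\<in>{1..degree f}. b (\<tau> i) = \<sigma> (b i)) \<longleftrightarrow> ?m \<tau> \<in> ?G" if \<tau>: "\<tau> permutes {1..degree f}"
  proof
    assume "\<exists>\<sigma>\<in>?G. \<forall>i\<in>{1..degree f}. b (\<tau> i) = \<sigma> (b i)"
    then obtain \<sigma> where \<sigma>: "\<sigma> \<in> ?G" "\<And>i. i \<in> {1..degree f} \<Longrightarrow> b (\<tau> i) = \<sigma> (b i)" by blast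
    have "?m \<tau> = \<sigma>"
    proof
      fix x
      show "?m \<tau> x = \<sigma> x"
      proof (cases "x \<in> fibre f p")
        case True
        then obtain i where "i \<in> {1..degree f}" "x = b i" using im by blast
        then show ?thesis using \<sigma>(2) map_permutation_apply[OF inj, of i \<tau>] by simp
      next
        case False
        then show ?thesis
          using permutes_not_in[OF map_permutation_permutes[OF b \<tau>]]
            permutes_not_in[OF fibre_monodromy_permutes[OF deg \<sigma>(1)]] by simp
      qed
    qed
    then show "?m \<tau> \<in> ?G" using \<sigma>(1) by simp
  next
    assume "?m \<tau> \<in> ?G"
    then show "\<exists>\<sigma>\<in>?G. \<forall>i\<in>{1..degree f}. b (\<tau> i) = \<sigma> (b i)"
      by (rule bexI[rotated]) (simp add: map_permutation_apply[OF inj])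
  qed
  then show ?thesis unfolding monodromy_group_def by (auto simp: sym_group_carrier)
qed

lemma perm_group_monodromy_group:
  assumes b: "bij_betw b {1..degree f} (fibre f p)" and deg: "0 < degree f" and p: "p \<notin> critical_values f"
  shows "perm_group (monodromy_group f p b) {1..degree f}"
proof -
  interpret G: transitive_perm_group "fibre_monodromy f p" "fibre f p"
    by (rule transitive_perm_group_fibre_monodromy[OF deg p])
  have inj: "inj_on b {1..degree f}" using b by (auto simp: bij_betw_def)
  show ?thesis
  proof
    show "\<sigma> permutes {1..degree f}" if "\<sigma> \<in> monodromy_group f p b" for \<sigma>
      using that mem_monodromy_group[OF b deg] by blast
    show "id \<in> monodromy_group f p b"
      using G.id_mem map_permutation_id'[OF inj] by (simp add: mem_monodromy_group[OF b deg] permutes_id)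
    show comp: "\<sigma> \<circ> \<tau> \<in> monodromy_group f p b"
      if "\<sigma> \<in> monodromy_group f p b" "\<tau> \<in> monodromy_group f p b" for \<sigma> \<tau>
      using that G.comp_mem
      by (auto simp: mem_monodromy_group[OF b deg] map_permutation_compose'[OF inj] intro: permutes_compose)
    show "Hilbert_Choice.inv \<sigma> \<in> monodromy_group f p b" if "\<sigma> \<in> monodromy_group f p b" for \<sigma>
    proof -
      have \<sigma>: "\<sigma> permutes {1..degree f}" "map_permutation {1..degree f} b \<sigma> \<in> fibre_monodromy f p"
        using that by (auto simp: mem_monodromy_group[OF b deg])
      let ?m = "map_permutation {1..degree f} b"
      have "?m \<sigma> \<circ> ?m (Hilbert_Choice.inv \<sigma>) = id"
        using permutes_inv_o(1)[OF \<sigma>(1)] map_permutation_id'[OF inj]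
        by (simp flip: map_permutation_compose'[OF inj permutes_inv[OF \<sigma>(1)]])
      then have "?m (Hilbert_Choice.inv \<sigma>) = Hilbert_Choice.inv (?m \<sigma>)"
        by (metis G.permutes[OF \<sigma>(2)] comp_assoc comp_id id_comp permutes_inv_o(2))
      then show ?thesis
        using \<sigma> G.inv_mem permutes_inv by (auto simp: mem_monodromy_group[OF b deg])
    qed
  qed simp
qed

lemma subgroup_monodromy_group:
  assumes "bij_betw b {1..degree f} (fibre f p)" "0 < degree f" "p \<notin> critical_values f"
  shows "subgroup (monodromy_group f p b) (sym_group (degree f))"
proof -
  interpret H: perm_group "monodromy_group f p b" "{1..degree f}"
    by (rule perm_group_monodromy_group[OF assms])
  show ?thesis
  proof (rule group.subgroupI[OF sym_group_is_group])
    show "monodromy_group f p b \<subseteq> carrier (sym_group (degree f))"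
      using H.permutes by (auto simp: sym_group_carrier)
    show "monodromy_group f p b \<noteq> {}" using H.id_mem by blast
    show "inv\<^bsub>sym_group (degree f)\<^esub> a \<in> monodromy_group f p b" if "a \<in> monodromy_group f p b" for a
      using that H.inv_mem H.permutes by (simp add: sym_group_carrier)
    show "a \<otimes>\<^bsub>sym_group (degree f)\<^esub> b' \<in> monodromy_group f p b"
      if "a \<in> monodromy_group f p b" "b' \<in> monodromy_group f p b" for a b'
      using that H.comp_mem by (simp add: sym_group_mult)
  qed
qed

lemma renumbering_exists:
  assumes b: "bij_betw b A X" and b0: "bij_betw b0 A X"
  shows "\<exists>u. u permutes A \<and> (\<forall>i\<in>A. b0 (u i) = b i)"
proof -
  let ?u = "\<lambda>i. if i \<in> A then inv_into A b0 (b i) else i"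
  have "bij_betw (inv_into A b0 \<circ> b) A A"
    using b bij_betw_inv_into[OF b0] by (rule bij_betw_trans)
  then have "bij_betw ?u A A" by (rule bij_betw_cong[THEN iffD1, rotated]) simp
  then have "?u permutes A" by (rule bij_imp_permutes) simp
  moreover have "b0 (?u i) = b i" if "i \<in> A" for i
    using that b b0 by (auto simp: bij_betw_def f_inv_into_f)
  ultimately show ?thesis by blast
qed

lemma mem_monodromy_group_renumber:
  assumes b: "bij_betw b {1..degree f} (fibre f p)" and b0: "bij_betw b0 {1..degree f} (fibre f p)"
    and deg: "0 < degree f" and u: "u permutes {1..degree f}" "\<And>i. i \<in> {1..degree f} \<Longrightarrow> b0 (u i) = b i"
  shows "\<tau> \<in> monodromy_group f p b \<longleftrightarrow> u \<circ> \<tau> \<circ> Hilbert_Choice.inv u \<in> monodromy_group f p b0"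
proof -
  let ?A = "{1..degree f}" and ?v = "Hilbert_Choice.inv u"
  have perm: "u \<circ> \<tau> \<circ> ?v permutes ?A \<longleftrightarrow> \<tau> permutes ?A"
  proof
    assume "u \<circ> \<tau> \<circ> ?v permutes ?A"
    then have "?v \<circ> (u \<circ> \<tau> \<circ> ?v) \<circ> u permutes ?A"
      by (intro permutes_compose[OF u(1)] permutes_compose[OF _ permutes_inv[OF u(1)]])
    moreover have "?v \<circ> (u \<circ> \<tau> \<circ> ?v) \<circ> u = \<tau>"
      using permutes_inverses[OF u(1)] by (simp add: fun_eq_iff)
    ultimately show "\<tau> permutes ?A" by simp
  qed (use u(1) permutes_inv[OF u(1)] in \<open>intro permutes_compose\<close>)
  have "map_permutation ?A b0 (u \<circ> \<tau> \<circ> ?v) = map_permutation ?A b \<tau>" if \<tau>: "\<tau> permutes ?A"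
  proof
    fix x
    have inj: "inj_on b0 ?A" "inj_on b ?A" using b b0 by (auto simp: bij_betw_def)
    show "map_permutation ?A b0 (u \<circ> \<tau> \<circ> ?v) x = map_permutation ?A b \<tau> x"
    proof (cases "x \<in> fibre f p")
      case True
      then obtain i where i: "i \<in> ?A" "x = b i" using b unfolding bij_betw_def by blast
      have ui: "u i \<in> ?A" "\<tau> i \<in> ?A" using i(1) permutes_in_image[OF u(1)] permutes_in_image[OF \<tau>] by blast+
      have "map_permutation ?A b0 (u \<circ> \<tau> \<circ> ?v) (b0 (u i)) = b0 ((u \<circ> \<tau> \<circ> ?v) (u i))"
        by (rule map_permutation_apply[OF inj(1) ui(1)])
      also have "\<dots> = b (\<tau> i)" using u(2)[OF ui(2)] permutes_inverses[OF u(1)] by simp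
      also have "\<dots> = map_permutation ?A b \<tau> (b i)"
        by (rule map_permutation_apply[OF inj(2) i(1), symmetric])
      finally show ?thesis using i u(2)[OF i(1)] by simp
    next
      case False
      then show ?thesis
        using permutes_not_in[OF map_permutation_permutes[OF b \<tau>]]
          permutes_not_in[OF map_permutation_permutes[OF b0 perm[THEN iffD2, OF \<tau>]]] by simp
    qed
  qed
  then show ?thesis
    unfolding mem_monodromy_group[OF b deg] mem_monodromy_group[OF b0 deg] using perm by auto
qed

text \<open>If suitable numberings give literally the same subgroup, arbitrary ones give conjugate
  subgroups: the conjugator passes from \<open>b\<close> to \<open>b0\<close> by \<open>u\<close>
  and from \<open>c0\<close> back to \<open>c\<close> by the inverse of \<open>v\<close>.\<close>

lemma conjugate_monodromy_groups:
  assumes d: "degree f = d" "degree g = d" "0 < d"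
    and p: "p \<notin> critical_values f" and b: "bij_betw b {1..d} (fibre f p)" "bij_betw b0 {1..d} (fibre f p)"
    and q: "q \<notin> critical_values g" and c: "bij_betw c {1..d} (fibre g q)" "bij_betw c0 {1..d} (fibre g q)"
    and eq: "monodromy_group f p b0 = monodromy_group g q c0"
  shows "conjugate_subgroups (sym_group d) (monodromy_group f p b) (monodromy_group g q c)"
proof -
  obtain u where u: "u permutes {1..d}" "\<And>i. i \<in> {1..d} \<Longrightarrow> b0 (u i) = b i"
    using renumbering_exists[OF b] by blast
  obtain v where v: "v permutes {1..d}" "\<And>i. i \<in> {1..d} \<Longrightarrow> c0 (v i) = c i"
    using renumbering_exists[OF c] by blast
  let ?inv = "Hilbert_Choice.inv :: (nat \<Rightarrow> nat) \<Rightarrow> nat \<Rightarrow> nat"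
  define s where "s = ?inv v \<circ> u"
  have s: "s permutes {1..d}" unfolding s_def using u(1) permutes_inv[OF v(1)] by (rule permutes_compose)
  have inv_s: "?inv s = ?inv u \<circ> v"
    unfolding s_def o_inv_distrib[OF permutes_bij[OF permutes_inv[OF v(1)]] permutes_bij[OF u(1)]]
      permutes_inv_inv[OF v(1)] ..
  have f: "\<tau> \<in> monodromy_group f p b \<longleftrightarrow> u \<circ> \<tau> \<circ> ?inv u \<in> monodromy_group f p b0" for \<tau>
    using mem_monodromy_group_renumber[of b f p b0 u] b d u by simp
  have g: "\<tau> \<in> monodromy_group g q c \<longleftrightarrow> v \<circ> \<tau> \<circ> ?inv v \<in> monodromy_group f p b0" for \<tau>
    unfolding eq using mem_monodromy_group_renumber[of c g q c0 v] c d v by simp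
  have "\<tau> \<in> monodromy_group g q c \<longleftrightarrow> ?inv s \<circ> \<tau> \<circ> s \<in> monodromy_group f p b" for \<tau>
  proof -
    have "u \<circ> (?inv s \<circ> \<tau> \<circ> s) \<circ> ?inv u = v \<circ> \<tau> \<circ> ?inv v"
      unfolding inv_s unfolding s_def using permutes_inverses[OF u(1)] by (simp add: fun_eq_iff)
    then show ?thesis by (simp add: f g)
  qed
  note * = this
  have "monodromy_group g q c = (\<lambda>\<tau>. s \<circ> (\<tau> \<circ> ?inv s)) ` monodromy_group f p b"
  proof (rule Set.set_eqI, rule iffI)
    fix \<tau>
    {
      assume "\<tau> \<in> monodromy_group g q c"
      then have "?inv s \<circ> \<tau> \<circ> s \<in> monodromy_group f p b" using * by blast
      moreover have "\<tau> = s \<circ> ((?inv s \<circ> \<tau> \<circ> s) \<circ> ?inv s)"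
        using permutes_inverses[OF s] by (simp add: fun_eq_iff)
      ultimately show "\<tau> \<in> (\<lambda>\<tau>. s \<circ> (\<tau> \<circ> ?inv s)) ` monodromy_group f p b" by blast
    next
      assume "\<tau> \<in> (\<lambda>\<tau>. s \<circ> (\<tau> \<circ> ?inv s)) ` monodromy_group f p b"
      then obtain \<rho> where \<rho>: "\<rho> \<in> monodromy_group f p b" "\<tau> = s \<circ> (\<rho> \<circ> ?inv s)" by blast
      moreover have "?inv s \<circ> (s \<circ> (\<rho> \<circ> ?inv s)) \<circ> s = \<rho>"
        using permutes_inverses[OF s] by (simp add: fun_eq_iff)
      ultimately show "\<tau> \<in> monodromy_group g q c" using * by simp
    }
  qed
  then have "monodromy_group g q c =
      s <#\<^bsub>sym_group d\<^esub> (monodromy_group f p b #>\<^bsub>sym_group d\<^esub> inv\<^bsub>sym_group d\<^esub> s)"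
    using s by (auto simp: l_coset_def r_coset_def sym_group_mult sym_group_carrier)
  then show ?thesis
    unfolding conjugate_subgroups_def
    using subgroup_monodromy_group[of b f p] subgroup_monodromy_group[of c g q] d p q b c s
    by (auto simp: sym_group_carrier)
qed

lemma monodromy_group_relation:
  assumes b: "bij_betw b {1..degree f} (fibre f p)" and deg: "0 < degree f"
    and G: "\<And>\<sigma>. \<sigma> \<in> fibre_monodromy f p \<longleftrightarrow>
      \<sigma> permutes fibre f p \<and> (\<forall>x\<in>fibre f p. \<forall>y\<in>fibre f p. E x y \<longleftrightarrow> E (\<sigma> x) (\<sigma> y))"
    and E: "\<And>i j. i \<in> {1..degree f} \<Longrightarrow> j \<in> {1..degree f} \<Longrightarrow> E (b i) (b j) \<longleftrightarrow> E0 i j"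
  shows "monodromy_group f p b = {\<tau>. \<tau> permutes {1..degree f} \<and>
     (\<forall>i\<in>{1..degree f}. \<forall>j\<in>{1..degree f}. E0 i j \<longleftrightarrow> E0 (\<tau> i) (\<tau> j))}"
proof -
  let ?A = "{1..degree f}"
  have inj: "inj_on b ?A" and im: "fibre f p = b ` ?A" using b by (auto simp: bij_betw_def)
  have "map_permutation ?A b \<tau> \<in> fibre_monodromy f p \<longleftrightarrow> (\<forall>i\<in>?A. \<forall>j\<in>?A. E0 i j \<longleftrightarrow> E0 (\<tau> i) (\<tau> j))"
    if \<tau>: "\<tau> permutes ?A" for \<tau>
  proof -
    have "map_permutation ?A b \<tau> \<in> fibre_monodromy f p \<longleftrightarrow>
       (\<forall>i\<in>?A. \<forall>j\<in>?A. E (b i) (b j) \<longleftrightarrow> E (map_permutation ?A b \<tau> (b i)) (map_permutation ?A b \<tau> (b j)))"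
      unfolding G using map_permutation_permutes[OF b \<tau>] im by simp
    also have "\<dots> \<longleftrightarrow> (\<forall>i\<in>?A. \<forall>j\<in>?A. E0 i j \<longleftrightarrow> E0 (\<tau> i) (\<tau> j))"
      using E permutes_in_image[OF \<tau>] by (intro ball_cong refl) (simp add: map_permutation_apply[OF inj] del: atLeastAtMost_iff One_nat_def)
    finally show ?thesis .
  qed
  then show ?thesis by (auto simp: mem_monodromy_group[OF b deg])
qed

section \<open>Critical portraits\<close>

text \<open>A set forgets how many critical values share a profile; combined with
  \<open>sum_defect\<close>, knowing which profiles occur suffices for the classification.\<close>

definition profiles :: "complex poly \<Rightarrow> nat multiset set" where
  "profiles f = critical_local_degrees f ` critical_values f"

lemma profiles_eq:
  assumes "identical_critical_portraits f g"
  shows "profiles f = profiles g"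
proof -
  obtain \<phi> where \<phi>: "bij_betw \<phi> (critical_values f) (critical_values g)"
    "\<And>v. v \<in> critical_values f \<Longrightarrow> critical_local_degrees g (\<phi> v) = critical_local_degrees f v"
    using assms unfolding identical_critical_portraits_def by blast
  have "profiles g = critical_local_degrees g ` \<phi> ` critical_values f"
    using \<phi>(1) by (simp add: profiles_def bij_betw_def)
  also have "\<dots> = profiles f" using \<phi>(2) by (simp add: profiles_def image_image)
  finally show ?thesis by simp
qed

text \<open>For the profile over \<open>v\<close> this is \<open>degree f\<close> minus the number
  of points over \<open>v\<close>, the contribution of \<open>v\<close> to the Riemann-Hurwitz
  formula.\<close>

definition defect :: "nat multiset \<Rightarrow> nat" where
  "defect M = (\<Sum>m\<in>#M. m - 1)"

text \<open>Three entries of size at least 2 would already sum to 6.\<close>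

lemma small_profile_cases:
  fixes M :: "nat multiset"
  assumes "M \<noteq> {#}" "\<And>m. m \<in># M \<Longrightarrow> 2 \<le> m" "sum_mset M \<le> 5"
  shows "M = {#2#} \<or> M = {#3#} \<or> M = {#4#} \<or> M = {#5#} \<or> M = {#2, 2#} \<or> M = {#2, 3#}"
proof -
  obtain x N where M: "M = add_mset x N" using assms(1) by (cases M) auto
  have x: "2 \<le> x" using assms(2) M by simp
  show ?thesis
  proof (cases N)
    case empty
    then have "x = 2 \<or> x = 3 \<or> x = 4 \<or> x = 5" using M x assms(3) by auto
    then show ?thesis using M empty by auto
  next
    case (add y N')
    have y: "2 \<le> y" using assms(2) M add by simp
    have "N' = {#}"
    proof (cases N')
      case (add z N'')
      then have "2 \<le> z" using assms(2) M \<open>N = add_mset y N'\<close> by simp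
      then show ?thesis using x y assms(3) M \<open>N = add_mset y N'\<close> add by simp
    qed
    then have "x + y \<le> 5" using assms(3) M add by simp
    then have "(x = 2 \<and> y = 2) \<or> (x = 2 \<and> y = 3) \<or> (x = 3 \<and> y = 2)" using x y by linarith
    then show ?thesis using M add \<open>N' = {#}\<close> by (auto simp: add_mset_commute)
  qed
qed

context
  fixes f :: "complex poly"
  assumes deg: "0 < degree f"
begin

lemma finite_critical_fibre: "finite (critical_points f \<inter> fibre f v)"
  using finite_critical_points[OF deg] by simp

lemma set_critical_local_degrees:
  "set_mset (critical_local_degrees f v) = local_degree f ` (critical_points f \<inter> fibre f v)"
  using finite_critical_fibre by (simp add: critical_local_degrees_def)

lemma size_critical_local_degrees:
  "size (critical_local_degrees f v) = card (critical_points f \<inter> fibre f v)"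
  by (simp add: critical_local_degrees_def)

lemma local_degree_ge_2_iff: "2 \<le> local_degree f z \<longleftrightarrow> z \<in> critical_points f"
  using local_degree_eq_1_iff[OF deg, of z] local_degree_pos[OF deg, of z] by linarith

lemma critical_local_degrees_ge_2: "m \<in># critical_local_degrees f v \<Longrightarrow> 2 \<le> m"
  using local_degree_ge_2_iff by (auto simp: set_critical_local_degrees)

lemma critical_local_degrees_nonempty:
  assumes "v \<in> critical_values f"
  shows "critical_local_degrees f v \<noteq> {#}"
proof -
  obtain z where "z \<in> critical_points f" "poly f z = v" using assms by (auto simp: critical_values_def)
  then have "critical_points f \<inter> fibre f v \<noteq> {}" by (auto simp: mem_fibre)
  then have "set_mset (critical_local_degrees f v) \<noteq> {}" by (simp add: set_critical_local_degrees)
  then show ?thesis by auto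
qed

text \<open>A profile omits the non-critical points of the fibre, each of which has local degree
  1.\<close>

lemma sum_critical_local_degrees:
  "sum_mset (critical_local_degrees f v) + card (fibre f v - critical_points f) = degree f"
proof -
  have "sum_mset (critical_local_degrees f v) = (\<Sum>z\<in>critical_points f \<inter> fibre f v. local_degree f z)"
    by (simp add: critical_local_degrees_def sum_unfold_sum_mset)
  moreover have "card (fibre f v - critical_points f) = (\<Sum>z\<in>fibre f v - critical_points f. local_degree f z)"
    by (simp add: local_degree_eq_1_iff[OF deg, THEN iffD2])
  moreover have "(\<Sum>z\<in>critical_points f \<inter> fibre f v. local_degree f z) +
      (\<Sum>z\<in>fibre f v - critical_points f. local_degree f z) = (\<Sum>z\<in>fibre f v. local_degree f z)"
    using finite_fibre[OF deg, of v] by (subst sum.union_disjoint[symmetric]) (auto intro!: sum.cong)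
  ultimately show ?thesis using sum_local_degree[OF deg, of v] by simp
qed

lemma sum_critical_local_degrees_le: "sum_mset (critical_local_degrees f v) \<le> degree f"
  using sum_critical_local_degrees[of v] by simp

text \<open>Riemann-Hurwitz for a polynomial: both sides count the roots of \<open>pderiv f\<close>
  with multiplicity, on the left grouped by critical value.\<close>

lemma sum_defect: "(\<Sum>v\<in>critical_values f. defect (critical_local_degrees f v)) = degree f - 1"
proof -
  have "defect (critical_local_degrees f v) =
      (\<Sum>z\<in>{z \<in> critical_points f. poly f z = v}. Polynomial.order z (pderiv f))" for v
  proof -
    have "critical_points f \<inter> fibre f v = {z \<in> critical_points f. poly f z = v}" by (auto simp: mem_fibre)
    then show ?thesis
      by (simp add: defect_def critical_local_degrees_def sum_unfold_sum_mset local_degree_eq_Suc[OF deg]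
          image_mset.compositionality comp_def)
  qed
  then have "(\<Sum>v\<in>critical_values f. defect (critical_local_degrees f v)) =
      (\<Sum>z\<in>critical_points f. Polynomial.order z (pderiv f))"
    using sum.group[OF finite_critical_points[OF deg] finite_critical_values[OF deg], of "poly f"]
    by (simp add: critical_values_def)
  also have "\<dots> = degree (pderiv f)"
    unfolding critical_points_def by (rule sum_order_roots[OF pderiv_nonzero[OF deg]])
  finally show ?thesis by (simp add: degree_pderiv)
qed

lemma profile_cases:
  assumes "degree f \<le> 5" "M \<in> profiles f"
  shows "M = {#2#} \<or> M = {#3#} \<or> M = {#4#} \<or> M = {#5#} \<or> M = {#2, 2#} \<or> M = {#2, 3#}"
    and "sum_mset M \<le> degree f"
proof -
  obtain v where v: "v \<in> critical_values f" "M = critical_local_degrees f v"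
    using assms(2) by (auto simp: profiles_def)
  show le: "sum_mset M \<le> degree f" using sum_critical_local_degrees_le v by simp
  show "M = {#2#} \<or> M = {#3#} \<or> M = {#4#} \<or> M = {#5#} \<or> M = {#2, 2#} \<or> M = {#2, 3#}"
    using small_profile_cases[of M] critical_local_degrees_nonempty[OF v(1)] critical_local_degrees_ge_2
      le assms(1) v(2) by simp
qed

lemma defect_le_total:
  assumes "v \<in> critical_values f" "w \<in> critical_values f" "v \<noteq> w"
  shows "defect (critical_local_degrees f v) + defect (critical_local_degrees f w) \<le> degree f - 1"
proof -
  have "(\<Sum>u\<in>{v, w}. defect (critical_local_degrees f u)) \<le> degree f - 1"
    unfolding sum_defect[symmetric] using assms finite_critical_values[OF deg] by (intro sum_mono2) auto
  then show ?thesis using assms by simp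
qed

lemma profiles_degree_2:
  assumes "degree f = 2"
  shows "{#2#} \<in> profiles f"
proof -
  have "critical_values f \<noteq> {}" using sum_defect assms by auto
  then obtain M where M: "M \<in> profiles f" by (auto simp: profiles_def)
  then show ?thesis using profile_cases[OF _ M] assms by auto
qed

lemma profiles_degree_3:
  assumes "degree f = 3" "{#3#} \<notin> profiles f"
  shows "{#2#} \<in> profiles f"
proof -
  have "critical_values f \<noteq> {}" using sum_defect assms by auto
  then obtain M where M: "M \<in> profiles f" by (auto simp: profiles_def)
  then show ?thesis using profile_cases[OF _ M] assms by auto
qed

text \<open>Without \<open>{#2#}\<close> and \<open>{#4#}\<close> only profiles of defect 2 remain,
  but the total defect 3 is odd.\<close>

lemma profiles_degree_4:
  assumes "degree f = 4" "{#4#} \<notin> profiles f"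
  shows "{#2#} \<in> profiles f"
proof (rule ccontr)
  assume "{#2#} \<notin> profiles f"
  then have "defect M = 2" if "M \<in> profiles f" for M
    using profile_cases[OF _ that] that assms by (auto simp: defect_def)
  then have "defect (critical_local_degrees f v) = 2" if "v \<in> critical_values f" for v
    using that by (simp add: profiles_def)
  then have "(\<Sum>v\<in>critical_values f. defect (critical_local_degrees f v)) = 2 * card (critical_values f)"
    by simp
  then show False using sum_defect assms(1) by presburger
qed

text \<open>The total defect is 4 and the remaining profiles have defect 2 or 3. A profile
  \<open>{#4#}\<close> of defect 3 would leave 1 for the other values, which none of them has; so
  there are two values of defect 2.\<close>

lemma profiles_degree_5:
  assumes "degree f = 5" "{#5#} \<notin> profiles f" "{#2#} \<notin> profiles f" "{#2, 3#} \<notin> profiles f"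
  shows "profiles f \<subseteq> {{#3#}, {#2, 2#}}" "card (critical_values f) = 2"
proof -
  have c: "M = {#3#} \<or> M = {#4#} \<or> M = {#2, 2#}" if "M \<in> profiles f" for M
    using profile_cases[OF _ that] that assms by auto
  have ge: "2 \<le> defect (critical_local_degrees f v)" if "v \<in> critical_values f" for v
    using c[of "critical_local_degrees f v"] that by (auto simp: profiles_def defect_def)
  have no4: "{#4#} \<notin> profiles f"
  proof
    assume "{#4#} \<in> profiles f"
    then obtain v where v: "v \<in> critical_values f" "critical_local_degrees f v = {#4#}"
      by (auto simp: profiles_def)
    have "critical_values f = {v}"
      using defect_le_total[OF v(1)] v ge assms(1) by (fastforce simp: defect_def)
    then show False using sum_defect v assms(1) by (simp add: defect_def)
  qed
  then show "profiles f \<subseteq> {{#3#}, {#2, 2#}}" using c by blast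
  then have "defect (critical_local_degrees f v) = 2" if "v \<in> critical_values f" for v
    using that by (force simp: profiles_def defect_def)
  then have "(\<Sum>v\<in>critical_values f. defect (critical_local_degrees f v)) = 2 * card (critical_values f)"
    by simp
  then show "card (critical_values f) = 2" using sum_defect assms(1) by simp
qed

lemma single_critical_point:
  assumes "critical_local_degrees f v = {#m#}"
  obtains z where "critical_points f \<inter> fibre f v = {z}" "local_degree f z = m"
proof -
  have "card (critical_points f \<inter> fibre f v) = 1"
    using size_critical_local_degrees[of v] assms by simp
  then obtain z where z: "critical_points f \<inter> fibre f v = {z}" by (rule card_1_singletonE)
  then show ?thesis using that set_critical_local_degrees[of v] assms by simp
qed

lemma two_critical_points:
  assumes "critical_local_degrees f v = {#m, n#}"
  obtains y z where "critical_points f \<inter> fibre f v = {y, z}" "y \<noteq> z" "local_degree f y = m" "local_degree f z = n"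
proof -
  have "card (critical_points f \<inter> fibre f v) = 2"
    using size_critical_local_degrees[of v] assms by simp
  then obtain y z where yz: "critical_points f \<inter> fibre f v = {y, z}" "y \<noteq> z" by (auto simp: card_2_iff)
  then have "{#local_degree f y, local_degree f z#} = {#m, n#}"
    using assms by (simp add: critical_local_degrees_def)
  then have "local_degree f y = m \<and> local_degree f z = n \<or> local_degree f y = n \<and> local_degree f z = m"
    by (auto simp: add_eq_conv_ex)
  then show ?thesis using that[of y z] that[of z y] yz by auto
qed

lemma noncritical_local_degree: "z \<in> fibre f v \<Longrightarrow> z \<notin> critical_points f \<inter> fibre f v \<Longrightarrow> local_degree f z = 1"
  using local_degree_eq_1_iff[OF deg] by blast

section \<open>Group elements supplied by small loops\<close>

lemma local_cycle_structure:
  assumes "p \<notin> critical_values f"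
  shows "\<exists>\<sigma>\<in>fibre_monodromy f p. \<exists>B. cycle_structure B (fibre f v) (local_degree f) (fibre f p) \<sigma>"
proof -
  obtain \<sigma> B where "\<sigma> \<in> fibre_monodromy f p"
    and "bij_betw B (SIGMA z:fibre f v. {..<local_degree f z}) (fibre f p)"
      "\<forall>z\<in>fibre f v. \<forall>j<local_degree f z. \<sigma> (B (z, j)) = B (z, Suc j mod local_degree f z)"
    using local_monodromy[OF deg assms, of v] by blast
  then show ?thesis
    by (intro bexI[of _ \<sigma>] exI[of _ B] cycle_structure.intro fibre_monodromy_permutes[OF deg]) auto
qed

lemma transposition_in_monodromy:
  assumes p: "p \<notin> critical_values f" and "{#2#} \<in> profiles f \<or> {#2, 3#} \<in> profiles f"
  shows "\<exists>a\<in>fibre f p. \<exists>b\<in>fibre f p. a \<noteq> b \<and> transposition a b \<in> fibre_monodromy f p"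
proof -
  interpret G: transitive_perm_group "fibre_monodromy f p" "fibre f p"
    by (rule transitive_perm_group_fibre_monodromy[OF deg p])
  obtain v where v: "critical_local_degrees f v = {#2#} \<or> critical_local_degrees f v = {#2, 3#}"
    using assms(2) by (force simp: profiles_def)
  have "\<exists>z0\<in>fibre f v. local_degree f z0 = 2 \<and>
      (\<forall>z\<in>fibre f v. z \<noteq> z0 \<longrightarrow> local_degree f z = 1 \<or> local_degree f z = 3)"
    using v
  proof
    assume "critical_local_degrees f v = {#2#}"
    then obtain z0 where "critical_points f \<inter> fibre f v = {z0}" "local_degree f z0 = 2"
      by (rule single_critical_point)
    then show ?thesis using noncritical_local_degree[of _ v] by blast
  next
    assume "critical_local_degrees f v = {#2, 3#}"
    then obtain y z where "critical_points f \<inter> fibre f v = {y, z}" "local_degree f y = 2" "local_degree f z = 3"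
      by (rule two_critical_points)
    then show ?thesis using noncritical_local_degree[of _ v] by blast
  qed
  then obtain z0 where z0: "z0 \<in> fibre f v" "local_degree f z0 = 2"
    "\<And>z. z \<in> fibre f v \<Longrightarrow> z \<noteq> z0 \<Longrightarrow> local_degree f z = 1 \<or> local_degree f z = 3" by blast
  obtain \<sigma> B where \<sigma>: "\<sigma> \<in> fibre_monodromy f p"
    and "cycle_structure B (fibre f v) (local_degree f) (fibre f p) \<sigma>"
    using local_cycle_structure[OF p] by blast
  then interpret cycle_structure B "fibre f v" "local_degree f" "fibre f p" \<sigma> by blast
  have "\<sigma> ^^ 3 = transposition (B (z0, 0)) (B (z0, 1))"
    by (rule cube_eq_transposition[OF z0])
  moreover have "\<sigma> ^^ 3 \<in> fibre_monodromy f p" by (rule G.funpow_mem[OF \<sigma>])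
  moreover have "B (z0, 0) \<in> fibre f p" "B (z0, 1) \<in> fibre f p"
    using B_mem[OF z0(1)] z0(2) by auto
  moreover have "B (z0, 0) \<noteq> B (z0, 1)"
    using B_eq_iff[OF z0(1) _ z0(1), of 0 1] z0(2) by simp
  ultimately show ?thesis by metis
qed

lemma three_cycle_in_monodromy:
  assumes p: "p \<notin> critical_values f" and "{#3#} \<in> profiles f"
  shows "\<exists>a\<in>fibre f p. \<exists>b\<in>fibre f p. \<exists>c\<in>fibre f p. distinct [a, b, c] \<and> three_cycle a b c \<in> fibre_monodromy f p"
proof -
  obtain v where "critical_local_degrees f v = {#3#}" using assms(2) by (force simp: profiles_def)
  then obtain z0 where z: "critical_points f \<inter> fibre f v = {z0}" "local_degree f z0 = 3"
    by (rule single_critical_point)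
  then have z0: "z0 \<in> fibre f v" "local_degree f z0 = 3"
    "\<And>z. z \<in> fibre f v \<Longrightarrow> z \<noteq> z0 \<Longrightarrow> local_degree f z = 1"
    using noncritical_local_degree[of _ v] by blast+
  obtain \<sigma> B where \<sigma>: "\<sigma> \<in> fibre_monodromy f p"
    and "cycle_structure B (fibre f v) (local_degree f) (fibre f p) \<sigma>"
    using local_cycle_structure[OF p] by blast
  then interpret cycle_structure B "fibre f v" "local_degree f" "fibre f p" \<sigma> by blast
  have "B (z0, j) \<in> fibre f p" if "j < 3" for j
    using B_mem[OF z0(1)] z0(2) that by simp
  moreover have "\<sigma> = three_cycle (B (z0, 0)) (B (z0, 1)) (B (z0, 2))"
    by (rule eq_three_cycle(1)[OF z0])
  moreover have "distinct [B (z0, 0), B (z0, 1), B (z0, 2)]"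
    by (rule eq_three_cycle(2)[OF z0])
  ultimately show ?thesis
    using \<sigma> by (intro bexI[of _ "B (z0, 0)"] bexI[of _ "B (z0, 1)"] bexI[of _ "B (z0, 2)"]) auto
qed

text \<open>A profile that does not use up the degree leaves a non-critical point in its fibre,
  which becomes a cycle of length 1. In the dihedral cases the resulting element is the reflection
  that generates a point stabilizer.\<close>

lemma fixed_point_in_monodromy:
  assumes p: "p \<notin> critical_values f" and M: "M \<in> profiles f" "sum_mset M < degree f"
  shows "\<exists>\<sigma>\<in>fibre_monodromy f p. \<exists>x\<in>fibre f p. \<sigma> x = x \<and> \<sigma> \<noteq> id"
proof -
  obtain v where v: "v \<in> critical_values f" "M = critical_local_degrees f v"
    using M(1) by (auto simp: profiles_def)
  obtain z2 where z2: "z2 \<in> fibre f v" "2 \<le> local_degree f z2"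
    using v(1) local_degree_ge_2_iff by (auto simp: critical_values_def mem_fibre)
  have "fibre f v - critical_points f \<noteq> {}"
    using sum_critical_local_degrees[of v] M(2) v(2) by (metis add.right_neutral card.empty nat_less_le)
  then obtain z1 where z1: "z1 \<in> fibre f v" "local_degree f z1 = 1"
    using noncritical_local_degree by blast
  obtain \<sigma> B where \<sigma>: "\<sigma> \<in> fibre_monodromy f p"
    and "cycle_structure B (fibre f v) (local_degree f) (fibre f p) \<sigma>"
    using local_cycle_structure[OF p] by blast
  then interpret cycle_structure B "fibre f v" "local_degree f" "fibre f p" \<sigma> by blast
  show ?thesis using fixed_point[OF z1 z2] \<sigma> by blast
qed

lemma poly_eq_fibre_product:
  "poly f x = w + lead_coeff f * (\<Prod>z\<in>fibre f w. (x - z) ^ local_degree f z)"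
proof -
  let ?q = "f - [:w:]"
  have "coeff ?q (degree f) = lead_coeff f" using deg by (simp add: coeff_pCons split: nat.splits)
  then have lc: "lead_coeff ?q = lead_coeff f" by (simp add: degree_minus_const[OF deg])
  have "poly ?q x = poly (smult (lead_coeff ?q) (\<Prod>z|poly ?q z = 0. [:-z, 1:] ^ Polynomial.order z ?q)) x"
    by (simp only: complex_poly_decompose)
  also have "\<dots> = lead_coeff f * (\<Prod>z\<in>fibre f w. (x - z) ^ Polynomial.order z ?q)"
    unfolding lc fibre_altdef by (simp add: poly_prod)
  also have "(\<Prod>z\<in>fibre f w. (x - z) ^ Polynomial.order z ?q) = (\<Prod>z\<in>fibre f w. (x - z) ^ local_degree f z)"
    by (intro prod.cong) (auto simp: local_degree_def mem_fibre)
  finally show ?thesis by (simp add: algebra_simps)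
qed

lemma poly_pderiv_eq_product:
  "poly (pderiv f) x =
     of_nat (degree f) * lead_coeff f * (\<Prod>z\<in>critical_points f. (x - z) ^ (local_degree f z - 1))"
proof -
  let ?q = "pderiv f"
  have lc: "lead_coeff ?q = of_nat (degree f) * lead_coeff f"
    using deg by (simp add: degree_pderiv coeff_pderiv)
  have "poly ?q x = poly (smult (lead_coeff ?q) (\<Prod>z|poly ?q z = 0. [:-z, 1:] ^ Polynomial.order z ?q)) x"
    by (simp only: complex_poly_decompose)
  also have "\<dots> = of_nat (degree f) * lead_coeff f * (\<Prod>z\<in>critical_points f. (x - z) ^ Polynomial.order z ?q)"
    unfolding lc critical_points_def by (simp add: poly_prod)
  finally show ?thesis by (simp add: local_degree_eq_Suc[OF deg])
qed

end

section \<open>Cyclic groups and the dihedral group of order 8\<close>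

text \<open>The existential numbering absorbs the freedom up to conjugacy, so that a concrete set of
  permutations can stand for the group.\<close>

definition has_model :: "complex poly \<Rightarrow> complex \<Rightarrow> (nat \<Rightarrow> nat) set \<Rightarrow> bool" where
  "has_model f p K \<longleftrightarrow>
     (\<exists>b. bij_betw b {1..degree f} (fibre f p) \<and> monodromy_group f p b = K)"

text \<open>The automorphism group of a directed graph on \<open>1..d\<close>: a directed cycle
  gives the cyclic group, two disjoint edges the dihedral group of order 8, a pentagon that of order
  10.\<close>

definition relation_group :: "nat \<Rightarrow> (nat \<Rightarrow> nat \<Rightarrow> bool) \<Rightarrow> (nat \<Rightarrow> nat) set" where
  "relation_group d E = {\<tau>. \<tau> permutes {1..d} \<and> (\<forall>i\<in>{1..d}. \<forall>j\<in>{1..d}. E i j \<longleftrightarrow> E (\<tau> i) (\<tau> j))}"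

lemma numbering_exists:
  assumes "0 < degree f" "p \<notin> critical_values f"
  obtains b :: "nat \<Rightarrow> complex" where "bij_betw b {1..degree f} (fibre f p)"
  using ex_bij_betw_nat_finite_1[OF finite_fibre[OF assms(1), of p]] card_fibre[OF assms] by auto

lemma has_model_symmetric:
  assumes deg: "0 < degree f" and p: "p \<notin> critical_values f"
    and all: "\<And>\<sigma>. \<sigma> permutes fibre f p \<Longrightarrow> \<sigma> \<in> fibre_monodromy f p"
  shows "has_model f p {\<tau>. \<tau> permutes {1..degree f}}"
proof -
  obtain b where b: "bij_betw b {1..degree f} (fibre f p)" using numbering_exists[OF deg p] .
  have "monodromy_group f p b = {\<tau>. \<tau> permutes {1..degree f}}"
    using mem_monodromy_group[OF b deg] all map_permutation_permutes[OF b] by blast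
  then show ?thesis using b by (auto simp: has_model_def)
qed

text \<open>Invariance of \<open>E\<close> bounds the group from above. From below,
  \<open>stab\<close> supplies the automorphisms fixing the single point \<open>e\<close>, and
  transitivity supplies the rest.\<close>

lemma has_model_relation_group:
  assumes b: "bij_betw b {1..degree f} (fibre f p)" and deg: "0 < degree f" and p: "p \<notin> critical_values f"
    and le: "\<And>\<sigma> x y. \<sigma> \<in> fibre_monodromy f p \<Longrightarrow> x \<in> fibre f p \<Longrightarrow> y \<in> fibre f p \<Longrightarrow>
        E x y \<longleftrightarrow> E (\<sigma> x) (\<sigma> y)"
    and e: "e \<in> fibre f p"
    and stab: "\<And>\<beta>. \<beta> permutes fibre f p \<Longrightarrow> \<beta> e = e \<Longrightarrow>
        (\<And>x y. x \<in> fibre f p \<Longrightarrow> y \<in> fibre f p \<Longrightarrow> E x y \<longleftrightarrow> E (\<beta> x) (\<beta> y)) \<Longrightarrow> \<beta> \<in> fibre_monodromy f p"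
    and E: "\<And>i j. i \<in> {1..degree f} \<Longrightarrow> j \<in> {1..degree f} \<Longrightarrow> E (b i) (b j) \<longleftrightarrow> E0 i j"
  shows "has_model f p (relation_group (degree f) E0)"
proof -
  interpret G: transitive_perm_group "fibre_monodromy f p" "fibre f p"
    by (rule transitive_perm_group_fibre_monodromy[OF deg p])
  have "\<alpha> \<in> fibre_monodromy f p \<longleftrightarrow>
      \<alpha> permutes fibre f p \<and> (\<forall>x\<in>fibre f p. \<forall>y\<in>fibre f p. E x y \<longleftrightarrow> E (\<alpha> x) (\<alpha> y))" for \<alpha>
  proof
    assume a: "\<alpha> permutes fibre f p \<and> (\<forall>x\<in>fibre f p. \<forall>y\<in>fibre f p. E x y \<longleftrightarrow> E (\<alpha> x) (\<alpha> y))"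
    show "\<alpha> \<in> fibre_monodromy f p"
    proof (rule G.supergroup_mem_of_stabilizer[OF e conjunct1[OF a]])
      fix \<sigma> assume \<sigma>: "\<sigma> \<in> fibre_monodromy f p" "\<sigma> (\<alpha> e) = e"
      show "\<sigma> \<circ> \<alpha> \<in> fibre_monodromy f p"
      proof (rule stab)
        show "\<sigma> \<circ> \<alpha> permutes fibre f p" using a G.permutes[OF \<sigma>(1)] by (intro permutes_compose) auto
        show "(\<sigma> \<circ> \<alpha>) e = e" using \<sigma>(2) by simp
        show "E x y \<longleftrightarrow> E ((\<sigma> \<circ> \<alpha>) x) ((\<sigma> \<circ> \<alpha>) y)" if "x \<in> fibre f p" "y \<in> fibre f p" for x y
        proof -
          have "\<alpha> x \<in> fibre f p" "\<alpha> y \<in> fibre f p"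
            using that permutes_in_image[OF conjunct1[OF a]] by blast+
          then have "E (\<alpha> x) (\<alpha> y) \<longleftrightarrow> E (\<sigma> (\<alpha> x)) (\<sigma> (\<alpha> y))" by (rule le[OF \<sigma>(1)])
          moreover have "E x y \<longleftrightarrow> E (\<alpha> x) (\<alpha> y)" using a that by blast
          ultimately show ?thesis unfolding o_apply by blast
        qed
      qed
    qed
  qed (use le G.permutes in blast)
  then have "monodromy_group f p b = relation_group (degree f) E0"
    unfolding relation_group_def by (rule monodromy_group_relation[OF b deg, of E E0, OF _ E])
  then show ?thesis unfolding has_model_def using b by blast
qed

lemma fibre_symmetry_iff:
  assumes deg: "0 < degree f" and T: "continuous_on UNIV T" "\<And>x. poly f (T x) = poly f x"
    and \<sigma>: "\<sigma> \<in> fibre_monodromy f p" and x: "x \<in> fibre f p"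
  shows "y = T x \<longleftrightarrow> \<sigma> y = T (\<sigma> x)"
proof -
  have "inj \<sigma>" using permutes_inj[OF fibre_monodromy_permutes[OF deg \<sigma>]] .
  then have "y = T x \<longleftrightarrow> \<sigma> y = \<sigma> (T x)" by (simp add: inj_eq)
  then show ?thesis using fibre_monodromy_commute[OF deg T \<sigma> x] by simp
qed

text \<open>The polynomial is \<open>v + a (x - c)^d\<close>, and the rotation \<open>T\<close>
  about \<open>c\<close> by one d-th of a turn makes the fibre a directed cycle. An automorphism of
  a directed cycle with a fixed point is the identity, so the stabilizer is trivial.\<close>

lemma has_model_cyclic:
  assumes deg: "0 < degree f" and p: "p \<notin> critical_values f" and "{#degree f#} \<in> profiles f"
  shows "has_model f p (relation_group (degree f) (\<lambda>i j. j = (if i = degree f then 1 else Suc i)))"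
proof -
  define d where "d = degree f"
  let ?X = "fibre f p"
  obtain v where v: "v \<in> critical_values f" "critical_local_degrees f v = {#d#}"
    using assms(3) by (force simp: profiles_def d_def)
  obtain c where c: "critical_points f \<inter> fibre f v = {c}" "local_degree f c = d"
    using single_critical_point[OF deg v(2)] .
  have "c \<in> fibre f v" using c(1) by blast
  then have "(\<Sum>z\<in>fibre f v. local_degree f z) = d + (\<Sum>z\<in>fibre f v - {c}. local_degree f z)"
    using c(2) by (simp add: sum.remove[OF finite_fibre[OF deg]])
  then have "(\<Sum>z\<in>fibre f v - {c}. local_degree f z) = 0"
    using sum_local_degree[OF deg, of v] by (simp add: d_def)
  then have "\<forall>z\<in>fibre f v - {c}. local_degree f z = 0"
    using sum_eq_0_iff[of "fibre f v - {c}" "local_degree f"] finite_fibre[OF deg, of v] by simp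
  then have "fibre f v - {c} = {}"
    using local_degree_pos[OF deg] by (metis all_not_in_conv less_irrefl)
  then have "fibre f v = {c}" using \<open>c \<in> fibre f v\<close> by blast
  then have fx: "poly f x = v + lead_coeff f * (x - c) ^ d" for x
    using poly_eq_fibre_product[OF deg, of x v] c(2) by simp
  have d0: "0 < d" using deg by (simp add: d_def)
  define \<omega> where "\<omega> = cis (2 * pi / real d)"
  have \<omega>_pow: "\<omega> ^ i = cis (2 * pi * real i / real d)" for i
    by (simp add: \<omega>_def Complex.DeMoivre mult_ac)
  have \<omega>d: "\<omega> ^ d = 1" using d0 by (simp add: \<omega>_pow)
  define T where "T = (\<lambda>x. c + \<omega> * (x - c))"
  have contT: "continuous_on UNIV T" unfolding T_def by (intro continuous_intros)
  have fT: "poly f (T x) = poly f x" for x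
    unfolding fx by (simp add: T_def power_mult_distrib \<omega>d)
  have "card ?X \<noteq> 0" using card_fibre[OF deg p] deg by simp
  then obtain x0 where x0: "x0 \<in> ?X" by fastforce
  have x0c: "x0 \<noteq> c"
  proof
    assume "x0 = c"
    then have "p = v" using x0 fx[of c] zero_power[OF d0, where ?'a = complex] by (simp add: mem_fibre)
    then show False using p v(1) by simp
  qed
  \<comment> \<open>The exponent is \<open>i - 1\<close> because the numbering starts at 1:
    \<open>b 1\<close> is \<open>x0\<close>, and \<open>T\<close> carries \<open>b d\<close> back to
    \<open>b 1\<close>.\<close>
  define b where "b = (\<lambda>i. c + \<omega> ^ (i - 1) * (x0 - c))"
  have bX: "b i \<in> ?X" for i
  proof -
    have "(\<omega> ^ (i - 1)) ^ d = 1" using \<omega>d by (metis power_commutes power_mult power_one mult.commute)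
    then show ?thesis using x0 unfolding mem_fibre fx by (simp add: b_def power_mult_distrib)
  qed
  have inj: "inj_on b {1..d}"
  proof (rule inj_onI)
    fix i j assume ij: "i \<in> {1..d}" "j \<in> {1..d}" "b i = b j"
    then have "\<omega> ^ (i - 1) = \<omega> ^ (j - 1)" using x0c by (simp add: b_def)
    moreover have "inj_on (\<lambda>k. \<omega> ^ k) {..<d}"
      unfolding \<omega>_pow using Complex.bij_betw_roots_unity[OF d0] by (simp add: bij_betw_def)
    ultimately have "i - 1 = j - 1" using ij by (elim inj_onD) auto
    then show "i = j" using ij by auto
  qed
  have b: "bij_betw b {1..d} ?X"
  proof -
    have "b ` {1..d} = ?X"
      using bX card_image[OF inj] card_fibre[OF deg p] finite_fibre[OF deg, of p]
      by (intro card_subset_eq) (auto simp: d_def)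
    then show ?thesis using inj by (simp add: bij_betw_def)
  qed
  have Tb: "T (b i) = b (if i = d then 1 else Suc i)" if i: "i \<in> {1..d}" for i
  proof -
    have "\<omega> * \<omega> ^ (i - 1) = \<omega> ^ i" using i by (simp flip: power_Suc)
    then have "T (b i) = c + \<omega> ^ i * (x0 - c)" by (simp add: T_def b_def mult.assoc[symmetric])
    then show ?thesis using \<omega>d by (simp add: b_def)
  qed
  show ?thesis
  proof (rule has_model_relation_group[where E = "\<lambda>x y. y = T x" and e = x0])
    show "bij_betw b {1..degree f} (fibre f p)" using b by (simp add: d_def)
    show "y = T x \<longleftrightarrow> \<sigma> y = T (\<sigma> x)" if "\<sigma> \<in> fibre_monodromy f p" "x \<in> ?X" for \<sigma> x y
      by (rule fibre_symmetry_iff[OF deg contT fT that])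
    show "b j = T (b i) \<longleftrightarrow> j = (if i = degree f then 1 else Suc i)"
      if "i \<in> {1..degree f}" "j \<in> {1..degree f}" for i j
    proof -
      have "(if i = d then 1 else Suc i) \<in> {1..d}" using that by (auto simp: d_def)
      then show ?thesis
        using Tb[of i] inj_on_eq_iff[OF inj, of j "if i = d then 1 else Suc i"] that by (simp add: d_def)
    qed
    fix \<beta> assume \<beta>: "\<beta> permutes ?X" "\<beta> x0 = x0"
      and com: "\<And>x y. x \<in> ?X \<Longrightarrow> y \<in> ?X \<Longrightarrow> y = T x \<longleftrightarrow> \<beta> y = T (\<beta> x)"
    \<comment> \<open>A permutation that commutes with the rotation and fixes \<open>x0\<close>
      fixes the whole orbit.\<close>
    have "Suc k \<in> {1..d} \<Longrightarrow> \<beta> (b (Suc k)) = b (Suc k)" for k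
    proof (induction k)
      case 0
      then show ?case using \<beta>(2) by (simp add: b_def One_nat_def)
    next
      case (Suc k)
      then have k: "Suc k \<in> {1..d}" "Suc k \<noteq> d" by auto
      then have "b (Suc (Suc k)) = T (b (Suc k))" using Tb[OF k(1)] by simp
      then show ?case using com[OF bX bX, of "Suc (Suc k)" "Suc k"] Suc.IH[OF k(1)] by simp
    qed
    then have fixed: "\<beta> (b i) = b i" if "i \<in> {1..d}" for i
      using that by (cases i) auto
    have "\<beta> = id"
    proof
      fix x show "\<beta> x = id x"
      proof (cases "x \<in> ?X")
        case True
        then obtain i where "i \<in> {1..d}" "x = b i" using b unfolding bij_betw_def by blast
        then show ?thesis using fixed by simp
      qed (use \<beta>(1) in \<open>simp add: permutes_not_in\<close>)
    qed
    then show "\<beta> \<in> fibre_monodromy f p" using fibre_monodromy_id[OF deg p] by simp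
  qed (use deg p x0 in auto)
qed

text \<open>The chain rule for the reflection. At its centre the derivative equals its own negative,
  so a fixed point of the symmetry is critical.\<close>

lemma pderiv_reflection:
  fixes f :: "complex poly"
  assumes "\<And>x. poly f (s - x) = poly f x"
  shows "poly (pderiv f) (s - x) = - poly (pderiv f) x"
proof -
  have "poly (pcompose f [:s, -1:]) x = poly f x" for x
    using assms[of x] by (simp add: poly_pcompose)
  then have "pcompose f [:s, -1:] = f" by (simp flip: poly_eq_poly_eq_iff add: fun_eq_iff)
  then have "pderiv f = pcompose (pderiv f) [:s, -1:] * pderiv [:s, -1:]"
    using pderiv_pcompose[of f "[:s, -1:]"] by simp
  from arg_cong[OF this, of "\<lambda>q. poly q x"] show ?thesis
    by (simp add: pderiv_pCons poly_pcompose)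
qed

text \<open>The profile \<open>{#2, 2#}\<close> makes \<open>f - v\<close> a constant times the
  square of a quadratic, so the reflection \<open>T\<close> about the midpoint of its roots pairs
  off the fibre. An automorphism of the pairing that fixes \<open>x0\<close> also fixes its partner
  and can at most swap the other two points; a small loop of type \<open>{#2#}\<close> realizes this
  swap, up to the choice of \<open>x0\<close>.\<close>

lemma has_model_dihedral_4:
  assumes deg: "degree f = 4" and p: "p \<notin> critical_values f"
    and P: "{#2, 2#} \<in> profiles f" "{#2#} \<in> profiles f"
  shows "has_model f p (relation_group 4 (\<lambda>i j. (i, j) \<in> {(1, 2), (2, 1), (3, 4), (4, 3)}))"
proof -
  let ?X = "fibre f p"
  have deg0: "0 < degree f" using deg by simp
  obtain v where v: "critical_local_degrees f v = {#2, 2#}"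
    using P(1) by (force simp: profiles_def)
  obtain \<alpha> \<beta> where ab: "critical_points f \<inter> fibre f v = {\<alpha>, \<beta>}" "\<alpha> \<noteq> \<beta>"
      "local_degree f \<alpha> = 2" "local_degree f \<beta> = 2"
    using two_critical_points[OF deg0 v] .
  have "card (fibre f v - critical_points f) = 0"
    using sum_critical_local_degrees[OF deg0, of v] v deg by simp
  then have "fibre f v = {\<alpha>, \<beta>}" using finite_fibre[OF deg0, of v] ab(1) by auto
  then have fx: "poly f x = v + lead_coeff f * ((x - \<alpha>)\<^sup>2 * (x - \<beta>)\<^sup>2)" for x
    using poly_eq_fibre_product[OF deg0, of x v] ab by simp
  define T where "T = (\<lambda>x. (\<alpha> + \<beta>) - x)"
  have contT: "continuous_on UNIV T" unfolding T_def by (intro continuous_intros)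
  have fT: "poly f (T x) = poly f x" for x
    unfolding fx T_def by (simp add: algebra_simps power2_eq_square)
  have TT: "T (T x) = x" for x by (simp add: T_def)
  have TX: "T x \<in> ?X \<longleftrightarrow> x \<in> ?X" for x by (simp add: mem_fibre fT)
  have Tne: "T x \<noteq> x" if "x \<in> ?X" for x
  proof
    assume "T x = x"
    then have "poly (pderiv f) x = 0"
      using pderiv_reflection[of f "\<alpha> + \<beta>" x] fT by (simp add: T_def)
    then show False using p that by (auto simp: critical_values_def critical_points_def mem_fibre)
  qed
  obtain \<sigma> x0 where \<sigma>: "\<sigma> \<in> fibre_monodromy f p" "x0 \<in> ?X" "\<sigma> x0 = x0" "\<sigma> \<noteq> id"
    using fixed_point_in_monodromy[OF deg0 p P(2)] deg by auto
  have card4: "card ?X = 4" using card_fibre[OF deg0 p] deg by simp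
  have "card {x0, T x0} = 2" using Tne[OF \<sigma>(2)] by simp
  then have "\<not> ?X \<subseteq> {x0, T x0}" using card4 card_mono[of "{x0, T x0}" ?X] by auto
  then obtain y where y: "y \<in> ?X" "y \<noteq> x0" "y \<noteq> T x0" by blast
  have dist: "distinct [x0, T x0, y, T y]"
    using Tne[OF \<sigma>(2)] Tne[OF y(1)] y TT by (auto dest: arg_cong[where f = T])
  have "card {x0, T x0, y, T y} = 4" using distinct_card[OF dist] by simp
  then have X: "?X = {x0, T x0, y, T y}"
    using card4 finite_fibre[OF deg0, of p] \<sigma>(2) y(1) TX by (intro card_subset_eq[symmetric]) simp_all
  define b where "b = (\<lambda>i::nat. [x0, T x0, y, T y] ! (i - 1))"
  have b_simps: "b 1 = x0" "b 2 = T x0" "b 3 = y" "b 4 = T y" by (simp_all add: b_def)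
  have I4: "{1..4::nat} = {1, 2, 3, 4}" by auto
  have b: "bij_betw b {1..4} ?X"
    using dist unfolding bij_betw_def I4 X by (auto simp: b_simps)
  have com: "\<tau> (T x) = T (\<tau> x)" if "\<tau> \<in> fibre_monodromy f p" "x \<in> ?X" for \<tau> x
    by (rule fibre_monodromy_commute[OF deg0 contT fT that])
  have rigid: "\<tau> = id \<or> \<tau> y = T y" "\<tau> (T x0) = T x0" "\<tau> (T y) = T (\<tau> y)"
    if \<tau>: "\<tau> permutes ?X" "\<tau> x0 = x0" and c: "\<And>x. x \<in> ?X \<Longrightarrow> \<tau> (T x) = T (\<tau> x)" for \<tau>
  proof -
    show 1: "\<tau> (T x0) = T x0" and 2: "\<tau> (T y) = T (\<tau> y)" using c \<sigma>(2) y(1) \<tau>(2) by auto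
    have "\<tau> y \<in> ?X" using permutes_in_image[OF \<tau>(1)] y(1) by simp
    moreover have "\<tau> y \<noteq> x0" "\<tau> y \<noteq> T x0"
      using inj_eq[OF permutes_inj[OF \<tau>(1)]] y \<tau>(2) 1 by metis+
    ultimately have "\<tau> y = y \<or> \<tau> y = T y" unfolding X by blast
    moreover have "\<tau> = id" if "\<tau> y = y"
    proof
      fix x show "\<tau> x = id x"
        using that \<tau> 1 2 X permutes_not_in[OF \<tau>(1), of x] by (cases "x \<in> ?X") auto
    qed
    ultimately show "\<tau> = id \<or> \<tau> y = T y" by blast
  qed
  have \<sigma>y: "\<sigma> y = T y" using rigid(1)[OF fibre_monodromy_permutes[OF deg0 \<sigma>(1)] \<sigma>(3) com[OF \<sigma>(1)]] \<sigma>(4) by blast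
  have "has_model f p (relation_group (degree f) (\<lambda>i j. (i, j) \<in> {(1, 2), (2, 1), (3, 4), (4, 3)}))"
  proof (rule has_model_relation_group[where E = "\<lambda>x y. y = T x" and e = x0])
    show "bij_betw b {1..degree f} ?X" using b deg by simp
    show "y = T x \<longleftrightarrow> \<tau> y = T (\<tau> x)" if "\<tau> \<in> fibre_monodromy f p" "x \<in> ?X" for \<tau> x y
      by (rule fibre_symmetry_iff[OF deg0 contT fT that])
    show "b j = T (b i) \<longleftrightarrow> (i, j) \<in> {(1, 2), (2, 1), (3, 4), (4, 3)}"
      if "i \<in> {1..degree f}" "j \<in> {1..degree f}" for i j
    proof -
      have "i = 1 \<or> i = 2 \<or> i = 3 \<or> i = 4" "j = 1 \<or> j = 2 \<or> j = 3 \<or> j = 4" using that deg by auto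
      then show ?thesis using dist by (elim disjE) (auto simp: b_simps TT)
    qed
    fix \<tau> assume \<tau>: "\<tau> permutes ?X" "\<tau> x0 = x0"
      and E: "\<And>x y. x \<in> ?X \<Longrightarrow> y \<in> ?X \<Longrightarrow> y = T x \<longleftrightarrow> \<tau> y = T (\<tau> x)"
    have c: "\<tau> (T x) = T (\<tau> x)" if "x \<in> ?X" for x using E[OF that, of "T x"] TX that by simp
    show "\<tau> \<in> fibre_monodromy f p"
    proof (cases "\<tau> = id")
      case True
      then show ?thesis using fibre_monodromy_id[OF deg0 p] by simp
    next
      case False
      then have \<tau>y: "\<tau> y = T y" using rigid(1)[OF \<tau> c] by blast
      have \<tau>': "\<tau> (T x0) = T x0" "\<tau> (T y) = T (T y)" using rigid(2,3)[OF \<tau> c] \<tau>y by auto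
      have \<sigma>': "\<sigma> (T x0) = T x0" "\<sigma> (T y) = T (T y)"
        using rigid(2,3)[OF fibre_monodromy_permutes[OF deg0 \<sigma>(1)] \<sigma>(3) com[OF \<sigma>(1)]] \<sigma>y by auto
      have "\<tau> x = \<sigma> x" for x
      proof (cases "x \<in> ?X")
        case True
        then have "x = x0 \<or> x = T x0 \<or> x = y \<or> x = T y" unfolding X by blast
        then show ?thesis using \<tau>y \<sigma>y \<tau>' \<sigma>' \<tau>(2) \<sigma>(3) by (elim disjE) simp_all
      next
        case False
        then show ?thesis
          using permutes_not_in[OF \<tau>(1)] permutes_not_in[OF fibre_monodromy_permutes[OF deg0 \<sigma>(1)]] by simp
      qed
      then have "\<tau> = \<sigma>" by (rule ext)
      then show ?thesis using \<sigma>(1) by simp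
    qed
  qed (use deg0 p \<sigma>(2) in auto)
  then show ?thesis using deg by simp
qed

section \<open>Quartics with full monodromy\<close>

lemma poly_pderiv_eqI:
  fixes f :: "complex poly"
  assumes "\<And>x. poly f x = F x" "(F has_field_derivative D) (at x)"
  shows "poly (pderiv f) x = D"
proof -
  have "poly f = F" using assms(1) by (rule ext)
  then show ?thesis using DERIV_unique[OF poly_DERIV[of f x]] assms(2) by simp
qed

text \<open>Centering at the mean \<open>c\<close> of the roots removes the cubic term;
  \<open>B\<close> then measures the failure of \<open>f\<close> to be even about
  \<open>c\<close>.\<close>

lemma quartic_normal_form:
  fixes f :: "complex poly"
  assumes "degree f = 4"
  obtains a c A B C where "a \<noteq> 0"
    "\<And>x. poly f x = a * ((x - c) ^ 4 + A * (x - c)\<^sup>2 + B * (x - c)) + C"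
    "\<And>x. poly (pderiv f) x = a * (4 * (x - c) ^ 3 + 2 * A * (x - c) + B)"
proof -
  define a where "a = coeff f 4"
  have a: "a \<noteq> 0" using assms leading_coeff_0_iff[of f] by (auto simp: a_def)
  have f: "poly f x = coeff f 0 + coeff f 1 * x + coeff f 2 * x ^ 2 + coeff f 3 * x ^ 3 + a * x ^ 4" for x
  proof -
    have "{..4::nat} = {0, 1, 2, 3, 4}" by auto
    then show ?thesis by (simp add: poly_altdef assms a_def)
  qed
  define c where "c = - coeff f 3 / (4 * a)"
  define A where "A = coeff f 2 / a - 6 * c\<^sup>2"
  define B where "B = coeff f 1 / a + 4 * c ^ 3 + 2 * A * c"
  define C where "C = coeff f 0 - a * (c ^ 4 + A * c\<^sup>2 - B * c)"
  have e: "coeff f 3 = - 4 * a * c" "coeff f 2 = a * A + 6 * a * c\<^sup>2"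
      "coeff f 1 = a * B - 4 * a * c ^ 3 - 2 * a * A * c"
      "coeff f 0 = C + a * (c ^ 4 + A * c\<^sup>2 - B * c)"
    using a by (simp_all add: c_def A_def B_def C_def algebra_simps)
  have fx: "poly f x = a * ((x - c) ^ 4 + A * (x - c)\<^sup>2 + B * (x - c)) + C" for x
    unfolding f e by (simp add: algebra_simps power4_eq_xxxx power3_eq_cube power2_eq_square)
  moreover have "poly (pderiv f) x = a * (4 * (x - c) ^ 3 + 2 * A * (x - c) + B)" for x
    by (rule poly_pderiv_eqI[OF fx]) (auto intro!: derivative_eq_intros simp: algebra_simps)
  ultimately show ?thesis using that a by blast
qed

text \<open>For \<open>A \<noteq> 0\<close> the critical points \<open>c + r\<close> and
  \<open>c - r\<close> with \<open>r^2 = - A / 2\<close> have the same value, so some profile has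
  two entries; for \<open>A = 0\<close> the only critical point is \<open>c\<close>, with defect 3.
  Contrapositively this provides \<open>B \<noteq> 0\<close>.\<close>

lemma even_quartic_profiles:
  assumes deg: "degree f = 4" and a: "a \<noteq> 0"
    and f: "\<And>x. poly f x = a * ((x - c) ^ 4 + A * (x - c)\<^sup>2) + C"
    and f': "\<And>x. poly (pderiv f) x = a * (4 * (x - c) ^ 3 + 2 * A * (x - c))"
  shows "{#4#} \<in> profiles f \<or> {#2, 2#} \<in> profiles f"
proof (rule ccontr)
  assume no: "\<not> ?thesis"
  have deg0: "0 < degree f" using deg by simp
  have M: "M = {#2#} \<or> M = {#3#}" if "M \<in> profiles f" for M
    using profile_cases[OF deg0 _ that] that no deg by auto
  have one: "card (critical_points f \<inter> fibre f v) = 1" if "v \<in> critical_values f" for v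
    using M[of "critical_local_degrees f v"] that size_critical_local_degrees[OF deg0, of v]
    by (auto simp: profiles_def)
  show False
  proof (cases "A = 0")
    case False
    define r where "r = csqrt (- A / 2)"
    have r2: "r\<^sup>2 = - A / 2" by (simp add: r_def)
    have r: "r \<noteq> 0" using r2 False by auto
    have "A = - 2 * r\<^sup>2" using r2 by simp
    then have crit: "c + r \<in> critical_points f" "c - r \<in> critical_points f"
      by (simp_all add: critical_points_def f' power3_eq_cube power2_eq_square)
    have val: "poly f (c - r) = poly f (c + r)" by (simp add: f)
    have "{c + r, c - r} \<subseteq> critical_points f \<inter> fibre f (poly f (c + r))"
      using crit val by (simp add: mem_fibre)
    then have "card {c + r, c - r} \<le> 1"
      using one[of "poly f (c + r)"] card_mono[OF finite_critical_fibre[OF deg0, of "poly f (c + r)"]] crit(1)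
      by (metis critical_values_def imageI)
    moreover have "c + r \<noteq> c - r"
    proof -
      have "(c + r) - (c - r) = 2 * r" by simp
      then show ?thesis using r by (metis mult_eq_0_iff right_minus_eq zero_neq_numeral)
    qed
    ultimately show False by simp
  next
    case True
    then have "critical_points f = {c}" using a by (auto simp: critical_points_def f')
    then have V: "critical_values f = {poly f c}" by (simp add: critical_values_def)
    then have "defect (critical_local_degrees f (poly f c)) = 3"
      using sum_defect[OF deg0] deg by simp
    moreover have "critical_local_degrees f (poly f c) \<in> profiles f" by (simp add: profiles_def V)
    ultimately show False using M by (force simp: defect_def)
  qed
qed

text \<open>Unordered pairs of points in a fibre are parametrised by their sum, which ranges over a
  punctured plane; a path between two such sums is followed by the corresponding pair.\<close>

lemma quartic_pair_transitive:
  assumes deg: "degree f = 4" and a: "a \<noteq> 0" and B: "B \<noteq> 0"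
    and f: "\<And>x. poly f x = a * ((x - c) ^ 4 + A * (x - c)\<^sup>2 + B * (x - c)) + C"
    and f': "\<And>x. poly (pderiv f) x = a * (4 * (x - c) ^ 3 + 2 * A * (x - c) + B)"
    and p: "p \<notin> critical_values f"
    and x: "x \<in> fibre f p" "y \<in> fibre f p" "x \<noteq> y"
    and x': "x' \<in> fibre f p" "y' \<in> fibre f p" "x' \<noteq> y'"
  shows "\<exists>\<sigma>\<in>fibre_monodromy f p. {\<sigma> x, \<sigma> y} = {x', y'}"
proof -
  have deg0: "0 < degree f" using deg by simp
  \<comment> \<open>With \<open>Z = z - c\<close>, these are the constant terms of the factors
    \<open>Z^2 - s Z + m s\<close> and \<open>Z^2 + s Z + n s\<close>, belonging to a pair with sum
    \<open>s\<close> and the complementary pair with sum \<open>- s\<close>. \<open>P s\<close> is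
    the value whose fibre they divide.\<close>
  define m where "m = (\<lambda>s. (s\<^sup>2 + A + B / s) / 2)"
  define n where "n = (\<lambda>s. (s\<^sup>2 + A - B / s) / 2)"
  define P where "P = (\<lambda>s. C - a * (m s * n s))"
  have mn: "m s + n s = s\<^sup>2 + A" "s * (m s - n s) = B" if "s \<noteq> 0" for s
    using that by (simp_all add: m_def n_def field_simps)
  have fac: "poly f z - P s = a * (((z - c)\<^sup>2 - s * (z - c) + m s) * ((z - c)\<^sup>2 + s * (z - c) + n s))"
    if "s \<noteq> 0" for s z
  proof -
    define Z where "Z = z - c"
    have "(Z\<^sup>2 - s * Z + m s) * (Z\<^sup>2 + s * Z + n s) =
        Z ^ 4 + (m s + n s - s\<^sup>2) * Z\<^sup>2 + s * (m s - n s) * Z + m s * n s"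
      by (simp add: algebra_simps power2_eq_square power4_eq_xxxx)
    also have "\<dots> = Z ^ 4 + A * Z\<^sup>2 + B * Z + m s * n s" by (simp add: mn[OF that])
    finally have e: "(Z\<^sup>2 - s * Z + m s) * (Z\<^sup>2 + s * Z + n s) = Z ^ 4 + A * Z\<^sup>2 + B * Z + m s * n s" .
    show ?thesis
      unfolding f P_def Z_def[symmetric] e by (simp add: algebra_simps)
  qed
  have pair: "s \<noteq> 0 \<and> m s = (u - c) * (w - c) \<and> P s = p"
    if "u \<in> fibre f p" "w \<in> fibre f p" "u \<noteq> w" "s = (u - c) + (w - c)" for u w s
  proof -
    define X where "X = u - c"
    define Y where "Y = w - c"
    have "poly f u - poly f w = 0" using that(1,2) by (simp add: mem_fibre)
    moreover have "poly f u - poly f w = a * ((X - Y) * (s * (X\<^sup>2 + Y\<^sup>2) + A * s + B))"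
      unfolding f that(4) by (simp add: X_def[symmetric] Y_def[symmetric] algebra_simps
          power2_eq_square power4_eq_xxxx)
    moreover have "X \<noteq> Y" using that(3) by (simp add: X_def Y_def)
    ultimately have e: "s * (X\<^sup>2 + Y\<^sup>2) + A * s + B = 0" using a by simp
    \<comment> \<open>The divided difference of \<open>f\<close> would reduce to \<open>B\<close> at
      \<open>s = 0\<close>.\<close>
    then have s: "s \<noteq> 0" using B by auto
    have "B = - s * (X\<^sup>2 + Y\<^sup>2 + A)" using e by (simp add: algebra_simps eq_neg_iff_add_eq_0)
    then have "B / s = - (X\<^sup>2 + Y\<^sup>2 + A)" using s by simp
    moreover have "s = X + Y" by (simp add: that(4) X_def Y_def)
    ultimately have m: "m s = X * Y" by (simp add: m_def power2_sum)
    have "poly f u - P s = 0"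
      unfolding fac[OF s] m by (simp add: \<open>s = X + Y\<close> X_def[symmetric] algebra_simps power2_eq_square)
    then show ?thesis using s m that(1) by (simp add: mem_fibre X_def Y_def)
  qed
  define s0 where "s0 = (x - c) + (y - c)"
  define s1 where "s1 = (x' - c) + (y' - c)"
  have s0: "s0 \<noteq> 0" "m s0 = (x - c) * (y - c)" "P s0 = p" using pair[OF x s0_def] by auto
  have s1: "s1 \<noteq> 0" "m s1 = (x' - c) * (y' - c)" "P s1 = p" using pair[OF x' s1_def] by auto
  \<comment> \<open>Sums where the formulas break down or the fibre degenerates. Clearing
    denominators in \<open>P s = v\<close> gives an equation of degree 6 in \<open>s\<close> with
    leading coefficient \<open>a\<close>, so there are finitely many.\<close>
  define bad where "bad = insert 0 {s. s \<noteq> 0 \<and> P s \<in> critical_values f}"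
  have "{s. s \<noteq> 0 \<and> P s \<in> critical_values f} \<subseteq>
      (\<Union>v\<in>critical_values f. {s. poly [:- a * B\<^sup>2, 0, a * A\<^sup>2 + 4 * (v - C), 0, 2 * a * A, 0, a:] s = 0})"
  proof clarify
    fix s assume s: "s \<noteq> 0" "P s \<in> critical_values f"
    have e: "4 * s\<^sup>2 * (m s * n s) = (s * (s\<^sup>2 + A) + B) * (s * (s\<^sup>2 + A) - B)"
      using s(1) by (simp add: m_def n_def field_simps power2_eq_square)
    have "4 * s\<^sup>2 * (P s - C) + a * (4 * s\<^sup>2 * (m s * n s)) = 0"
      by (simp add: P_def algebra_simps)
    then have "4 * s\<^sup>2 * (P s - C) + a * ((s * (s\<^sup>2 + A) + B) * (s * (s\<^sup>2 + A) - B)) = 0"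
      unfolding e .
    then have "poly [:- a * B\<^sup>2, 0, a * A\<^sup>2 + 4 * (P s - C), 0, 2 * a * A, 0, a:] s = 0"
      by (simp add: algebra_simps power2_eq_square)
    then show "s \<in> (\<Union>v\<in>critical_values f.
        {s. poly [:- a * B\<^sup>2, 0, a * A\<^sup>2 + 4 * (v - C), 0, 2 * a * A, 0, a:] s = 0})"
      using s(2) by blast
  qed
  moreover have "finite (\<Union>v\<in>critical_values f.
      {s. poly [:- a * B\<^sup>2, 0, a * A\<^sup>2 + 4 * (v - C), 0, 2 * a * A, 0, a:] s = 0})"
    using finite_critical_values[OF deg0] a by (intro finite_UN_I poly_roots_finite) auto
  ultimately have "finite bad" unfolding bad_def by (simp add: finite_subset)
  then have "path_connected (- bad)"
    by (intro path_connected_complement_countable countable_finite) simp_all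
  moreover have "s0 \<in> - bad" "s1 \<in> - bad" using s0 s1 p by (auto simp: bad_def)
  ultimately obtain \<delta> where \<delta>: "path \<delta>" "path_image \<delta> \<subseteq> - bad" "pathstart \<delta> = s0" "pathfinish \<delta> = s1"
    unfolding path_connected_def by metis
  have \<delta>t: "\<delta> t \<noteq> 0" "P (\<delta> t) \<notin> critical_values f" if "t \<in> {0..1}" for t
  proof -
    have "\<delta> t \<in> - bad" using \<delta>(2) that unfolding path_image_def by blast
    then show "\<delta> t \<noteq> 0" "P (\<delta> t) \<notin> critical_values f" by (auto simp: bad_def)
  qed
  define \<gamma> where "\<gamma> = (\<lambda>t. P (\<delta> t))"
  have cont\<delta>: "continuous_on {0..1} \<delta>" using \<delta>(1) by (simp add: path_def)
  have cm: "continuous_on {0..1} (\<lambda>t. m (\<delta> t))" and cn: "continuous_on {0..1} (\<lambda>t. n (\<delta> t))"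
    unfolding m_def n_def using \<delta>t(1) by (auto intro!: continuous_intros cont\<delta>)
  have loop: "loop_avoiding_critical_values f p \<gamma>"
    unfolding loop_avoiding_critical_values_def
  proof (intro conjI)
    show "path \<gamma>" unfolding path_def \<gamma>_def P_def by (intro continuous_intros cm cn)
    show "pathstart \<gamma> = p" "pathfinish \<gamma> = p"
      using \<delta>(3,4) s0(3) s1(3) by (simp_all add: \<gamma>_def pathstart_def pathfinish_def)
    show "path_image \<gamma> \<subseteq> - critical_values f" using \<delta>t(2) by (auto simp: \<gamma>_def path_image_def)
  qed
  then have avoid: "avoiding_path f \<gamma>" "pathstart \<gamma> = p" by (simp_all add: loop_iff_avoiding_path)
  obtain \<sigma> where \<sigma>: "\<sigma> \<in> fibre_monodromy f p" "\<And>w. w \<in> fibre f p \<Longrightarrow> \<sigma> w = transport f \<gamma> w"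
    using fibre_monodromy_of_loop[OF deg0 loop] by blast
  have mem: "\<sigma> w = x' \<or> \<sigma> w = y'" if w: "w \<in> fibre f p" "w = x \<or> w = y" for w
  proof -
    obtain h where h: "is_lift f \<gamma> h" "pathstart h = w"
      using lift_exists[OF deg0 avoid(1), of w] avoid(2) w(1) by auto
    have conth: "continuous_on {0..1} h" using h(1) by (simp add: is_lift_def path_def)
    \<comment> \<open>The lift starts as a root of the first factor and must remain one, since it
      could change factors only where both vanish.\<close>
    let ?\<phi> = "\<lambda>t. (h t - c)\<^sup>2 - \<delta> t * (h t - c) + m (\<delta> t)"
    let ?\<psi> = "\<lambda>t. (h t - c)\<^sup>2 + \<delta> t * (h t - c) + n (\<delta> t)"
    have "?\<phi> 1 = 0 \<longleftrightarrow> ?\<phi> 0 = 0"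
    proof (rule product_zero_on_interval)
      show "continuous_on {0..1} ?\<phi>" "continuous_on {0..1} ?\<psi>"
        by (intro continuous_intros conth cont\<delta> cm cn)+
      fix t :: real assume t: "t \<in> {0..1}"
      have ht: "poly f (h t) = P (\<delta> t)" using h(1) t by (simp add: is_lift_def \<gamma>_def)
      then show "?\<phi> t * ?\<psi> t = 0" using fac[OF \<delta>t(1)[OF t], of "h t"] a by simp
      show "?\<phi> t \<noteq> 0 \<or> ?\<psi> t \<noteq> 0"
      proof (rule ccontr)
        assume "\<not> ?thesis"
        then have z: "?\<phi> t = 0" "?\<psi> t = 0" by auto
        define Z where "Z = h t - c"
        define s where "s = \<delta> t"
        have s: "s \<noteq> 0" using \<delta>t(1)[OF t] by (simp add: s_def)
        \<comment> \<open>The derivative of the product of the two factors: a common root would be a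
          critical point of \<open>f\<close>.\<close>
        have "(2 * Z - s) * (Z\<^sup>2 + s * Z + n s) + (2 * Z + s) * (Z\<^sup>2 - s * Z + m s) =
            4 * Z ^ 3 + 2 * (m s + n s - s\<^sup>2) * Z + s * (m s - n s)"
          by (simp add: algebra_simps power2_eq_square power3_eq_cube)
        also have "\<dots> = 4 * Z ^ 3 + 2 * A * Z + B" by (simp add: mn[OF s])
        finally have "poly (pderiv f) (h t) = 0" using z by (simp add: f' Z_def s_def)
        then have "P (\<delta> t) \<in> critical_values f"
          unfolding critical_values_def critical_points_def ht[symmetric] by blast
        then show False using \<delta>t(2)[OF t] by simp
      qed
    qed
    moreover have "?\<phi> 0 = 0"
    proof -
      have "h 0 = w" "\<delta> 0 = s0" using h(2) \<delta>(3) by (simp_all add: pathstart_def)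
      then have "?\<phi> 0 = (w - x) * (w - y)"
        by (simp add: s0(2)) (simp add: s0_def algebra_simps power2_eq_square)
      then show ?thesis using w(2) by auto
    qed
    ultimately have \<phi>1: "?\<phi> 1 = 0" by simp
    have "h 1 = \<sigma> w" "\<delta> 1 = s1"
      using transport_lift[OF deg0 avoid(1) h(1)] h(2) \<sigma>(2)[OF w(1)] \<delta>(4) by (simp_all add: pathfinish_def)
    then have "?\<phi> 1 = (\<sigma> w - x') * (\<sigma> w - y')"
      by (simp add: s1(2)) (simp add: s1_def algebra_simps power2_eq_square)
    with \<phi>1 show ?thesis by auto
  qed
  have "\<sigma> x \<noteq> \<sigma> y"
    using x(3) inj_eq[OF permutes_inj[OF fibre_monodromy_permutes[OF deg0 \<sigma>(1)]]] by simp
  then have "{\<sigma> x, \<sigma> y} = {x', y'}" using mem[OF x(1)] mem[OF x(2)] by auto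
  then show ?thesis using \<sigma>(1) by blast
qed

text \<open>Excluding \<open>{#4#}\<close> leaves, by parity of the total defect, a profile
  \<open>{#2#}\<close> and hence a transposition; excluding both profiles gives
  \<open>B \<noteq> 0\<close> and with it transitivity on pairs.\<close>

lemma has_model_symmetric_4:
  assumes deg: "degree f = 4" and p: "p \<notin> critical_values f"
    and P: "{#4#} \<notin> profiles f" "{#2, 2#} \<notin> profiles f"
  shows "has_model f p {\<tau>. \<tau> permutes {1..degree f}}"
proof -
  have deg0: "0 < degree f" using deg by simp
  interpret G: transitive_perm_group "fibre_monodromy f p" "fibre f p"
    by (rule transitive_perm_group_fibre_monodromy[OF deg0 p])
  obtain a c A B C where f: "a \<noteq> 0"
      "\<And>x. poly f x = a * ((x - c) ^ 4 + A * (x - c)\<^sup>2 + B * (x - c)) + C"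
      "\<And>x. poly (pderiv f) x = a * (4 * (x - c) ^ 3 + 2 * A * (x - c) + B)"
    by (rule quartic_normal_form[OF deg]) (assumption | rule that)+
  have B: "B \<noteq> 0"
  proof
    assume "B = 0"
    then show False using even_quartic_profiles[OF deg f(1), of c A C] f(2,3) P by simp
  qed
  obtain u w where uw: "u \<in> fibre f p" "w \<in> fibre f p" "u \<noteq> w" "transposition u w \<in> fibre_monodromy f p"
    using transposition_in_monodromy[OF deg0 p] profiles_degree_4[OF deg0 deg P(1)] by blast
  show ?thesis
  proof (rule has_model_symmetric[OF deg0 p])
    fix \<sigma> assume "\<sigma> permutes fibre f p"
    then show "\<sigma> \<in> fibre_monodromy f p"
      by (rule G.all_permutations_of_pair_transitive[OF uw(4,1,2,3), rotated])
        (rule quartic_pair_transitive[OF deg f(1) B f(2,3) p uw(1,2,3)])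
  qed
qed

section \<open>The alternating group of degree 5\<close>

text \<open>The grouping makes the effect of exchanging \<open>u\<close> and \<open>v\<close>
  visible: only the first factor changes sign.\<close>

definition vandermonde5 :: "complex \<Rightarrow> complex \<Rightarrow> complex \<Rightarrow> complex \<Rightarrow> complex \<Rightarrow> complex" where
  "vandermonde5 u v x y z =
     (u - v) * ((u - x) * (v - x)) * ((u - y) * (v - y)) * ((u - z) * (v - z)) *
     ((x - y) * (x - z) * (y - z))"

lemma vandermonde5_swap: "vandermonde5 v u x y z = - vandermonde5 u v x y z"
proof -
  have "v - u = - (u - v)" by simp
  then show ?thesis unfolding vandermonde5_def by (simp only: mult.commute minus_mult_left[symmetric] mult_minus_right)
qed

lemma vandermonde5_nonzero: "distinct [u, v, x, y, z] \<Longrightarrow> vandermonde5 u v x y z \<noteq> 0"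
  by (auto simp: vandermonde5_def)

text \<open>The square of the Vandermonde product is the discriminant of \<open>f - w\<close>, which is also a product of
  values of \<open>f - w\<close> at the critical points; it is a square as soon as all defects equal 2.\<close>

lemma discriminant_square:
  assumes deg: "degree f = 5"
    and defect: "\<And>v. v \<in> critical_values f \<Longrightarrow> defect (critical_local_degrees f v) = 2"
  shows "\<exists>\<kappa>. \<forall>w u v x y z. w \<notin> critical_values f \<and> fibre f w = {u, v, x, y, z} \<and> distinct [u, v, x, y, z] \<longrightarrow>
     (vandermonde5 u v x y z)\<^sup>2 = \<kappa> * (\<Prod>t\<in>critical_values f. t - w)\<^sup>2"
proof -
  have deg0: "0 < degree f" using deg by simp
  define a where "a = lead_coeff f"
  have a: "a \<noteq> 0" using deg0 by (auto simp: a_def)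
  let ?C = "critical_points f"
  define e where "e = (\<lambda>t. local_degree f t - 1)"
  \<comment> \<open>Found by evaluating the product of \<open>pderiv f\<close> over the fibre in two
    ways; it does not involve \<open>w\<close>.\<close>
  define \<kappa> where "\<kappa> = 5 ^ 5 * (\<Prod>t\<in>?C. (- 1 / a) ^ e t)"
  have "(vandermonde5 u v x y z)\<^sup>2 = \<kappa> * (\<Prod>t\<in>critical_values f. t - w)\<^sup>2"
    if w: "w \<notin> critical_values f" and X: "fibre f w = {u, v, x, y, z}" and d: "distinct [u, v, x, y, z]" for w u v x y z
  proof -
    have f: "poly f s = w + a * ((s - u) * (s - v) * (s - x) * (s - y) * (s - z))" for s
    proof -
      have "(\<Prod>t\<in>fibre f w. (s - t) ^ local_degree f t) = (\<Prod>t\<in>fibre f w. s - t)"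
        using local_degree_noncritical_value[OF deg0 w] by simp
      also have "\<dots> = (s - u) * (s - v) * (s - x) * (s - y) * (s - z)"
        unfolding X using d by (simp add: mult.assoc)
      finally show ?thesis using poly_eq_fibre_product[OF deg0, of s w] by (simp add: a_def)
    qed
    let ?F = "\<lambda>s. w + a * ((s - u) * (s - v) * (s - x) * (s - y) * (s - z))"
    have "poly f = ?F" using f by (rule ext)
    then have D: "(?F has_field_derivative poly (pderiv f) s) (at s)" for s
      using poly_DERIV[of f s] by simp
    have "poly (pderiv f) u = a * ((u - v) * (u - x) * (u - y) * (u - z))"
      "poly (pderiv f) v = a * ((v - u) * (v - x) * (v - y) * (v - z))"
      "poly (pderiv f) x = a * ((x - u) * (x - v) * (x - y) * (x - z))"
      "poly (pderiv f) y = a * ((y - u) * (y - v) * (y - x) * (y - z))"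
      "poly (pderiv f) z = a * ((z - u) * (z - v) * (z - x) * (z - y))"
      by (rule DERIV_unique[OF D], (auto intro!: derivative_eq_intros)[1])+
    note * = this
    have "poly (pderiv f) u * poly (pderiv f) v * poly (pderiv f) x * poly (pderiv f) y * poly (pderiv f) z
        = a ^ 5 * ((u - v) * (v - u) * ((u - x) * (x - u)) * ((v - x) * (x - v)) * ((u - y) * (y - u)) *
           ((v - y) * (y - v)) * ((u - z) * (z - u)) * ((v - z) * (z - v)) * ((x - y) * (y - x)) *
           ((x - z) * (z - x)) * ((y - z) * (z - y)))"
    proof -
      have e: "(a * r) * (a * s) * (a * t) * (a * q) * (a * k) = a ^ 5 * (r * s * t * q * k)" for r s t q k
        by algebra
      show ?thesis unfolding * e by (simp only: mult_ac)
    qed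
    \<comment> \<open>Each of the ten pairs contributes a sign, and ten signs cancel.\<close>
    also have "\<dots> = a ^ 5 * (vandermonde5 u v x y z)\<^sup>2"
    proof -
      have "(r - s) * (s - r) = - ((r - s)\<^sup>2)" for r s :: complex
        by (simp add: power2_eq_square algebra_simps)
      then show ?thesis unfolding vandermonde5_def by (simp add: power_mult_distrib mult_ac)
    qed
    finally have 1: "(\<Prod>s\<in>fibre f w. poly (pderiv f) s) = a ^ 5 * (vandermonde5 u v x y z)\<^sup>2"
      unfolding X using d by (simp add: mult.assoc)
    have "(\<Prod>s\<in>fibre f w. poly (pderiv f) s) =
        (\<Prod>s\<in>fibre f w. 5 * a * (\<Prod>t\<in>?C. (s - t) ^ e t))"
      using poly_pderiv_eq_product[OF deg0] by (simp add: deg a_def e_def)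
    also have "\<dots> = (5 * a) ^ 5 * (\<Prod>s\<in>fibre f w. \<Prod>t\<in>?C. (s - t) ^ e t)"
      using card_fibre[OF deg0 w] deg by (simp add: prod.distrib)
    also have "(\<Prod>s\<in>fibre f w. \<Prod>t\<in>?C. (s - t) ^ e t) = (\<Prod>t\<in>?C. (\<Prod>s\<in>fibre f w. s - t) ^ e t)"
      by (subst prod.swap) (simp add: prod_power_distrib)
    also have "\<dots> = (\<Prod>t\<in>?C. (- 1 / a * (poly f t - w)) ^ e t)"
    proof (intro prod.cong refl arg_cong2[where f = "(^)"])
      fix t
      have "(\<Prod>s\<in>fibre f w. s - t) = - ((t - u) * (t - v) * (t - x) * (t - y) * (t - z))"
      proof -
        have "(\<Prod>s\<in>fibre f w. s - t) = (u - t) * (v - t) * (x - t) * (y - t) * (z - t)"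
          unfolding X using d by (simp add: mult.assoc)
        also have "\<dots> = (- (t - u)) * (- (t - v)) * (- (t - x)) * (- (t - y)) * (- (t - z))" by simp
        finally show ?thesis by (simp only: minus_mult_left[symmetric] mult_minus_right minus_minus)
      qed
      then show "(\<Prod>s\<in>fibre f w. s - t) = - 1 / a * (poly f t - w)" using a by (simp add: f)
    qed
    also have "\<dots> = (\<Prod>t\<in>?C. (- 1 / a) ^ e t) * (\<Prod>t\<in>?C. (poly f t - w) ^ e t)"
      by (simp only: power_mult_distrib prod.distrib)
    also have "(\<Prod>t\<in>?C. (poly f t - w) ^ e t) =
        (\<Prod>v\<in>critical_values f. \<Prod>t\<in>{t \<in> ?C. poly f t = v}. (poly f t - w) ^ e t)"
      by (rule prod.group[symmetric, OF finite_critical_points[OF deg0] finite_critical_values[OF deg0]])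
        (simp add: critical_values_def)
    \<comment> \<open>The exponents over one critical value add up to its defect, which is 2 by
      hypothesis.\<close>
    also have "\<dots> = (\<Prod>v\<in>critical_values f. (v - w) ^ 2)"
    proof (rule prod.cong[OF refl])
      fix r assume r: "r \<in> critical_values f"
      have S: "{t \<in> ?C. poly f t = r} = ?C \<inter> fibre f r" by (auto simp: mem_fibre)
      have "(\<Prod>t\<in>{t \<in> ?C. poly f t = r}. (poly f t - w) ^ e t) =
          (r - w) ^ (\<Sum>t\<in>{t \<in> ?C. poly f t = r}. e t)"
        by (simp add: power_sum)
      also have "(\<Sum>t\<in>{t \<in> ?C. poly f t = r}. e t) = defect (critical_local_degrees f r)"
        unfolding S by (simp add: defect_def critical_local_degrees_def sum_unfold_sum_mset e_def
            image_mset.compositionality comp_def)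
      finally show "(\<Prod>t\<in>{t \<in> ?C. poly f t = r}. (poly f t - w) ^ e t) = (r - w) ^ 2"
        using defect[OF r] by simp
    qed
    also have "\<dots> = (\<Prod>v\<in>critical_values f. v - w) ^ 2" by (rule prod_power_distrib[symmetric])
    finally have "a ^ 5 * (vandermonde5 u v x y z)\<^sup>2 =
        a ^ 5 * (\<kappa> * (\<Prod>v\<in>critical_values f. v - w)\<^sup>2)"
      unfolding 1 \<kappa>_def by (simp add: power_mult_distrib mult_ac)
    then show ?thesis using a by simp
  qed
  then show ?thesis by blast
qed

text \<open>Along the lifts the Vandermonde product \<open>D\<close> is \<open>S\<close> or
  \<open>- S\<close>, where \<open>S\<close> depends on the loop alone; as \<open>D\<close> never
  vanishes, the sign is constant. \<open>S\<close> returns to its initial value, so \<open>D\<close>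
  does too, whereas a transposition would negate it.\<close>

lemma transposition_notin_monodromy:
  assumes deg: "degree f = 5" and p: "p \<notin> critical_values f"
    and defect: "\<And>v. v \<in> critical_values f \<Longrightarrow> defect (critical_local_degrees f v) = 2"
    and uv: "u \<in> fibre f p" "v \<in> fibre f p" "u \<noteq> v"
  shows "transposition u v \<notin> fibre_monodromy f p"
proof
  assume \<tau>: "transposition u v \<in> fibre_monodromy f p"
  have deg0: "0 < degree f" using deg by simp
  have "card (fibre f p - {u, v}) = 3"
    using card_fibre[OF deg0 p] deg uv by (simp add: card_Diff_subset)
  then obtain x y z where xyz: "fibre f p - {u, v} = {x, y, z}" "distinct [x, y, z]"
    by (auto simp: card_3_iff)
  then have X: "fibre f p = {u, v, x, y, z}" and d: "distinct [u, v, x, y, z]" using uv by auto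
  obtain \<kappa> where \<kappa>: "\<And>w u v x y z. w \<notin> critical_values f \<Longrightarrow> fibre f w = {u, v, x, y, z} \<Longrightarrow>
     distinct [u, v, x, y, z] \<Longrightarrow> (vandermonde5 u v x y z)\<^sup>2 = \<kappa> * (\<Prod>t\<in>critical_values f. t - w)\<^sup>2"
    using discriminant_square[OF deg defect] by metis
  obtain \<gamma> C where \<gamma>: "loop_avoiding_critical_values f p \<gamma>"
    and C: "\<And>x. x \<in> fibre f p \<Longrightarrow> continuous_on {0..1} (C x) \<and> C x 0 = x \<and> C x 1 = transposition u v x"
      "\<And>t. t \<in> {0..1} \<Longrightarrow> bij_betw (\<lambda>x. C x t) (fibre f p) (fibre f (\<gamma> t))"
    using fibre_monodromy_lifts[OF deg0 \<tau>] by metis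
  have c\<gamma>: "continuous_on {0..1} \<gamma>" and \<gamma>p: "\<gamma> 0 = p" "\<gamma> 1 = p"
    using \<gamma> by (auto simp: loop_avoiding_critical_values_def path_def pathstart_def pathfinish_def)
  define D where "D = (\<lambda>t. vandermonde5 (C u t) (C v t) (C x t) (C y t) (C z t))"
  define S where "S = (\<lambda>t. csqrt \<kappa> * (\<Prod>s\<in>critical_values f. s - \<gamma> t))"
  have cD: "continuous_on {0..1} D"
    unfolding D_def vandermonde5_def using C(1) X by (intro continuous_intros) auto
  have cS: "continuous_on {0..1} S"
    unfolding S_def by (intro continuous_intros c\<gamma>)
  have DS: "(D t)\<^sup>2 = (S t)\<^sup>2" and D0: "D t \<noteq> 0" if t: "t \<in> {0..1}" for t
  proof -
    have inj: "inj_on (\<lambda>x. C x t) {u, v, x, y, z}" and im: "fibre f (\<gamma> t) = {C u t, C v t, C x t, C y t, C z t}"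
      using C(2)[OF t] unfolding bij_betw_def X by auto
    have dt: "distinct [C u t, C v t, C x t, C y t, C z t]"
      using inj d by (auto simp: inj_on_def)
    have "\<gamma> t \<notin> critical_values f"
      using \<gamma> t unfolding loop_avoiding_critical_values_def path_image_def by blast
    from \<kappa>[OF this im dt] show "(D t)\<^sup>2 = (S t)\<^sup>2" by (simp add: D_def S_def power_mult_distrib)
    show "D t \<noteq> 0" unfolding D_def by (rule vandermonde5_nonzero[OF dt])
  qed
  have iff: "D 1 - S 1 = 0 \<longleftrightarrow> D 0 - S 0 = 0"
  proof (rule product_zero_on_interval)
    show "continuous_on {0..1} (\<lambda>t. D t - S t)" "continuous_on {0..1} (\<lambda>t. D t + S t)"
      by (intro continuous_intros cD cS)+
    fix t :: real assume t: "t \<in> {0..1}"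
    show "(D t - S t) * (D t + S t) = 0"
      using DS[OF t] by (simp add: algebra_simps power2_eq_square)
    show "D t - S t \<noteq> 0 \<or> D t + S t \<noteq> 0"
    proof (rule ccontr)
      assume "\<not> ?thesis"
      then have "2 * D t = (D t - S t) + (D t + S t)" "D t - S t = 0" "D t + S t = 0" by auto
      then show False using D0[OF t] by simp
    qed
  qed
  have S1: "S 1 = S 0" by (simp add: S_def \<gamma>p)
  have D1: "D 1 = - D 0"
  proof -
    have "C r 0 = r" "C r 1 = transposition u v r" if "r \<in> {u, v, x, y, z}" for r
      using C(1) that X by auto
    moreover have "transposition u v r = r" if "r \<in> {x, y, z}" for r
      using that d by (auto simp: Transposition.transpose_def)
    ultimately have "D 1 = vandermonde5 v u x y z" "D 0 = vandermonde5 u v x y z"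
      unfolding D_def by simp_all
    then show ?thesis by (simp only: vandermonde5_swap[of v u])
  qed
  have "D 0 = S 0 \<or> D 0 = - S 0" using DS[of 0] by (simp add: power2_eq_iff)
  then show False
  proof
    assume "D 0 = S 0"
    then have "D 0 = - D 0" using iff S1 D1 by simp
    then show False using D0[of 0] by simp
  next
    assume "D 0 = - S 0"
    then have "D 0 = - D 0" using iff S1 D1 by simp
    then show False using D0[of 0] by simp
  qed
qed

lemma has_model_alternating_5:
  assumes deg: "degree f = 5" and p: "p \<notin> critical_values f"
    and P: "profiles f \<subseteq> {{#3#}, {#2, 2#}}" "{#3#} \<in> profiles f"
  shows "has_model f p {\<tau>. \<tau> permutes {1..5} \<and> evenperm \<tau>}"
proof -
  have deg0: "0 < degree f" using deg by simp
  interpret G: transitive_perm_group "fibre_monodromy f p" "fibre f p"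
    by (rule transitive_perm_group_fibre_monodromy[OF deg0 p])
  have defect: "defect (critical_local_degrees f v) = 2" if "v \<in> critical_values f" for v
  proof -
    have "critical_local_degrees f v \<in> profiles f" using that by (simp add: profiles_def)
    then show ?thesis using P(1) by (auto simp: defect_def)
  qed
  have "prime (5::nat)" by simp
  then have prime: "prime (card (fibre f p))" using card_fibre[OF deg0 p] deg by simp
  obtain u v w where uvw: "u \<in> fibre f p" "v \<in> fibre f p" "w \<in> fibre f p" "distinct [u, v, w]"
    "three_cycle u v w \<in> fibre_monodromy f p"
    using three_cycle_in_monodromy[OF deg0 p P(2)] by blast
  have even: "\<sigma> \<in> fibre_monodromy f p \<longleftrightarrow> \<sigma> permutes fibre f p \<and> evenperm \<sigma>" for \<sigma>
  proof (rule G.eq_even_permutations)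
    show "three_cycle a b c \<in> fibre_monodromy f p"
      if "a \<in> fibre f p" "b \<in> fibre f p" "c \<in> fibre f p" "distinct [a, b, c]" for a b c
      using G.all_three_cycles[OF prime uvw(5,4,1,2,3)] that by blast
    show "transposition u v \<notin> fibre_monodromy f p"
      using uvw by (intro transposition_notin_monodromy[OF deg p defect]) auto
  qed (use uvw in auto)
  obtain b where b: "bij_betw b {1..degree f} (fibre f p)" using numbering_exists[OF deg0 p] .
  have inj: "inj_on b {1..degree f}" using b by (simp add: bij_betw_def)
  have "\<tau> \<in> monodromy_group f p b \<longleftrightarrow> \<tau> permutes {1..degree f} \<and> evenperm \<tau>" for \<tau>
    unfolding mem_monodromy_group[OF b deg0] even
    using map_permutation_permutes[OF b] evenperm_map_permutation[OF inj _ finite_atLeastAtMost] by blast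
  then have "monodromy_group f p b = {\<tau>. \<tau> permutes {1..degree f} \<and> evenperm \<tau>}" by blast
  then show ?thesis using b deg by (auto simp: has_model_def)
qed

section \<open>The dihedral group of order 10\<close>

text \<open>The hypothesis is the rescaled differential equation of a Chebyshev polynomial.
  Coefficients 9 down to 5 determine the lower coefficients in turn; the result is \<open>h5\<close>
  times the Dickson polynomial \<open>y^5 - 5 \<kappa> y^3 + 5 \<kappa>^2 y\<close>.\<close>

lemma chebyshev_coefficients:
  fixes h0 h1 h2 h3 h4 h5 \<kappa> W :: complex
  assumes eq: "smult 25 ([:h0, h1, h2, h3, h4, h5:]\<^sup>2 - [:W:]) =
      [:-4 * \<kappa>, 0, 1:] * (pderiv [:h0, h1, h2, h3, h4, h5:])\<^sup>2" and h5: "h5 \<noteq> 0"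
  shows "h4 = 0" "h3 = - 5 * \<kappa> * h5" "h2 = 0" "h1 = 5 * \<kappa>\<^sup>2 * h5" "h0 = 0"
proof -
  have c: "coeff (smult 25 ([:h0, h1, h2, h3, h4, h5:]\<^sup>2 - [:W:])) n =
      coeff ([:-4 * \<kappa>, 0, 1:] * (pderiv [:h0, h1, h2, h3, h4, h5:])\<^sup>2) n" for n
    using eq by simp
  note s = pderiv_pCons power2_eq_square algebra_simps numeral_eq_Suc coeff_pCons
  have 9: "10 * (h4 * h5) = 0" using c[of 9] by (simp add: s)
  then show h4: "h4 = 0" using h5 by simp
  have 8: "h5 * (20 * h3 + 100 * \<kappa> * h5) = 0" using c[of 8] by (simp add: s h4)
  have "20 * (h3 + 5 * \<kappa> * h5) = 20 * h3 + 100 * \<kappa> * h5" by (simp add: algebra_simps)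
  also have "\<dots> = 0" using 8 h5 by simp
  finally have "h3 + 5 * \<kappa> * h5 = 0" by (metis mult_eq_0_iff zero_neq_numeral)
  then show h3: "h3 = - 5 * \<kappa> * h5" by (simp add: eq_neg_iff_add_eq_0)
  have 7: "30 * (h5 * h2) = 0" using c[of 7] by (simp add: s h4)
  then show h2: "h2 = 0" using h5 by simp
  have 6: "h5 * (40 * h1 - 200 * \<kappa> * \<kappa> * h5) = 0" using c[of 6] by (simp add: s h4 h3 h2)
  then show "h1 = 5 * \<kappa>\<^sup>2 * h5" using h5 by (simp add: power2_eq_square)
  have 5: "50 * (h5 * h0) = 0" using c[of 5] by (simp add: s h4 h3 h2)
  then show "h0 = 0" using h5 by simp
qed

text \<open>A 2-regular graph is a union of cycles; on five vertices a triangle would leave two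
  vertices, too few for a second cycle.\<close>

lemma five_cycle_of_regular:
  assumes X: "finite X" "card X = 5"
    and sym: "\<And>x y. E x y \<Longrightarrow> E y x" and irrefl: "\<And>x. \<not> E x x"
    and two: "\<And>x. x \<in> X \<Longrightarrow> card {y \<in> X. E x y} = 2" and x1: "x1 \<in> X"
  obtains x2 x3 x4 x5 where "distinct [x1, x2, x3, x4, x5]" "X = {x1, x2, x3, x4, x5}"
    "{y \<in> X. E x1 y} = {x2, x5}" "{y \<in> X. E x2 y} = {x1, x3}" "{y \<in> X. E x3 y} = {x2, x4}"
    "{y \<in> X. E x4 y} = {x3, x5}" "{y \<in> X. E x5 y} = {x1, x4}"
proof -
  define N where "N = (\<lambda>x. {y \<in> X. E x y})"
  have N_sym: "y \<in> N x \<longleftrightarrow> x \<in> N y" if "x \<in> X" "y \<in> X" for x y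
    using that sym by (auto simp: N_def)
  have N_irrefl: "x \<notin> N x" for x using irrefl by (simp add: N_def)
  have N_X: "N x \<subseteq> X" for x by (auto simp: N_def)
  have N2: "card (N x) = 2" if "x \<in> X" for x using two[OF that] by (simp add: N_def)
  have N_eq: "N x = {u, w}" if "x \<in> X" "u \<in> N x" "w \<in> N x" "u \<noteq> w" for x u w
    using N2[OF that(1)] that(2-4) by (auto simp: card_2_iff)
  have other: "\<exists>w. N x = {u, w} \<and> w \<noteq> u" if "x \<in> X" "u \<in> N x" for x u
    using N2[OF that(1)] that(2) by (auto simp: card_2_iff)
  obtain x2 x5 where x25: "N x1 = {x2, x5}" "x2 \<noteq> x5" using N2[OF x1] by (auto simp: card_2_iff)
  have in2: "x2 \<in> X" "x5 \<in> X" using N_X[of x1] x25 by auto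
  have ne: "x2 \<noteq> x1" "x5 \<noteq> x1" using N_irrefl[of x1] x25 by auto
  have "x1 \<in> N x2" "x1 \<in> N x5" using N_sym[OF x1] in2 x25 by auto
  then obtain x3 where x3: "N x2 = {x1, x3}" "x3 \<noteq> x1" using other in2 by blast
  have in3: "x3 \<in> X" using N_X[of x2] x3 by auto
  have x32: "x3 \<noteq> x2" using N_irrefl[of x2] x3 by auto
  have x35: "x3 \<noteq> x5"
  proof
    assume 35: "x3 = x5"
    have "x2 \<in> N x5" using N_sym[OF in2(1) in2(2)] x3 35 by auto
    then have N5: "N x5 = {x1, x2}" using N_eq[OF in2(2)] \<open>x1 \<in> N x5\<close> ne by auto
    have "card (X - {x1, x2, x5}) = 2" using X x1 in2 x25 ne by (simp add: card_Diff_subset)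
    then obtain u w where uw: "X - {x1, x2, x5} = {u, w}" "u \<noteq> w" by (auto simp: card_2_iff)
    then have u: "u \<in> X" "u \<notin> {x1, x2, x5}" by auto
    have "x1 \<notin> N u" "x2 \<notin> N u" "x5 \<notin> N u"
      using N_sym[OF u(1)] x1 in2 u(2) x25(1) x3(1) N5 35 by auto
    then have "N u \<subseteq> {w}" using N_X[of u] N_irrefl[of u] uw by auto
    then have "card (N u) \<le> 1" using card_mono[of "{w}" "N u"] by simp
    then show False using N2[OF u(1)] by simp
  qed
  have d4: "card {x1, x2, x3, x5} = 4" using x25 x3 x32 x35 ne by auto
  have "card (X - {x1, x2, x3, x5}) = 1"
    using X x1 in2 in3 d4 by (subst card_Diff_subset) auto
  then obtain x4 where x4: "X - {x1, x2, x3, x5} = {x4}" by (rule card_1_singletonE)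
  have Xeq: "X = {x1, x2, x3, x4, x5}" using x4 x1 in2 in3 by auto
  have d: "distinct [x1, x2, x3, x4, x5]" using x4 x25 x3 x32 x35 ne by auto
  have in4: "x4 \<in> X" using Xeq by simp
  have "x1 \<notin> N x4" "x2 \<notin> N x4"
    using N_sym[OF in4] x1 in2 x25(1) x3(1) d by auto
  then have "N x4 \<subseteq> {x3, x5}" using N_X[of x4] N_irrefl[of x4] Xeq by auto
  then have N4: "N x4 = {x3, x5}" using N2[OF in4] x35 by (intro card_subset_eq) auto
  have N3: "N x3 = {x2, x4}"
    using N_eq[OF in3, of x2 x4] N_sym[OF in3] in2 in4 x3 N4 d by auto
  have N5: "N x5 = {x1, x4}"
    using N_eq[OF in2(2), of x1 x4] N_sym[OF in2(2)] x1 in4 x25 N4 d by auto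
  show ?thesis using that[OF d Xeq] x25(1) x3(1) N3 N4 N5 by (simp add: N_def)
qed

text \<open>Fixing a vertex leaves its neighbours fixed or exchanged, and this propagates round the
  cycle; the second case is the reflection through \<open>x1\<close>.\<close>

lemma five_cycle_automorphism:
  assumes d: "distinct [x1, x2, x3, x4, x5]" and X: "X = {x1, x2, x3, x4, x5}"
    and N: "{y \<in> X. E x1 y} = {x2, x5}" "{y \<in> X. E x2 y} = {x1, x3}" "{y \<in> X. E x3 y} = {x2, x4}"
      "{y \<in> X. E x4 y} = {x3, x5}" "{y \<in> X. E x5 y} = {x1, x4}"
    and \<beta>: "\<beta> permutes X" "\<beta> x1 = x1"
    and E: "\<And>x y. x \<in> X \<Longrightarrow> y \<in> X \<Longrightarrow> E x y \<longleftrightarrow> E (\<beta> x) (\<beta> y)"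
  shows "\<beta> = id \<or> \<beta> = transposition x2 x5 \<circ> transposition x3 x4"
proof -
  have inX: "x1 \<in> X" "x2 \<in> X" "x3 \<in> X" "x4 \<in> X" "x5 \<in> X" using X by auto
  have nb: "\<beta> y \<in> {z \<in> X. E (\<beta> x) z}" if "x \<in> X" "y \<in> {z \<in> X. E x z}" for x y
    using that E[of x y] permutes_in_image[OF \<beta>(1)] by auto
  have inj: "\<beta> x = \<beta> y \<longleftrightarrow> x = y" for x y using inj_eq[OF permutes_inj[OF \<beta>(1)]] .
  have ne1: "\<beta> x2 \<noteq> x1" "\<beta> x3 \<noteq> x1" "\<beta> x4 \<noteq> x1" "\<beta> x5 \<noteq> x1"
    using inj[of _ x1] \<beta>(2) d by auto
  have "\<beta> x2 \<in> {x2, x5}" "\<beta> x5 \<in> {x2, x5}"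
    using nb[OF inX(1), of x2] nb[OF inX(1), of x5] \<beta>(2) N(1) by auto
  then consider "\<beta> x2 = x2" "\<beta> x5 = x5" | "\<beta> x2 = x5" "\<beta> x5 = x2"
    using inj[of x2 x5] d by auto
  then show ?thesis
  proof cases
    case 1
    have "\<beta> x3 = x3" using nb[OF inX(2), of x3] 1 N(2) ne1 by auto
    moreover have "\<beta> x4 = x4" using nb[OF inX(5), of x4] 1 N(5) ne1 by auto
    ultimately have "\<beta> x = x" for x
      using 1 \<beta>(2) X permutes_not_in[OF \<beta>(1), of x] by (cases "x \<in> X") auto
    then show ?thesis by (auto simp: fun_eq_iff)
  next
    case 2
    have "\<beta> x3 = x4" using nb[OF inX(2), of x3] 2 N(2,5) ne1 by auto
    moreover have "\<beta> x4 = x3" using nb[OF inX(5), of x4] 2 N(2,5) ne1 by auto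
    ultimately have "\<beta> x = (transposition x2 x5 \<circ> transposition x3 x4) x" for x
      using 2 \<beta>(2) X d permutes_not_in[OF \<beta>(1), of x]
      by (cases "x \<in> X") (auto simp: Transposition.transpose_def)
    then show ?thesis by blast
  qed
qed

text \<open>Over each of the two critical values lie one simple and two double roots. Hence
  \<open>(f - v1) (f - v2)\<close> and the square of \<open>pderiv f\<close> contain the same four
  critical points, and up to a constant their quotient is \<open>(x - e1) (x - e2)\<close>: the
  Chebyshev differential equation.\<close>

lemma quintic_chebyshev_form:
  assumes deg: "degree f = 5" and P: "profiles f \<subseteq> {{#2, 2#}}" and V: "card (critical_values f) = 2"
  obtains a c \<kappa> C where "a \<noteq> 0" "\<kappa> \<noteq> 0"
    "\<And>x. poly f x = a * ((x - c) ^ 5 - 5 * \<kappa> * (x - c) ^ 3 + 5 * \<kappa>\<^sup>2 * (x - c)) + C"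
proof -
  have deg0: "0 < degree f" using deg by simp
  let ?V = "critical_values f" and ?K = "critical_points f"
  define a where "a = lead_coeff f"
  have a: "a \<noteq> 0" using deg0 by (auto simp: a_def)
  obtain v1 v2 where v: "?V = {v1, v2}" "v1 \<noteq> v2" using V by (auto simp: card_2_iff)
  have over: "\<exists>e \<alpha> \<beta>. ?K \<inter> fibre f w = {\<alpha>, \<beta>} \<and> \<alpha> \<noteq> \<beta> \<and> local_degree f \<alpha> = 2 \<and> local_degree f \<beta> = 2 \<and>
      poly f e = w \<and> (\<forall>x. poly f x - w = a * ((x - e) * (x - \<alpha>)\<^sup>2 * (x - \<beta>)\<^sup>2))"
    if w: "w \<in> ?V" for w
  proof -
    have M: "critical_local_degrees f w = {#2, 2#}" using P w by (auto simp: profiles_def)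
    obtain \<alpha> \<beta> where ab: "?K \<inter> fibre f w = {\<alpha>, \<beta>}" "\<alpha> \<noteq> \<beta>" "local_degree f \<alpha> = 2" "local_degree f \<beta> = 2"
      by (rule two_critical_points[OF deg0 M]) (assumption | rule that)+
    have "card (fibre f w - ?K) = 1" using sum_critical_local_degrees[OF deg0, of w] M deg by simp
    then obtain e where e: "fibre f w - ?K = {e}" by (rule card_1_singletonE)
    then have e': "e \<in> fibre f w" "e \<notin> ?K" by auto
    have me: "local_degree f e = 1" by (rule noncritical_local_degree[OF deg0 e'(1)]) (use e' in blast)
    have F: "fibre f w = {e, \<alpha>, \<beta>}" using e ab(1) by blast
    have d: "e \<noteq> \<alpha>" "e \<noteq> \<beta>" using e'(2) ab(1) by auto
    have "poly f x - w = a * ((x - e) * (x - \<alpha>)\<^sup>2 * (x - \<beta>)\<^sup>2)" for x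
      using poly_eq_fibre_product[OF deg0, of x w] ab d me unfolding F by (simp add: a_def mult.assoc)
    then show ?thesis using ab e'(1) by (auto simp: mem_fibre)
  qed
  obtain e1 \<alpha>1 \<beta>1 where 1: "?K \<inter> fibre f v1 = {\<alpha>1, \<beta>1}" "\<alpha>1 \<noteq> \<beta>1" "local_degree f \<alpha>1 = 2"
      "local_degree f \<beta>1 = 2" "poly f e1 = v1"
      "\<And>x. poly f x - v1 = a * ((x - e1) * (x - \<alpha>1)\<^sup>2 * (x - \<beta>1)\<^sup>2)"
    using over[of v1] v by blast
  obtain e2 \<alpha>2 \<beta>2 where 2: "?K \<inter> fibre f v2 = {\<alpha>2, \<beta>2}" "\<alpha>2 \<noteq> \<beta>2" "local_degree f \<alpha>2 = 2"
      "local_degree f \<beta>2 = 2" "poly f e2 = v2"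
      "\<And>x. poly f x - v2 = a * ((x - e2) * (x - \<alpha>2)\<^sup>2 * (x - \<beta>2)\<^sup>2)"
    using over[of v2] v by blast
  have "?K = (?K \<inter> fibre f v1) \<union> (?K \<inter> fibre f v2)"
    using v(1) unfolding critical_values_def by (auto simp: mem_fibre)
  then have K: "?K = {\<alpha>1, \<beta>1, \<alpha>2, \<beta>2}" using 1(1) 2(1) by auto
  have "poly f \<alpha>1 = v1" "poly f \<beta>1 = v1" "poly f \<alpha>2 = v2" "poly f \<beta>2 = v2"
    using 1(1) 2(1) by (auto simp: mem_fibre)
  then have d: "distinct [\<alpha>1, \<beta>1, \<alpha>2, \<beta>2]" using v(2) 1(2) 2(2) by auto
  have f': "poly (pderiv f) x = 5 * a * ((x - \<alpha>1) * (x - \<beta>1) * (x - \<alpha>2) * (x - \<beta>2))" for x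
    using poly_pderiv_eq_product[OF deg0, of x] d 1(3,4) 2(3,4) unfolding K
    by (simp add: deg a_def mult.assoc)
  have key: "25 * ((poly f x - v1) * (poly f x - v2)) = (x - e1) * (x - e2) * (poly (pderiv f) x)\<^sup>2" for x
    unfolding 1(6) 2(6) f' by algebra
  \<comment> \<open>Centre and scale that turn \<open>(x - e1) (x - e2)\<close> into
    \<open>y^2 - 4 \<kappa>\<close>; likewise \<open>C\<close> below is the mean of the critical
    values.\<close>
  define c where "c = (e1 + e2) / 2"
  define \<kappa> where "\<kappa> = ((e1 - e2) / 4)\<^sup>2"
  have "e1 \<noteq> e2" using 1(5) 2(5) v(2) by auto
  then have \<kappa>: "\<kappa> \<noteq> 0" by (simp add: \<kappa>_def)
  define C where "C = (v1 + v2) / 2"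
  define h where "h = pcompose f [:c, 1:] - [:C:]"
  have ph: "poly h y = poly f (c + y) - C" for y by (simp add: h_def poly_pcompose)
  have "pderiv h = pcompose (pderiv f) [:c, 1:]"
    by (simp add: h_def pderiv_diff pderiv_pcompose pderiv_pCons)
  then have ph': "poly (pderiv h) y = poly (pderiv f) (c + y)" for y by (simp add: poly_pcompose)
  have "poly (smult 25 (h\<^sup>2 - [:((v1 - v2) / 2)\<^sup>2:])) y = poly ([:-4 * \<kappa>, 0, 1:] * (pderiv h)\<^sup>2) y" for y
  proof -
    have "(poly h y)\<^sup>2 - ((v1 - v2) / 2)\<^sup>2 = (poly f (c + y) - v1) * (poly f (c + y) - v2)"
      unfolding ph C_def by (simp add: field_simps power2_eq_square)
    moreover have "y\<^sup>2 - 4 * \<kappa> = (c + y - e1) * (c + y - e2)"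
      unfolding \<kappa>_def c_def by (simp add: field_simps power2_eq_square)
    moreover have "poly (smult 25 (h\<^sup>2 - [:((v1 - v2) / 2)\<^sup>2:])) y = 25 * ((poly h y)\<^sup>2 - ((v1 - v2) / 2)\<^sup>2)"
      by (simp add: poly_power)
    moreover have "poly ([:-4 * \<kappa>, 0, 1:] * (pderiv h)\<^sup>2) y = (y\<^sup>2 - 4 * \<kappa>) * (poly (pderiv f) (c + y))\<^sup>2"
      by (simp add: ph' poly_power power2_eq_square algebra_simps)
    ultimately show ?thesis using key[of "c + y"] by simp
  qed
  then have eq: "smult 25 (h\<^sup>2 - [:((v1 - v2) / 2)\<^sup>2:]) = [:-4 * \<kappa>, 0, 1:] * (pderiv h)\<^sup>2"
    by (simp only: poly_eq_poly_eq_iff[symmetric] fun_eq_iff) simp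
  have degp: "degree (pcompose f [:c, 1:]) = 5" by (simp add: degree_pcompose deg)
  then have degh: "degree h = 5" unfolding h_def using degree_minus_const[of "pcompose f [:c, 1:]"] by simp
  have hl: "h = [:coeff h 0, coeff h 1, coeff h 2, coeff h 3, coeff h 4, coeff h 5:]"
  proof (rule poly_eqI)
    fix n
    show "coeff h n = coeff [:coeff h 0, coeff h 1, coeff h 2, coeff h 3, coeff h 4, coeff h 5:] n"
    proof (cases "n \<le> 5")
      case True
      then have "n = 0 \<or> n = 1 \<or> n = 2 \<or> n = 3 \<or> n = 4 \<or> n = 5" by auto
      then show ?thesis by (elim disjE) (simp_all add: numeral_eq_Suc One_nat_def)
    next
      case False
      then have "coeff h n = 0" using degh by (simp add: coeff_eq_0)
      moreover have "degree [:coeff h 0, coeff h 1, coeff h 2, coeff h 3, coeff h 4, coeff h 5:] \<le> 5"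
        by (simp add: degree_pCons_eq_if)
      ultimately show ?thesis using False by (simp add: coeff_eq_0)
    qed
  qed
  define h5 where "h5 = coeff h 5"
  have h5: "h5 \<noteq> 0" using degh leading_coeff_0_iff[of h] by (auto simp: h5_def)
  have hh: "coeff h 4 = 0" "coeff h 3 = - 5 * \<kappa> * h5" "coeff h 2 = 0" "coeff h 1 = 5 * \<kappa>\<^sup>2 * h5" "coeff h 0 = 0"
    using chebyshev_coefficients[of "coeff h 0" "coeff h 1" "coeff h 2" "coeff h 3" "coeff h 4" "coeff h 5"
        "((v1 - v2) / 2)\<^sup>2" \<kappa>] eq h5 unfolding hl[symmetric] h5_def by auto
  have "poly h y = h5 * (y ^ 5 - 5 * \<kappa> * y ^ 3 + 5 * \<kappa>\<^sup>2 * y)" for y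
  proof -
    have "poly h y = poly [:coeff h 0, coeff h 1, coeff h 2, coeff h 3, coeff h 4, coeff h 5:] y"
      using hl by (rule arg_cong)
    also have "\<dots> = h5 * (y ^ 5 - 5 * \<kappa> * y ^ 3 + 5 * \<kappa>\<^sup>2 * y)"
      unfolding hh h5_def[symmetric] poly_pCons poly_0 by algebra
    finally show ?thesis .
  qed
  then have "poly f x = h5 * ((x - c) ^ 5 - 5 * \<kappa> * (x - c) ^ 3 + 5 * \<kappa>\<^sup>2 * (x - c)) + C" for x
    using ph[of "x - c"] by (simp add: algebra_simps(1-3) eq_diff_eq)
  then show ?thesis using that h5 \<kappa> by blast
qed

text \<open>For \<open>X = u + \<kappa> / u\<close> the quintic is
  \<open>u^5 + (\<kappa> / u)^5\<close>, unchanged when \<open>u\<close> is multiplied by a fifth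
  root of unity \<open>z\<close>. The roots \<open>z\<close> and \<open>1 / z\<close> together give
  the factor with \<open>\<tau> = z + 1 / z\<close>, and these values are the roots of
  \<open>t^2 + t - 1\<close>.\<close>

lemma chebyshev_factorization:
  fixes X Y \<kappa> \<tau> \<tau>' :: complex
  assumes "\<tau> + \<tau>' = - 1" "\<tau> * \<tau>' = - 1"
  shows "(X ^ 5 - 5 * \<kappa> * X ^ 3 + 5 * \<kappa>\<^sup>2 * X) - (Y ^ 5 - 5 * \<kappa> * Y ^ 3 + 5 * \<kappa>\<^sup>2 * Y) =
    (X - Y) * ((X\<^sup>2 + Y\<^sup>2 - \<tau> * X * Y + (\<tau>\<^sup>2 - 4) * \<kappa>) * (X\<^sup>2 + Y\<^sup>2 - \<tau>' * X * Y + (\<tau>'\<^sup>2 - 4) * \<kappa>))"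
  using assms by algebra

text \<open>The difference of the factors forces \<open>X Y = - \<kappa>\<close>, and then
  \<open>X^2 + Y^2 = 3 \<kappa>\<close>. So \<open>X^2\<close> is a root of
  \<open>t^2 - 3 \<kappa> t + \<kappa>^2\<close>, which says that the derivative of the quintic
  vanishes at \<open>X\<close>.\<close>

lemma chebyshev_common_zero:
  fixes X Y \<kappa> \<tau> \<tau>' :: complex
  assumes "\<tau> + \<tau>' = - 1" "\<tau> * \<tau>' = - 1" "\<tau> \<noteq> \<tau>'"
    and z: "X\<^sup>2 + Y\<^sup>2 - \<tau> * X * Y + (\<tau>\<^sup>2 - 4) * \<kappa> = 0" "X\<^sup>2 + Y\<^sup>2 - \<tau>' * X * Y + (\<tau>'\<^sup>2 - 4) * \<kappa> = 0"
  shows "5 * X ^ 4 - 15 * \<kappa> * X\<^sup>2 + 5 * \<kappa>\<^sup>2 = 0"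
proof -
  have "(\<tau>' - \<tau>) * (X * Y + \<kappa>) = 0" using z assms(1) by algebra
  then have XY: "X * Y = - \<kappa>" using assms(3) by (simp add: eq_neg_iff_add_eq_0)
  have "\<tau>\<^sup>2 = 1 - \<tau>" using assms(1,2) by algebra
  then have "X\<^sup>2 + Y\<^sup>2 = 3 * \<kappa>" using z(1) XY by algebra
  then show ?thesis using XY by algebra
qed

text \<open>The numbers are \<open>2 cos (2 pi / 5)\<close> and
  \<open>2 cos (4 pi / 5)\<close>.\<close>

lemma golden_conjugates:
  obtains \<tau> \<tau>' :: complex where "\<tau> + \<tau>' = - 1" "\<tau> * \<tau>' = - 1" "\<tau> \<noteq> \<tau>'"
proof -
  define r where "r = csqrt 5"
  have r: "r * r = 5" using power2_csqrt[of 5] by (simp add: r_def power2_eq_square)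
  have "r \<noteq> 0" using r by auto
  show ?thesis
  proof (rule that[of "(- 1 + r) / 2" "(- 1 - r) / 2"])
    show "(- 1 + r) / 2 * ((- 1 - r) / 2) = - 1" using r by (simp add: field_simps)
    show "(- 1 + r) / 2 + (- 1 - r) / 2 = - 1" by (simp add: field_simps)
    show "(- 1 + r) / 2 \<noteq> (- 1 - r) / 2" using \<open>r \<noteq> 0\<close> by (simp add: eq_neg_iff_add_eq_0)
  qed
qed

definition pentagon :: "nat \<Rightarrow> nat \<Rightarrow> bool" where
  "pentagon i j \<longleftrightarrow> j = (if i = 5 then 1 else i + 1) \<or> i = (if j = 5 then 1 else j + 1)"

text \<open>Joining fibre points at which the factor with \<open>\<tau>\<close> vanishes gives an
  invariant graph, by counting a pentagon. Its automorphisms fixing a vertex are the identity and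
  one reflection; a small loop of type \<open>{#2, 2#}\<close> fixes one point and is that
  reflection.\<close>

lemma has_model_dihedral_5:
  assumes deg: "degree f = 5" and p: "p \<notin> critical_values f"
    and P: "profiles f \<subseteq> {{#2, 2#}}" and V: "card (critical_values f) = 2"
  shows "has_model f p (relation_group (degree f) pentagon)"
proof -
  let ?X = "fibre f p"
  have deg0: "0 < degree f" using deg by simp
  obtain a c \<kappa> C where a: "a \<noteq> 0"
    and f: "\<And>x. poly f x = a * ((x - c) ^ 5 - 5 * \<kappa> * (x - c) ^ 3 + 5 * \<kappa>\<^sup>2 * (x - c)) + C"
    by (rule quintic_chebyshev_form[OF deg P V]) (assumption | rule that)+
  have f': "poly (pderiv f) x = a * (5 * (x - c) ^ 4 - 15 * \<kappa> * (x - c)\<^sup>2 + 5 * \<kappa>\<^sup>2)" for x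
    by (rule poly_pderiv_eqI[OF f]) (auto intro!: derivative_eq_intros simp: algebra_simps)
  obtain \<tau> \<tau>' :: complex where \<tau>: "\<tau> + \<tau>' = - 1" "\<tau> * \<tau>' = - 1" "\<tau> \<noteq> \<tau>'"
    by (rule golden_conjugates)
  define Q where "Q = (\<lambda>\<tau> x y. (x - c)\<^sup>2 + (y - c)\<^sup>2 - \<tau> * (x - c) * (y - c) + (\<tau>\<^sup>2 - 4) * \<kappa>)"
  have contQ: "continuous_on UNIV (\<lambda>z. Q \<tau> (fst z) (snd z))" for \<tau>
    unfolding Q_def by (intro continuous_intros)
  have Q_sym: "Q \<tau> x y = Q \<tau> y x" for \<tau> x y by (simp add: Q_def algebra_simps)
  have Q: "Q \<tau> x y * Q \<tau>' x y = 0 \<and> (Q \<tau> x y \<noteq> 0 \<or> Q \<tau>' x y \<noteq> 0)"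
    if w: "w \<notin> critical_values f" and xy: "x \<in> fibre f w" "y \<in> fibre f w" "x \<noteq> y" for w x y
  proof
    have "0 = poly f x - poly f y" using xy by (simp add: mem_fibre)
    also have "\<dots> = a * (((x - c) ^ 5 - 5 * \<kappa> * (x - c) ^ 3 + 5 * \<kappa>\<^sup>2 * (x - c)) -
        ((y - c) ^ 5 - 5 * \<kappa> * (y - c) ^ 3 + 5 * \<kappa>\<^sup>2 * (y - c)))"
      unfolding f by (simp only: right_diff_distrib add_diff_cancel_right)
    also have "\<dots> = a * (((x - c) - (y - c)) * (Q \<tau> x y * Q \<tau>' x y))"
      unfolding chebyshev_factorization[OF \<tau>(1,2)] Q_def ..
    finally show "Q \<tau> x y * Q \<tau>' x y = 0" using a xy(3) by simp
    show "Q \<tau> x y \<noteq> 0 \<or> Q \<tau>' x y \<noteq> 0"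
    proof (rule ccontr)
      assume "\<not> ?thesis"
      then have z: "Q \<tau> x y = 0" "Q \<tau>' x y = 0" by auto
      have "poly (pderiv f) x = 0"
        unfolding f' using chebyshev_common_zero[OF \<tau> z[unfolded Q_def]] by simp
      then show False using w xy(1) by (auto simp: critical_values_def critical_points_def mem_fibre)
    qed
  qed
  have card_X: "card ?X = 5" and fin_X: "finite ?X" using card_fibre[OF deg0 p] finite_fibre[OF deg0] deg by auto
  \<comment> \<open>For fixed \<open>x\<close> the condition is a monic quadratic equation in
    \<open>y - c\<close>.\<close>
  have le2: "card {y \<in> ?X. x \<noteq> y \<and> Q \<tau> x y = 0} \<le> 2" for \<tau> x
  proof -
    let ?q = "[:(x - c)\<^sup>2 + (\<tau>\<^sup>2 - 4) * \<kappa>, - \<tau> * (x - c), 1:]"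
    have "finite {Y. poly ?q Y = 0}" "card {Y. poly ?q Y = 0} \<le> 2"
      using poly_roots_finite[of ?q] card_poly_roots_bound[of ?q] by auto
    moreover have "(\<lambda>y. y - c) ` {y \<in> ?X. x \<noteq> y \<and> Q \<tau> x y = 0} \<subseteq> {Y. poly ?q Y = 0}"
      by (auto simp: Q_def algebra_simps power2_eq_square)
    moreover have "inj_on (\<lambda>y. y - c) {y \<in> ?X. x \<noteq> y \<and> Q \<tau> x y = 0}" by (simp add: inj_on_def)
    ultimately show ?thesis by (metis (no_types, lifting) card_image card_mono order_trans)
  qed
  define E where "E = (\<lambda>x y. x \<noteq> y \<and> Q \<tau> x y = 0)"
  \<comment> \<open>The two factors, with at most two solutions each, must cover the four other
    points, so each has exactly two.\<close>
  have E2: "card {y \<in> ?X. E x y} = 2" if x: "x \<in> ?X" for x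
  proof -
    have "?X - {x} = {y \<in> ?X. x \<noteq> y \<and> Q \<tau> x y = 0} \<union> {y \<in> ?X. x \<noteq> y \<and> Q \<tau>' x y = 0}"
      using Q[OF p x] by auto
    then have "card (?X - {x}) \<le> card {y \<in> ?X. x \<noteq> y \<and> Q \<tau> x y = 0} + card {y \<in> ?X. x \<noteq> y \<and> Q \<tau>' x y = 0}"
      by (simp add: card_Un_le)
    moreover have "card (?X - {x}) = 4" using card_X fin_X x by simp
    ultimately show ?thesis using le2[of x \<tau>] le2[of x \<tau>'] unfolding E_def by linarith
  qed
  have "critical_values f \<noteq> {}" using V by auto
  then have "profiles f \<noteq> {}" by (simp add: profiles_def)
  then have "{#2, 2#} \<in> profiles f" using P by blast
  then obtain \<sigma> x1 where \<sigma>: "\<sigma> \<in> fibre_monodromy f p" "x1 \<in> ?X" "\<sigma> x1 = x1" "\<sigma> \<noteq> id"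
    using fixed_point_in_monodromy[OF deg0 p, of "{#2, 2#}"] deg by auto
  have E_sym: "E y x" if "E x y" for x y using that Q_sym[of \<tau> x y] by (auto simp: E_def)
  have E_irrefl: "\<not> E x x" for x by (simp add: E_def)
  obtain x2 x3 x4 x5 where cyc: "distinct [x1, x2, x3, x4, x5]" "?X = {x1, x2, x3, x4, x5}"
    "{y \<in> ?X. E x1 y} = {x2, x5}" "{y \<in> ?X. E x2 y} = {x1, x3}" "{y \<in> ?X. E x3 y} = {x2, x4}"
    "{y \<in> ?X. E x4 y} = {x3, x5}" "{y \<in> ?X. E x5 y} = {x1, x4}"
    by (rule five_cycle_of_regular[OF fin_X card_X E_sym E_irrefl E2 \<sigma>(2)]) (assumption | rule that)+
  have E_mono: "E x y \<longleftrightarrow> E (\<rho> x) (\<rho> y)" if \<rho>: "\<rho> \<in> fibre_monodromy f p" "x \<in> ?X" "y \<in> ?X" for \<rho> x y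
  proof (cases "x = y")
    case False
    then have "\<rho> x \<noteq> \<rho> y" using inj_eq[OF permutes_inj[OF fibre_monodromy_permutes[OF deg0 \<rho>(1)]]] by simp
    moreover have "Q \<tau> (\<rho> x) (\<rho> y) = 0 \<longleftrightarrow> Q \<tau> x y = 0"
      by (rule fibre_monodromy_preserves[OF deg0 contQ contQ Q \<rho> False])
    ultimately show ?thesis using False by (simp add: E_def)
  qed (simp add: E_def)
  let ?r = "transposition x2 x5 \<circ> transposition x3 x4"
  have \<sigma>r: "\<sigma> = ?r"
    using five_cycle_automorphism[OF cyc fibre_monodromy_permutes[OF deg0 \<sigma>(1)] \<sigma>(3) E_mono[OF \<sigma>(1)]] \<sigma>(4)
    by blast
  define b where "b = (\<lambda>i::nat. [x1, x2, x3, x4, x5] ! (i - 1))"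
  have b_simps: "b 1 = x1" "b 2 = x2" "b 3 = x3" "b 4 = x4" "b 5 = x5" by (simp_all add: b_def)
  have I5: "{1..5::nat} = {1, 2, 3, 4, 5}" by auto
  have b: "bij_betw b {1..degree f} ?X"
    using cyc(1) unfolding bij_betw_def deg I5 cyc(2) by (auto simp: b_simps)
  show ?thesis
  proof (rule has_model_relation_group[where E = E and e = x1, OF b deg0 p E_mono \<sigma>(2)])
    fix \<beta> assume \<beta>: "\<beta> permutes ?X" "\<beta> x1 = x1"
      and E: "\<And>x y. x \<in> ?X \<Longrightarrow> y \<in> ?X \<Longrightarrow> E x y \<longleftrightarrow> E (\<beta> x) (\<beta> y)"
    show "\<beta> \<in> fibre_monodromy f p"
      using five_cycle_automorphism[OF cyc \<beta> E] \<sigma>r \<sigma>(1) fibre_monodromy_id[OF deg0 p] by auto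
  next
    fix i j assume ij: "i \<in> {1..degree f}" "j \<in> {1..degree f}"
    have "b j \<in> ?X" using b ij(2) unfolding bij_betw_def by blast
    then have "E (b i) (b j) \<longleftrightarrow> b j \<in> {y \<in> ?X. E (b i) y}" by simp
    moreover have "i = 1 \<or> i = 2 \<or> i = 3 \<or> i = 4 \<or> i = 5" "j = 1 \<or> j = 2 \<or> j = 3 \<or> j = 4 \<or> j = 5"
      using ij deg by auto
    moreover have "distinct [x5, x4, x3, x2, x1]" using cyc(1) by auto
    ultimately show "E (b i) (b j) \<longleftrightarrow> pentagon i j"
      using cyc(1) by (elim disjE) (simp_all add: b_simps cyc(3-7) pentagon_def)
  qed auto
qed

section \<open>Determination of the monodromy group\<close>

lemma has_model_symmetric_prime:
  assumes d: "prime (degree f)" and p: "p \<notin> critical_values f"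
    and P: "{#2#} \<in> profiles f \<or> {#2, 3#} \<in> profiles f"
  shows "has_model f p {\<tau>. \<tau> permutes {1..degree f}}"
proof -
  have deg0: "0 < degree f" using d by (rule prime_gt_0_nat)
  interpret G: transitive_perm_group "fibre_monodromy f p" "fibre f p"
    by (rule transitive_perm_group_fibre_monodromy[OF deg0 p])
  obtain u w where "u \<in> fibre f p" "w \<in> fibre f p" "u \<noteq> w" "transposition u w \<in> fibre_monodromy f p"
    using transposition_in_monodromy[OF deg0 p P] by blast
  moreover have "prime (card (fibre f p))" using d card_fibre[OF deg0 p] by simp
  ultimately show ?thesis
    using has_model_symmetric[OF deg0 p] G.all_permutations_of_transposition by blast
qed

lemma has_model_degree_1:
  assumes "degree f = 1" and p: "p \<notin> critical_values f"
  shows "has_model f p {\<tau>. \<tau> permutes {1..degree f}}"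
proof (rule has_model_symmetric[OF _ p])
  have deg0: "0 < degree f" using assms(1) by simp
  show "0 < degree f" by (rule deg0)
  obtain x where "fibre f p = {x}"
    using card_fibre[OF deg0 p] assms(1) by (auto simp: card_1_singleton_iff One_nat_def)
  then show "\<sigma> \<in> fibre_monodromy f p" if "\<sigma> permutes fibre f p" for \<sigma>
    using that fibre_monodromy_id[OF deg0 p] by simp
qed

text \<open>In order: cyclic, dihedral of order 8, alternating or dihedral of order 10, symmetric.
  The test for \<open>{#d#}\<close> comes first because a quintic with profile \<open>{#5#}\<close>
  has neither \<open>{#2#}\<close> nor \<open>{#2, 3#}\<close> either.\<close>

definition monodromy_model :: "nat \<Rightarrow> nat multiset set \<Rightarrow> (nat \<Rightarrow> nat) set" where
  "monodromy_model d P =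
    (if {#d#} \<in> P then relation_group d (\<lambda>i j. j = (if i = d then 1 else Suc i))
     else if d = 4 \<and> {#2, 2#} \<in> P then relation_group 4 (\<lambda>i j. (i, j) \<in> {(1, 2), (2, 1), (3, 4), (4, 3)})
     else if d = 5 \<and> {#2#} \<notin> P \<and> {#2, 3#} \<notin> P then
       (if {#3#} \<in> P then {\<tau>. \<tau> permutes {1..5} \<and> evenperm \<tau>} else relation_group 5 pentagon)
     else {\<tau>. \<tau> permutes {1..d}})"

text \<open>The model sees \<open>f\<close> only through its degree and profiles and
  \<open>p\<close> not at all, so one set serves for both polynomials and both base points.\<close>

lemma has_model_monodromy_model:
  assumes d: "1 \<le> degree f" "degree f \<le> 5" and p: "p \<notin> critical_values f"
  shows "has_model f p (monodromy_model (degree f) (profiles f))"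
proof (cases "{#degree f#} \<in> profiles f")
  case True
  then show ?thesis using has_model_cyclic[OF _ p True] d by (simp add: monodromy_model_def)
next
  case False
  have deg0: "0 < degree f" using d by simp
  consider "degree f = 1" | "degree f = 2" | "degree f = 3" | "degree f = 4" | "degree f = 5"
    using d by linarith
  then show ?thesis
  proof cases
    case 1
    then show ?thesis using has_model_degree_1[OF 1 p] False by (simp add: monodromy_model_def)
  next
    case 2
    \<comment> \<open>In degree 2 the profile \<open>{#2#}\<close> is total ramification, already
      covered by the cyclic case.\<close>
    then show ?thesis using profiles_degree_2[OF deg0 2] False by simp
  next
    case 3
    have "prime (3::nat)" by simp
    then show ?thesis
      using has_model_symmetric_prime[OF _ p] profiles_degree_3[OF deg0 3] False 3
      by (simp add: monodromy_model_def)
  next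
    case 4
    show ?thesis
    proof (cases "{#2, 2#} \<in> profiles f")
      case True
      then show ?thesis
        using has_model_dihedral_4[OF 4 p True] profiles_degree_4[OF deg0 4] False 4
        by (simp add: monodromy_model_def)
    next
      case no: False
      then show ?thesis
        using has_model_symmetric_4[OF 4 p] False 4 by (simp add: monodromy_model_def)
    qed
  next
    case 5
    show ?thesis
    proof (cases "{#2#} \<in> profiles f \<or> {#2, 3#} \<in> profiles f")
      case True
      have "prime (5::nat)" by simp
      then show ?thesis
        using has_model_symmetric_prime[OF _ p True] True False 5 by (auto simp: monodromy_model_def)
    next
      case no: False
      then have P: "profiles f \<subseteq> {{#3#}, {#2, 2#}}" "card (critical_values f) = 2"
        using profiles_degree_5[OF deg0 5] False 5 by simp_all
      show ?thesis
      proof (cases "{#3#} \<in> profiles f")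
        case True
        then show ?thesis
          using has_model_alternating_5[OF 5 p P(1) True] no False 5 by (simp add: monodromy_model_def)
      next
        case False
        then have "profiles f \<subseteq> {{#2, 2#}}" using P(1) by blast
        then show ?thesis
          using has_model_dihedral_5[OF 5 p _ P(2)] no \<open>{#degree f#} \<notin> profiles f\<close> False 5
          by (simp add: monodromy_model_def)
      qed
    qed
  qed
qed

theorem theorem2p1:
  fixes f g :: "complex poly" and d :: nat
    and p q :: complex and b c :: "nat \<Rightarrow> complex"
  assumes "degree f = d" and "degree g = d" and "1 \<le> d" and "d \<le> 5"
    and "identical_critical_portraits f g"
    and "p \<notin> critical_values f" and "bij_betw b {1..d} (fibre f p)"
    and "q \<notin> critical_values g" and "bij_betw c {1..d} (fibre g q)"
  shows "conjugate_subgroups (sym_group d) (monodromy_group f p b) (monodromy_group g q c)"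
proof -
  let ?K = "monodromy_model d (profiles f)"
  have "has_model f p ?K" using has_model_monodromy_model[of f p] assms by simp
  then obtain b0 where b0: "bij_betw b0 {1..d} (fibre f p)" "monodromy_group f p b0 = ?K"
    unfolding has_model_def assms(1) by blast
  have "has_model g q ?K"
    using has_model_monodromy_model[of g q] assms profiles_eq[OF assms(5)] by simp
  then obtain c0 where c0: "bij_betw c0 {1..d} (fibre g q)" "monodromy_group g q c0 = ?K"
    unfolding has_model_def assms(2) by blast
  show ?thesis
    by (rule conjugate_monodromy_groups[where ?b0.0 = b0 and ?c0.0 = c0])
      (use assms b0 c0 in auto)
qed

end
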